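(* Let $(E,\Delta)$ be a complete separable metric space. Let $\xi=(\xi_{tx}:(t,x)\in[0,1]\times F)$ be an $E$-valued process indexed by $[0,1]\times F$ and let $C,\beta,\gamma,\gamma'>0$ be such that $$\mathbb E\left[\Delta(\xi_{tx},\xi_{ty})^\beta\right]\le C\,R(x,y)^{d_H+1+\gamma},\qquad \mathbb E\left[\Delta(\xi_{sx},\xi_{tx})^\beta\right]\le C\,|s-t|^{d_H+1+\gamma'}$$ for all $s,t\in[0,1]$ and all $x,y\in F$. Then there exists a version $\hat\xi=(\hat\xi_{tx}:(t,x)\in[0,1]\times F)$ of $\xi$ which satisfies the following: (1) The map $(t,x)\mapsto\hat\xi_{tx}$ is almost surely essentially $\delta_0$-Hölder continuous with respect to $R_\infty$, where $\delta_0=\frac1\beta(\gamma\wedge\gamma')$. (2) For every $t\in[0,1]$ the map $x\mapsto\hat\xi_{tx}$ is almost surely essentially $\delta_1$-Hölder continuous with respect to $R$, where $\delta_1=\frac1\beta(1+\gamma)$. (3) For every $x\in F$ the map $t\mapsto\hat\xi_{tx}$ is almost surely essentially $\delta_2$-Hölder continuous with respect to the Euclidean metric, where $\delta_2=\frac1\beta(d_H+\gamma')$.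
   Context: Setting. Let $M\ge2$, $I=\{1,\dots,M\}$, let $F$ be a connected compact metric space and $\psi_i:F\to F$ ($i\in I$) injective strict contractions with $F=\bigcup_i\psi_i(F)$. Let $\mathbb W_n=I^n$ ($\mathbb W_0$ contains only the empty word), $\mathbb W_*=\bigcup_{n\ge0}\mathbb W_n$, $\mathbb W=I^{\mathbb N}$. For $w=w_1\dots w_n\in\mathbb W_*$ put $\psi_w=\psi_{w_1}\circ\dots\circ\psi_{w_n}$, $F_w=\psi_w(F)$. Let $\pi:\mathbb W\to F$ be given by $\{\pi(w)\}=\bigcap_nF_{w_1\dots w_n}$. With $\sigma$ the left shift on $\mathbb W$, the post-critical set is $P=\bigcup_{n\ge1}\sigma^n\big(\pi^{-1}(\bigcup_{i\ne j}F_i\cap F_j)\big)$; assume $P$ is finite (so $(F,(\psi_i))$ is a connected post-critically finite self-similar set). Put $F^0=\pi(P)$, $F^n=\bigcup_{w\in\mathbb W_n}\psi_w(F^0)$. Let $(A_0,\mathbf r)$ be a regular irreducible harmonic structure: $\mathbf r=(r_1,\dots,r_M)$ with all $r_i\in(0,1)$; $A_0$ is a real symmetric matrix indexed by $F^0$, non-positive definite, with non-negative off-diagonal entries and kernel exactly the constants; and, with $\mathcal E_0(f,g)=-\sum_{x,y\in F^0}f(x)A_0(x,y)g(y)$, $r_w=\prod_ir_{w_i}$ and $\mathcal E_n(f,g)=\sum_{w\in\mathbb W_n}r_w^{-1}\mathcal E_0(f\circ\psi_w|_{F^0},g\circ\psi_w|_{F^0})$ for $f,g:F^n\to\mathbb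 R$, one has $\mathcal E_0(f,f)=\min\{\mathcal E_1(g,g):g|_{F^0}=f\}$ for all $f$. Let $\mathcal D=\{f\in C(F):\lim_n\mathcal E_n(f|_{F^n},f|_{F^n})<\infty\}$ and $\mathcal E(f,g)=\lim_n\mathcal E_n(f|_{F^n},g|_{F^n})$. The resistance metric is $R(x,y)=(\inf\{\mathcal E(f,f):f\in\mathcal D,f(x)=0,f(y)=1\})^{-1}$ for $x\neq y$, $R(x,x)=0$; it induces the topology of $F$. Let $d_H>0$ be the unique number with $\sum_ir_i^{d_H}=1$. On $\mathbb R\times F$ put $R_\infty((s,x),(t,y))=\max\{|s-t|,R(x,y)\}$. A version of $\xi$ is a process on the same probability space and index set agreeing with $\xi$ almost surely at each index. A continuous map $f$ between metric spaces $(M_1,d_1),(M_2,d_2)$ is essentially $\delta$-Hölder continuous ($\delta>0$) if for every $\eta\in(0,\delta)$ there is a constant $\epsilon_\eta$ with $d_2(f(x),f(y))\le\epsilon_\eta d_1(x,y)^\eta$ for all $x,y$. *)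

theory Defs
  imports "HOL-Probability.Probability"
begin

section \<open>Post-critically finite self-similar sets\<close>

text \<open>
  The space is the subset \<open>F\<close> of an ambient metric type; the maps \<open>\<psi> i\<close> matter only on \<open>F\<close> and
  for \<open>1 \<le> i \<le> M\<close>.  Finite words are lists.  An infinite word \<open>w\<^sub>1 w\<^sub>2 \<dots>\<close> is a function \<open>w\<close> on the
  naturals, indexed from \<open>0\<close>: the letter \<open>w\<^sub>k\<close> is \<open>w (k - 1)\<close>.
\<close>

locale ifs =
  fixes F :: "'a::metric_space set" and M :: nat and \<psi> :: "nat \<Rightarrow> 'a \<Rightarrow> 'a"
begin

definition words :: "nat \<Rightarrow> nat list set" where
  "words n = {w. length w = n \<and> set w \<subseteq> {1..M}}"

definition inf_words :: "(nat \<Rightarrow> nat) set" where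
  "inf_words = {w. range w \<subseteq> {1..M}}"

definition word_map :: "nat list \<Rightarrow> 'a \<Rightarrow> 'a" where
  "word_map w = foldr (\<lambda>i f. \<psi> i \<circ> f) w id"

definition cell :: "nat list \<Rightarrow> 'a set" where
  "cell w = word_map w ` F"

definition coding :: "(nat \<Rightarrow> nat) \<Rightarrow> 'a" where
  "coding w = (THE x. (\<Inter>n. cell (map w [0..<n])) = {x})"

definition shift :: "(nat \<Rightarrow> nat) \<Rightarrow> nat \<Rightarrow> nat" where
  "shift w = (\<lambda>n. w (Suc n))"

definition critical_set :: "(nat \<Rightarrow> nat) set" where
  "critical_set = {w \<in> inf_words. coding w \<in> (\<Union>i\<in>{1..M}. \<Union>j\<in>{1..M} - {i}. \<psi> i ` F \<inter> \<psi> j ` F)}"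

definition post_critical_set :: "(nat \<Rightarrow> nat) set" where
  "post_critical_set = (\<Union>n\<in>{1..}. (shift ^^ n) ` critical_set)"

definition boundary :: "'a set" where
  "boundary = coding ` post_critical_set"

end

locale pcf_self_similar_set = ifs F M \<psi>
  for F :: "'a::metric_space set" and M :: nat and \<psi> :: "nat \<Rightarrow> 'a \<Rightarrow> 'a" +
  assumes two_le_M: "2 \<le> M"
    and F_nonempty: "F \<noteq> {}"
    and compact_F: "compact F"
    and connected_F: "connected F"
    and maps_F: "i \<in> {1..M} \<Longrightarrow> \<psi> i ` F \<subseteq> F"
    and inj_\<psi>: "i \<in> {1..M} \<Longrightarrow> inj_on (\<psi> i) F"
    and contraction_\<psi>: "i \<in> {1..M} \<Longrightarrow> \<exists>c. 0 \<le> c \<and> c < 1 \<and> c-lipschitz_on F (\<psi> i)"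
    and self_similar: "F = (\<Union>i\<in>{1..M}. \<psi> i ` F)"
    and finite_post_critical: "finite post_critical_set"

section \<open>Harmonic structures and the resistance metric\<close>

text \<open>
  Functions on \<open>F\<close>, or on a finite set \<open>F\<^sup>n\<close> of vertices, are represented by functions on the whole
  type; the forms and spaces below look only at their values on the set in question.
\<close>

locale energy_form = ifs F M \<psi>
  for F :: "'a::metric_space set" and M :: nat and \<psi> :: "nat \<Rightarrow> 'a \<Rightarrow> 'a" +
  fixes A\<^sub>0 :: "'a \<Rightarrow> 'a \<Rightarrow> real" and r :: "nat \<Rightarrow> real"
begin

definition energy0 :: "('a \<Rightarrow> real) \<Rightarrow> ('a \<Rightarrow> real) \<Rightarrow> real" where
  "energy0 f g = - (\<Sum>x\<in>boundary. \<Sum>y\<in>boundary. f x * A\<^sub>0 x y * g y)"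

definition r_word :: "nat list \<Rightarrow> real" where
  "r_word w = prod_list (map r w)"

definition energy_n :: "nat \<Rightarrow> ('a \<Rightarrow> real) \<Rightarrow> ('a \<Rightarrow> real) \<Rightarrow> real" where
  "energy_n n f g = (\<Sum>w\<in>words n. inverse (r_word w) * energy0 (f \<circ> word_map w) (g \<circ> word_map w))"

text \<open>The energies are nonnegative, so a finite limit is the same as convergence in the reals.\<close>

definition form_domain :: "('a \<Rightarrow> real) set" where
  "form_domain = {f. continuous_on F f \<and> convergent (\<lambda>n. energy_n n f f)}"

definition energy :: "('a \<Rightarrow> real) \<Rightarrow> ('a \<Rightarrow> real) \<Rightarrow> real" where
  "energy f g = lim (\<lambda>n. energy_n n f g)"

text \<open>
  For a regular irreducible harmonic structure and distinct points of \<open>F\<close> the infimum is over a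
  nonempty set and is positive, so computing it and its inverse in the reals loses nothing.
\<close>

definition resistance :: "'a \<Rightarrow> 'a \<Rightarrow> real" where
  "resistance x y =
     (if x = y then 0 else inverse (Inf {energy f f | f. f \<in> form_domain \<and> f x = 0 \<and> f y = 1}))"

definition resistance_max :: "real \<times> 'a \<Rightarrow> real \<times> 'a \<Rightarrow> real" where
  "resistance_max = (\<lambda>(s, x) (t, y). max \<bar>s - t\<bar> (resistance x y))"

definition dim_H :: real where
  "dim_H = (THE d. 0 < d \<and> (\<Sum>i\<in>{1..M}. r i powr d) = 1)"

end

locale regular_irreducible_harmonic_structure =
  pcf_self_similar_set F M \<psi> + energy_form F M \<psi> A\<^sub>0 r
  for F :: "'a::metric_space set" and M :: nat and \<psi> :: "nat \<Rightarrow> 'a \<Rightarrow> 'a"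
    and A\<^sub>0 :: "'a \<Rightarrow> 'a \<Rightarrow> real" and r :: "nat \<Rightarrow> real" +
  assumes r_bounds: "i \<in> {1..M} \<Longrightarrow> 0 < r i \<and> r i < 1"
    and symmetric: "x \<in> boundary \<Longrightarrow> y \<in> boundary \<Longrightarrow> A\<^sub>0 x y = A\<^sub>0 y x"
    and nonpositive_definite: "(\<Sum>x\<in>boundary. \<Sum>y\<in>boundary. f x * A\<^sub>0 x y * f y) \<le> 0"
    and off_diagonal: "x \<in> boundary \<Longrightarrow> y \<in> boundary \<Longrightarrow> x \<noteq> y \<Longrightarrow> 0 \<le> A\<^sub>0 x y"
    and kernel: "(\<forall>x\<in>boundary. (\<Sum>y\<in>boundary. A\<^sub>0 x y * f y) = 0) \<longleftrightarrow> (\<exists>c. \<forall>x\<in>boundary. f x = c)"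
    \<comment> \<open>\<open>\<E>\<^sub>0(f,f)\<close> is the (attained) minimum of \<open>\<E>\<^sub>1\<close> over all extensions of \<open>f\<close>\<close>
    and minimum_attained: "\<exists>g. (\<forall>x\<in>boundary. g x = f x) \<and> energy_n 1 g g = energy0 f f"
    and minimum_le: "(\<forall>x\<in>boundary. g x = f x) \<Longrightarrow> energy0 f f \<le> energy_n 1 g g"

section \<open>Versions of processes and essential Hoelder continuity\<close>

definition stochastic_process ::
    "'w measure \<Rightarrow> 'i set \<Rightarrow> ('i \<Rightarrow> 'w \<Rightarrow> 'e::topological_space) \<Rightarrow> bool" where
  "stochastic_process \<Omega> T X \<longleftrightarrow> (\<forall>i\<in>T. X i \<in> borel_measurable \<Omega>)"

definition version_of ::
    "'w measure \<Rightarrow> 'i set \<Rightarrow> ('i \<Rightarrow> 'w \<Rightarrow> 'e::topological_space) \<Rightarrow> ('i \<Rightarrow> 'w \<Rightarrow> 'e) \<Rightarrow> bool" where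
  "version_of \<Omega> T X Y \<longleftrightarrow> stochastic_process \<Omega> T Y \<and> (\<forall>i\<in>T. AE \<omega> in \<Omega>. Y i \<omega> = X i \<omega>)"

text \<open>
  The distance \<open>d\<close> on \<open>S\<close> is an argument, since the relevant metrics are not those of the type.
  The first conjunct after \<open>0 < \<delta>\<close> is continuity with respect to \<open>d\<close>.
\<close>

definition ess_holder_on ::
    "real \<Rightarrow> 'b set \<Rightarrow> ('b \<Rightarrow> 'b \<Rightarrow> real) \<Rightarrow> ('b \<Rightarrow> 'e::metric_space) \<Rightarrow> bool" where
  "ess_holder_on \<delta> S d f \<longleftrightarrow>
     0 < \<delta> \<and>
     (\<forall>x\<in>S. \<forall>e>0. \<exists>h>0. \<forall>y\<in>S. d x y < h \<longrightarrow> dist (f x) (f y) < e) \<and>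
     (\<forall>\<eta>. 0 < \<eta> \<and> \<eta> < \<delta> \<longrightarrow> (\<exists>c. \<forall>x\<in>S. \<forall>y\<in>S. dist (f x) (f y) \<le> c * d x y powr \<eta>))"

end

theory Submission
  imports Defs
begin

text \<open>
  The theorem is an instance of a Kolmogorov--Chentsov criterion in a pseudometric space whose
  covering numbers satisfy \<open>N \<epsilon> \<le> K * \<epsilon> powr (- d)\<close>: if the \<open>\<beta>\<close>-th moment of the increments is at most
  \<open>C * \<rho> s t powr \<theta>\<close> with \<open>\<theta> > d\<close>, there is a version that is Hoelder continuous of every order below
  \<open>(\<theta> - d) / \<beta>\<close> (\<open>holder_version\<close>).  On the product of the unit interval and \<open>F\<close> the dimension is
  \<open>dim_H + 1\<close> and \<open>\<theta> = dim_H + 1 + min \<gamma> \<gamma>'\<close>, which gives part (1).  The sections of the resulting version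
  are continuous and satisfy the original moment bounds over spaces of dimensions \<open>dim_H\<close> and \<open>1\<close>, so
  without a further change they have the larger exponents of (2) and (3)
  (\<open>continuous_process_holder\<close>).

  The criterion is proved by chaining along nets of the scales \<open>(1 / 2) ^ n\<close>.  Two nearby points
  descend to close points of a common net, and increments between close points of a net have to be
  bounded uniformly.  A bound on covering numbers leaves room for quadratically many such pairs.
  By \<open>sparse_pairs\<close> they can be joined by linearly many pairs whose distances are larger by a factor
  logarithmic in the size of the net, that is, linear in \<open>n\<close>; such a factor does not affect the
  exponents.

  For \<open>F\<close> with the resistance metric, a cell has diameter at most a constant times its weight \<open>r_word w\<close>
  (\<open>resistance_cell_bound\<close>).  This combines the scaling of the energy with the bound
  \<open>(f x - f y)\<^sup>2 \<le> K * energy f f\<close>, which is a geometric series along the cells that shrink to a point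
  (\<open>energy_controls_oscillation\<close>).  As the numbers \<open>r i powr dim_H\<close> sum to one, a constant times
  \<open>\<epsilon> powr (- dim_H)\<close> cells of weight at most \<open>\<epsilon>\<close> cover \<open>F\<close> (\<open>resistance_entropy\<close>).

  All this presupposes that the infimum defining the resistance is over a nonempty set, that is, that
  continuous functions of finite energy separate points (\<open>form_domain_separates\<close>).  They are
  constructed by harmonic extension along codes: the minimisers of the harmonic structure are
  iterated, their oscillations shrink like the square root of the weight, and different codes of
  one point agree because cells meet only at vertices.  The triangle inequality for the resistance
  comes from cutting a function at one of its levels (\<open>resistance_triangle\<close>).
\<close>

section \<open>Words, cells and the coding map\<close>

context ifs begin

lemma word_map_Nil [simp]: "word_map [] = id"
  by (simp add: word_map_def)

lemma word_map_Cons [simp]: "word_map (i # w) = \<psi> i \<circ> word_map w"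
  by (simp add: word_map_def)

lemma word_map_append: "word_map (u @ v) = word_map u \<circ> word_map v"
  by (induction u) (auto simp: fun_eq_iff)

lemma shift_apply: "shift \<tau> k = \<tau> (Suc k)"
  by (simp add: shift_def)

lemma funpow_shift: "(shift ^^ n) \<tau> k = \<tau> (k + n)"
  by (induction n arbitrary: k) (auto simp: shift_apply)

lemma prefix_Suc: "map \<tau> [0..<Suc n] = \<tau> 0 # map (shift \<tau>) [0..<n]"
  by (simp add: map_upt_Suc shift_apply del: upt_Suc)

lemma inf_wordsD: "\<tau> \<in> inf_words \<Longrightarrow> \<tau> k \<in> {1..M}"
  unfolding inf_words_def by blast

lemma shift_inf_words: "\<tau> \<in> inf_words \<Longrightarrow> shift \<tau> \<in> inf_words"
  by (auto simp: inf_words_def shift_apply)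

lemma prefix_in_words: "\<tau> \<in> inf_words \<Longrightarrow> map \<tau> [0..<n] \<in> words n"
  by (auto simp: words_def inf_words_def)

lemma case_nat_inf_words: "i \<in> {1..M} \<Longrightarrow> \<tau> \<in> inf_words \<Longrightarrow> case_nat i \<tau> \<in> inf_words"
  by (simp add: inf_words_def image_subset_iff split: nat.splits)

lemma shift_case_nat [simp]: "shift (case_nat i \<tau>) = \<tau>"
  by (simp add: shift_def fun_eq_iff)

lemma finite_words: "finite (words n)"
  unfolding words_def using finite_lists_length_eq[of "{1..M}" n] by (simp add: conj_commute)

lemma words_0: "words 0 = {[]}"
  by (auto simp: words_def)

lemma words_Suc: "words (Suc n) = (\<lambda>(i, w). i # w) ` ({1..M} \<times> words n)"
  by (force simp: words_def length_Suc_conv)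

end

context pcf_self_similar_set begin

lemma psi_in_F: "i \<in> {1..M} \<Longrightarrow> x \<in> F \<Longrightarrow> \<psi> i x \<in> F"
  using maps_F by blast

lemma word_map_in_F: "set w \<subseteq> {1..M} \<Longrightarrow> x \<in> F \<Longrightarrow> word_map w x \<in> F"
proof (induction w)
  case (Cons i w)
  then show ?case using psi_in_F[of i "word_map w x"] by simp
qed simp

lemma uniform_contraction:
  obtains c where "0 \<le> c" "c < 1" "\<And>i. i \<in> {1..M} \<Longrightarrow> c-lipschitz_on F (\<psi> i)"
proof -
  have "\<forall>i. \<exists>c. i \<in> {1..M} \<longrightarrow> 0 \<le> c \<and> c < 1 \<and> (c)-lipschitz_on F (\<psi> i)"
    using contraction_\<psi> by meson
  then obtain c where c: "\<And>i. i \<in> {1..M} \<Longrightarrow> 0 \<le> c i \<and> c i < 1 \<and> (c i)-lipschitz_on F (\<psi> i)"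
    by (metis (no_types))
  define m where "m = Max (c ` {1..M})"
  have ge: "c i \<le> m" if "i \<in> {1..M}" for i using that by (auto simp: m_def)
  have "m \<in> c ` {1..M}" unfolding m_def using two_le_M by (intro Max_in) auto
  then have "0 \<le> m" "m < 1" using c by auto
  moreover have "m-lipschitz_on F (\<psi> i)" if "i \<in> {1..M}" for i
    using c[OF that] ge[OF that] lipschitz_on_le by blast
  ultimately show ?thesis using that by blast
qed

lemma continuous_on_psi: "i \<in> {1..M} \<Longrightarrow> continuous_on F (\<psi> i)"
  using contraction_\<psi> lipschitz_on_continuous_on by blast

lemma continuous_on_word_map: "set w \<subseteq> {1..M} \<Longrightarrow> continuous_on F (word_map w)"
proof (induction w)
  case (Cons i w)
  have "continuous_on (word_map w ` F) (\<psi> i)"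
    using word_map_in_F[of w] continuous_on_psi[of i] Cons.prems
    by (auto elim!: continuous_on_subset)
  with Cons show ?case unfolding word_map_Cons by (intro continuous_on_compose) auto
qed auto

lemma cell_subset: "set w \<subseteq> {1..M} \<Longrightarrow> cell w \<subseteq> F"
  using word_map_in_F by (auto simp: cell_def)

lemma compact_cell: "set w \<subseteq> {1..M} \<Longrightarrow> compact (cell w)"
  unfolding cell_def by (intro compact_continuous_image continuous_on_word_map compact_F)

text \<open>
  A largest contraction ratio exists because there are finitely many maps, and an \<open>n\<close>-fold
  composition contracts by its \<open>n\<close>-th power.
\<close>

lemma cells_shrink:
  assumes "0 < (e::real)"
  obtains n where "\<And>w x y. w \<in> words n \<Longrightarrow> x \<in> cell w \<Longrightarrow> y \<in> cell w \<Longrightarrow> dist x y < e"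
proof -
  obtain c where c: "0 \<le> c" "c < 1" "\<And>i. i \<in> {1..M} \<Longrightarrow> c-lipschitz_on F (\<psi> i)"
    by (rule uniform_contraction) blast
  have *: "dist (word_map w x) (word_map w y) \<le> c ^ length w * dist x y"
    if "set w \<subseteq> {1..M}" "x \<in> F" "y \<in> F" for w x y
    using that
  proof (induction w)
    case (Cons i w)
    have "dist (word_map (i # w) x) (word_map (i # w) y) \<le> c * dist (word_map w x) (word_map w y)"
      using lipschitz_onD[OF c(3)[of i], of "word_map w x" "word_map w y"] Cons.prems
        word_map_in_F[of w x] word_map_in_F[of w y] by simp
    also have "\<dots> \<le> c * (c ^ length w * dist x y)"
      using Cons c(1) by (intro mult_left_mono) auto
    finally show ?case by (simp add: mult.assoc)
  qed auto
  have bdd: "bounded F" using compact_F by (rule compact_imp_bounded)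
  have "(\<lambda>n. c ^ n * diameter F) \<longlonglongrightarrow> 0 * diameter F"
    using c by (intro tendsto_mult tendsto_const LIMSEQ_power_zero) auto
  then have "\<forall>\<^sub>F n in sequentially. c ^ n * diameter F < e"
    using assms by (intro order_tendstoD(2)) auto
  then obtain n where n: "c ^ n * diameter F < e"
    by (auto simp: eventually_sequentially)
  show ?thesis
  proof (rule that[of n])
    fix w x y assume "w \<in> words n" "x \<in> cell w" "y \<in> cell w"
    then obtain x' y' where xy: "x' \<in> F" "y' \<in> F" "x = word_map w x'" "y = word_map w y'"
      and w: "length w = n" "set w \<subseteq> {1..M}" by (auto simp: cell_def words_def)
    have "dist x y \<le> c ^ n * dist x' y'" using *[OF w(2) xy(1,2)] xy w by simp
    also have "\<dots> \<le> c ^ n * diameter F"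
      using c xy bdd by (intro mult_left_mono diameter_bounded_bound) auto
    finally show "dist x y < e" using n by simp
  qed
qed

lemma cell_prefix_mono:
  assumes "\<tau> \<in> inf_words" "m \<le> n" shows "cell (map \<tau> [0..<n]) \<subseteq> cell (map \<tau> [0..<m])"
proof -
  have "map \<tau> [0..<n] = map \<tau> [0..<m] @ map \<tau> [m..<n]"
    using assms(2) by (metis map_append upt_add_eq_append le_add_diff_inverse zero_le)
  moreover have "set (map \<tau> [m..<n]) \<subseteq> {1..M}" using inf_wordsD[OF assms(1)] by auto
  ultimately show ?thesis
    using word_map_in_F[of "map \<tau> [m..<n]"] by (auto simp: cell_def word_map_append)
qed

text \<open>
  Uniqueness comes from the shrinking of the cells.  Once existence is known, the description
  operator in the definition of \<open>coding\<close> is justified.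
\<close>

lemma coding_eqI:
  assumes \<tau>: "\<tau> \<in> inf_words" and x: "\<And>n. x \<in> cell (map \<tau> [0..<n])"
  shows "coding \<tau> = x"
proof -
  have "y = x" if y: "\<And>n. y \<in> cell (map \<tau> [0..<n])" for y
  proof (rule ccontr)
    assume "y \<noteq> x"
    then have "0 < dist y x" by simp
    then obtain n where "\<And>w x' y'. w \<in> words n \<Longrightarrow> x' \<in> cell w \<Longrightarrow> y' \<in> cell w \<Longrightarrow> dist x' y' < dist y x"
      by (rule cells_shrink) blast
    then have "dist y x < dist y x" using prefix_in_words[OF \<tau>] x y by blast
    then show False by simp
  qed
  then have "(\<Inter>n. cell (map \<tau> [0..<n])) = {x}" using x by auto
  then show ?thesis unfolding coding_def by auto
qed

text \<open>
  The cells along a code are nested closed subsets of a compact set.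
\<close>

lemma coding_in_cell:
  assumes \<tau>: "\<tau> \<in> inf_words" shows "coding \<tau> \<in> cell (map \<tau> [0..<n])"
proof -
  have s: "set (map \<tau> [0..<n]) \<subseteq> {1..M}" for n using inf_wordsD[OF \<tau>] by auto
  have "F \<inter> (\<Inter>n\<in>UNIV. cell (map \<tau> [0..<n])) \<noteq> {}"
  proof (rule compact_imp_fip_image[OF compact_F])
    show "closed (cell (map \<tau> [0..<n]))" for n by (intro compact_imp_closed compact_cell s)
    fix N :: "nat set" assume "finite N"
    then obtain m where m: "\<And>n. n \<in> N \<Longrightarrow> n \<le> m" using finite_nat_set_iff_bounded_le by auto
    obtain x where "x \<in> cell (map \<tau> [0..<m])" using F_nonempty by (auto simp: cell_def)
    then have "x \<in> F \<inter> (\<Inter>n\<in>N. cell (map \<tau> [0..<n]))"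
      using cell_prefix_mono[OF \<tau> m] cell_subset[OF s, of m] by blast
    then show "F \<inter> (\<Inter>n\<in>N. cell (map \<tau> [0..<n])) \<noteq> {}" by blast
  qed
  then obtain x where "\<And>n. x \<in> cell (map \<tau> [0..<n])" by auto
  then show ?thesis using coding_eqI[OF \<tau>] by metis
qed

lemma coding_in_F: "\<tau> \<in> inf_words \<Longrightarrow> coding \<tau> \<in> F"
  using coding_in_cell[of \<tau> 0] by (simp add: cell_def)

lemma coding_shift: assumes \<tau>: "\<tau> \<in> inf_words" shows "coding \<tau> = \<psi> (\<tau> 0) (coding (shift \<tau>))"
proof (rule coding_eqI[OF \<tau>])
  fix n
  have "\<psi> (\<tau> 0) (coding (shift \<tau>)) \<in> cell (map \<tau> [0..<Suc n])"
    using coding_in_cell[OF shift_inf_words[OF \<tau>], of n] unfolding prefix_Suc cell_def by auto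
  then show "\<psi> (\<tau> 0) (coding (shift \<tau>)) \<in> cell (map \<tau> [0..<n])"
    using cell_prefix_mono[OF \<tau>, of n "Suc n"] by auto
qed

text \<open>
  Each point has a letter and a preimage under the map of that letter; iterating the choice of
  preimages reads off a code.
\<close>

lemma coding_surj:
  assumes "x \<in> F" obtains \<tau> where "\<tau> \<in> inf_words" "coding \<tau> = x"
proof -
  have "\<forall>x. \<exists>p. x \<in> F \<longrightarrow> fst p \<in> {1..M} \<and> snd p \<in> F \<and> x = \<psi> (fst p) (snd p)"
    using self_similar by fastforce
  then obtain S where S: "\<And>x. x \<in> F \<Longrightarrow> fst (S x) \<in> {1..M} \<and> snd (S x) \<in> F \<and> x = \<psi> (fst (S x)) (snd (S x))"
    by (metis (no_types))
  define I N where "I x = fst (S x)" and "N x = snd (S x)" for x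
  have I: "I x \<in> {1..M} \<and> N x \<in> F \<and> x = \<psi> (I x) (N x)" if "x \<in> F" for x
    using S[OF that] by (simp add: I_def N_def)
  define \<tau> where "\<tau> x = (\<lambda>n. I ((N ^^ n) x))" for x
  have inF: "(N ^^ n) x \<in> F" if "x \<in> F" for n x using that I by (induction n) auto
  have sh: "shift (\<tau> x) = \<tau> (N x)" for x by (simp add: fun_eq_iff shift_apply \<tau>_def funpow_swap1)
  have cell: "x \<in> cell (map (\<tau> x) [0..<n])" if "x \<in> F" for x n
    using that
  proof (induction n arbitrary: x)
    case (Suc n)
    have N: "N x \<in> F" "x = \<psi> (\<tau> x 0) (N x)" using I[OF Suc.prems] by (auto simp: \<tau>_def)
    from Suc.IH[OF N(1)] obtain y where "y \<in> F" "N x = word_map (map (\<tau> (N x)) [0..<n]) y"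
      by (auto simp: cell_def)
    then have "y \<in> F" "x = word_map (map (\<tau> x) [0..<Suc n]) y"
      using N(2) unfolding prefix_Suc sh by auto
    then show ?case unfolding cell_def by blast
  qed (simp add: cell_def)
  have "\<tau> x \<in> inf_words" using I inF[OF assms] by (auto simp: inf_words_def \<tau>_def)
  with cell[OF assms] coding_eqI that show ?thesis by blast
qed

lemma post_critical_inf_words: "\<tau> \<in> post_critical_set \<Longrightarrow> \<tau> \<in> inf_words"
proof -
  assume "\<tau> \<in> post_critical_set"
  then obtain n \<kappa> where "\<kappa> \<in> inf_words" "\<tau> = (shift ^^ n) \<kappa>"
    by (auto simp: post_critical_set_def critical_set_def)
  then show ?thesis by (auto simp add: inf_words_def funpow_shift image_subset_iff)
qed

lemma shift_post_critical: "\<tau> \<in> post_critical_set \<Longrightarrow> shift \<tau> \<in> post_critical_set"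
proof -
  assume "\<tau> \<in> post_critical_set"
  then obtain n \<kappa> where n: "n \<ge> 1" "\<kappa> \<in> critical_set" "\<tau> = (shift ^^ n) \<kappa>"
    by (auto simp: post_critical_set_def)
  then have "shift \<tau> = (shift ^^ Suc n) \<kappa>" "Suc n \<in> {1..}" by auto
  with n(2) show ?thesis unfolding post_critical_set_def by blast
qed

text \<open>
  The common point lies in two different first-level cells, so its codes are critical.
\<close>

lemma shift_post_criticalI:
  assumes "\<tau> \<in> inf_words" "\<tau>' \<in> inf_words" "coding \<tau> = coding \<tau>'" "\<tau> 0 \<noteq> \<tau>' 0"
  shows "shift \<tau> \<in> post_critical_set"
proof -
  have in_image: "coding \<kappa> \<in> \<psi> (\<kappa> 0) ` F" if "\<kappa> \<in> inf_words" for \<kappa>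
    using coding_shift[OF that] coding_in_F[OF shift_inf_words[OF that]] by blast
  have "coding \<tau> \<in> \<psi> (\<tau> 0) ` F" "coding \<tau> \<in> \<psi> (\<tau>' 0) ` F"
    using in_image[OF assms(1)] in_image[OF assms(2)] assms(3) by auto
  then have "\<tau> \<in> critical_set"
    using assms inf_wordsD[OF assms(1), of 0] inf_wordsD[OF assms(2), of 0]
    unfolding critical_set_def by blast
  moreover have "shift \<tau> = (shift ^^ 1) \<tau>" "(1::nat) \<in> {1..}" by auto
  ultimately show ?thesis unfolding post_critical_set_def by blast
qed

lemma finite_boundary: "finite boundary"
  using finite_post_critical by (simp add: boundary_def)

lemma boundary_subset_F: "boundary \<subseteq> F"
  using coding_in_F post_critical_inf_words by (auto simp: boundary_def)

text \<open>
  The post-critical set is shift invariant.  Hence every boundary point is also a vertex of some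
  first-level cell.
\<close>

lemma boundary_preimage:
  assumes "p \<in> boundary" obtains i q where "i \<in> {1..M}" "q \<in> boundary" "p = \<psi> i q"
proof -
  obtain \<tau> where \<tau>: "\<tau> \<in> post_critical_set" "p = coding \<tau>" using assms by (auto simp: boundary_def)
  show ?thesis
  proof (rule that)
    show "\<tau> 0 \<in> {1..M}" using \<tau> post_critical_inf_words inf_wordsD by blast
    show "coding (shift \<tau>) \<in> boundary" using \<tau> shift_post_critical by (auto simp: boundary_def)
    show "p = \<psi> (\<tau> 0) (coding (shift \<tau>))" using \<tau> coding_shift post_critical_inf_words by auto
  qed
qed

text \<open>
  A common point of two cells has two codes with different first letters.  Consequently functions
  that are prescribed cell by cell only have to agree at vertices.
\<close>

lemma cells_meet_in_boundary:
  assumes "i \<in> {1..M}" "j \<in> {1..M}" "i \<noteq> j" "\<psi> i ` F \<inter> \<psi> j ` F \<noteq> {}"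
  obtains p q where "p \<in> boundary" "q \<in> boundary" "\<psi> i p = \<psi> j q"
proof -
  obtain x y where xy: "x \<in> F" "y \<in> F" "\<psi> i x = \<psi> j y" using assms by auto
  obtain \<sigma> where s: "\<sigma> \<in> inf_words" "coding \<sigma> = x" using xy(1) by (rule coding_surj)
  obtain \<tau> where t: "\<tau> \<in> inf_words" "coding \<tau> = y" using xy(2) by (rule coding_surj)
  have w: "case_nat i \<sigma> \<in> inf_words" "case_nat j \<tau> \<in> inf_words"
    using s t assms case_nat_inf_words by auto
  have "coding (case_nat i \<sigma>) = coding (case_nat j \<tau>)"
    using coding_shift[OF w(1)] coding_shift[OF w(2)] s t xy by simp
  then have "\<sigma> \<in> post_critical_set" "\<tau> \<in> post_critical_set"
    using shift_post_criticalI[OF w] shift_post_criticalI[OF w(2,1)] assms by auto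
  with s t xy that show ?thesis by (auto simp: boundary_def)
qed

text \<open>
  Otherwise the cells in \<open>A\<close> and the remaining cells would split \<open>F\<close> into two disjoint closed parts.
\<close>

lemma cells_connected:
  assumes "A \<subseteq> {1..M}" "A \<noteq> {}" "A \<noteq> {1..M}"
  obtains i j where "i \<in> A" "j \<in> {1..M} - A" "\<psi> i ` F \<inter> \<psi> j ` F \<noteq> {}"
proof -
  have cl: "closed (\<Union>i\<in>B. \<psi> i ` F)" if "B \<subseteq> {1..M}" for B
    using that finite_subset[OF that] compact_F continuous_on_psi
    by (intro compact_imp_closed compact_UN compact_continuous_image) auto
  define U V where "U = (\<Union>i\<in>A. \<psi> i ` F)" and "V = (\<Union>i\<in>{1..M}-A. \<psi> i ` F)"
  have UV: "closed U" "closed V" using cl assms(1) by (auto simp: U_def V_def simp del: atLeastAtMost_iff)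
  have cover: "F \<subseteq> U \<union> V"
  proof
    fix x assume "x \<in> F"
    then obtain i where "i \<in> {1..M}" "x \<in> \<psi> i ` F" using self_similar by blast
    then show "x \<in> U \<union> V" unfolding U_def V_def by blast
  qed
  have meets: "(\<Union>i\<in>B. \<psi> i ` F) \<inter> F \<noteq> {}" if B: "B \<subseteq> {1..M}" "B \<noteq> {}" for B
  proof -
    obtain i x where "i \<in> B" "x \<in> F" using B F_nonempty by blast
    then have "\<psi> i x \<in> (\<Union>i\<in>B. \<psi> i ` F) \<inter> F" using B psi_in_F by blast
    then show ?thesis by blast
  qed
  have "U \<inter> F \<noteq> {}" "V \<inter> F \<noteq> {}"
    unfolding U_def V_def using assms by (intro meets; blast)+
  then have "U \<inter> V \<inter> F \<noteq> {}"
    using connected_closedD[OF connected_F _ cover UV] by blast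
  then obtain x where "x \<in> U" "x \<in> V" by blast
  then show ?thesis using that unfolding U_def V_def by blast
qed

lemma boundary_nonempty: "boundary \<noteq> {}"
proof -
  have *: "{1} \<subseteq> {1..M}" "2 \<in> {1..M}" using two_le_M by auto
  have "{1} \<noteq> {1..M}" using *(2) by (metis numeral_One num.distinct(1) numeral_eq_iff singletonD)
  with * obtain i j where "i \<in> {1}" "j \<in> {1..M} - {1}" "\<psi> i ` F \<inter> \<psi> j ` F \<noteq> {}"
    using cells_connected[of "{1}"] by blast
  then show ?thesis using cells_meet_in_boundary[of i j] *(1) by blast
qed

end

section \<open>Discrete energies\<close>

text \<open>
  The set of vertices at which \<open>g\<close> differs from \<open>g u\<close> by at most \<open>k * D\<close> gains a vertex whenever \<open>k\<close>
  increases by one, until it is everything.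
\<close>

lemma connected_graph_oscillation:
  fixes g :: "'v \<Rightarrow> real" and D :: real
  assumes fin: "finite V"
    and conn: "\<And>A. A \<subseteq> V \<Longrightarrow> A \<noteq> {} \<Longrightarrow> A \<noteq> V \<Longrightarrow> \<exists>u\<in>A. \<exists>v\<in>V - A. adj u v"
    and edge: "\<And>u v. u \<in> V \<Longrightarrow> v \<in> V \<Longrightarrow> adj u v \<Longrightarrow> \<bar>g u - g v\<bar> \<le> D"
    and uv: "u \<in> V" "v \<in> V" and D: "0 \<le> D"
  shows "\<bar>g u - g v\<bar> \<le> card V * D"
proof -
  define P where "P k = {v \<in> V. \<bar>g u - g v\<bar> \<le> real k * D}" for k
  have fP: "finite (P k)" for k using fin by (simp add: P_def)
  have "P k = V \<or> k + 1 \<le> card (P k)" for k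
  proof (induction k)
    case 0
    have "{u} \<subseteq> P 0" using uv D by (auto simp: P_def)
    from card_mono[OF fP this] show ?case by simp
  next
    case (Suc k)
    have mono: "P k \<subseteq> P (Suc k)"
    proof
      fix x assume "x \<in> P k"
      moreover have "real k * D \<le> real (Suc k) * D" using D by (intro mult_right_mono) auto
      ultimately show "x \<in> P (Suc k)" unfolding P_def by (auto intro: order_trans)
    qed
    show ?case
    proof (cases "P k = V")
      case True
      then have "P (Suc k) = V" using mono unfolding P_def by blast
      then show ?thesis by simp
    next
      case False
      moreover have "P k \<subseteq> V" by (auto simp: P_def)
      moreover have "P k \<noteq> {}" using False Suc by auto
      ultimately obtain x y where xy: "x \<in> P k" "y \<in> V - P k" "adj x y" using conn by meson
      have "\<bar>g x - g y\<bar> \<le> D" using xy edge by (auto simp: P_def)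
      then have "y \<in> P (Suc k)" using xy by (auto simp: P_def algebra_simps)
      then have "insert y (P k) \<subseteq> P (Suc k)" using mono by auto
      from card_mono[OF fP this] have "card (P k) + 1 \<le> card (P (Suc k))"
        using fP xy by simp
      then show ?thesis using Suc False by linarith
    qed
  qed
  from this[of "card V"] have "P (card V) = V"
    using card_mono[OF fin, of "P (card V)"] by (auto simp: P_def)
  then show ?thesis using uv by (auto simp: P_def)
qed

text \<open>
  The two differences on the left add up to \<open>u - v\<close> and have the same sign.
\<close>

lemma sq_diff_max_min:
  fixes u v a :: real
  shows "(max a u - max a v)\<^sup>2 + (min a u - min a v)\<^sup>2 \<le> (u - v)\<^sup>2"
proof -
  have *: "x\<^sup>2 + y\<^sup>2 \<le> (x + y)\<^sup>2" if "0 \<le> x * y" for x y :: real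
    using that by (simp add: power2_sum)
  have "max a u - max a v + (min a u - min a v) = u - v" by (simp add: max_def min_def)
  moreover have "0 \<le> (max a u - max a v) * (min a u - min a v)"
    by (cases "u \<le> v") (auto simp: max_def min_def mult_nonneg_nonneg mult_nonpos_nonpos)
  ultimately show ?thesis using * by metis
qed

text \<open>
  The Cauchy--Schwarz inequality for \<open>(sqrt A, sqrt C)\<close> and \<open>(sqrt B, sqrt D)\<close>.
\<close>

lemma square_sum_le:
  fixes u v A B C D :: real
  assumes "u\<^sup>2 \<le> A * B" "v\<^sup>2 \<le> C * D" and nonneg: "0 \<le> A" "0 \<le> B" "0 \<le> C" "0 \<le> D"
  shows "(u + v)\<^sup>2 \<le> (A + C) * (B + D)"
proof -
  have "(2 * u * v)\<^sup>2 = 4 * (u\<^sup>2 * v\<^sup>2)" by (simp add: power2_eq_square)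
  also have "\<dots> \<le> 4 * ((A * B) * (C * D))" using assms by (intro mult_left_mono mult_mono) auto
  also have "\<dots> \<le> (A * D + C * B)\<^sup>2"
    using zero_le_power2[of "A * D - C * B"] by (simp add: power2_eq_square algebra_simps)
  finally have "2 * u * v \<le> A * D + C * B"
    by (rule power2_le_imp_le) (use nonneg in auto)
  then show ?thesis using assms(1,2) by (simp add: power2_sum algebra_simps)
qed

context regular_irreducible_harmonic_structure begin

lemma r_pos: "i \<in> {1..M} \<Longrightarrow> 0 < r i" and r_less_1: "i \<in> {1..M} \<Longrightarrow> r i < 1"
  using r_bounds by auto

lemma r_word_Cons: "r_word (i # w) = r i * r_word w"
  by (simp add: r_word_def)

lemma r_word_pos: "set w \<subseteq> {1..M} \<Longrightarrow> 0 < r_word w"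
  by (induction w) (auto simp: r_word_def r_pos)

lemma energy0_cong: "(\<And>p. p \<in> boundary \<Longrightarrow> f p = g p) \<Longrightarrow> energy0 f f = energy0 g g"
  by (simp add: energy0_def cong: sum.cong)

lemma row_sum_zero: "x \<in> boundary \<Longrightarrow> (\<Sum>y\<in>boundary. A\<^sub>0 x y) = 0"
  using kernel[of "\<lambda>_. 1"] by auto

text \<open>
  Constants lie in the kernel, so the rows of \<open>A\<^sub>0\<close>, and by symmetry its columns, sum to zero; after
  expanding the square only the mixed terms survive.
\<close>

lemma energy0_eq:
  "energy0 f f = (\<Sum>x\<in>boundary. \<Sum>y\<in>boundary. A\<^sub>0 x y * (f x - f y)\<^sup>2) / 2"
proof -
  have 1: "(\<Sum>x\<in>boundary. \<Sum>y\<in>boundary. A\<^sub>0 x y * (f x)\<^sup>2) = 0"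
    by (simp add: sum_distrib_right[symmetric] row_sum_zero)
  have "(\<Sum>x\<in>boundary. \<Sum>y\<in>boundary. A\<^sub>0 x y * (f y)\<^sup>2) = (\<Sum>y\<in>boundary. \<Sum>x\<in>boundary. A\<^sub>0 y x * (f y)\<^sup>2)"
    by (subst sum.swap) (auto intro!: sum.cong simp: symmetric)
  then have 2: "(\<Sum>x\<in>boundary. \<Sum>y\<in>boundary. A\<^sub>0 x y * (f y)\<^sup>2) = 0"
    by (simp add: sum_distrib_right[symmetric] row_sum_zero)
  have "(\<Sum>x\<in>boundary. \<Sum>y\<in>boundary. A\<^sub>0 x y * (f x - f y)\<^sup>2) =
    (\<Sum>x\<in>boundary. \<Sum>y\<in>boundary. A\<^sub>0 x y * (f x)\<^sup>2 + A\<^sub>0 x y * (f y)\<^sup>2 - 2 * (f x * A\<^sub>0 x y * f y))"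
    by (intro sum.cong refl) (simp add: power2_diff algebra_simps)
  also have "\<dots> = 2 * energy0 f f"
    by (simp only: sum.distrib sum_subtractf 1 2 sum_distrib_left[symmetric] energy0_def)
  finally show ?thesis by simp
qed

text \<open>
  Only the entries off the diagonal have the right sign; those on the diagonal multiply zero.
\<close>

lemma weighted_sq_mono:
  assumes "x \<in> boundary" "y \<in> boundary" "x \<noteq> y \<Longrightarrow> u \<le> v" "x = y \<Longrightarrow> u = 0 \<and> v = 0"
  shows "A\<^sub>0 x y * u \<le> A\<^sub>0 x y * v"
  using assms off_diagonal by (cases "x = y") (auto intro: mult_left_mono)

lemma energy0_nonneg: "0 \<le> energy0 f f"
  unfolding energy0_def using nonpositive_definite[of f] by simp

text \<open>
  The Markov property in additive form: a cut at level \<open>a\<close> splits the energy.  It permits truncation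
  of minimisers, and it gives the triangle inequality of the resistance.
\<close>

lemma energy0_max_min:
  "energy0 (\<lambda>x. max a (f x)) (\<lambda>x. max a (f x)) + energy0 (\<lambda>x. min a (f x)) (\<lambda>x. min a (f x)) \<le> energy0 f f"
proof -
  have "(\<Sum>x\<in>boundary. \<Sum>y\<in>boundary.
      A\<^sub>0 x y * ((max a (f x) - max a (f y))\<^sup>2 + (min a (f x) - min a (f y))\<^sup>2))
    \<le> (\<Sum>x\<in>boundary. \<Sum>y\<in>boundary. A\<^sub>0 x y * (f x - f y)\<^sup>2)"
    using sq_diff_max_min by (intro sum_mono weighted_sq_mono) auto
  then show ?thesis by (simp add: energy0_eq distrib_left sum.distrib)
qed

lemma energy_n_0 [simp]: "energy_n 0 f f = energy0 f f"
  by (simp add: energy_n_def words_0 r_word_def)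

lemma energy_n_Suc: "energy_n (Suc n) f f = (\<Sum>i=1..M. inverse (r i) * energy_n n (f \<circ> \<psi> i) (f \<circ> \<psi> i))"
proof -
  let ?e = "\<lambda>w. inverse (r_word w) * energy0 (f \<circ> word_map w) (f \<circ> word_map w)"
  have inj: "inj_on (\<lambda>(i, w). i # w) ({1..M} \<times> words n)" by (auto simp: inj_on_def)
  have "energy_n (Suc n) f f = (\<Sum>i=1..M. \<Sum>w\<in>words n. ?e (i # w))"
    unfolding energy_n_def words_Suc sum.reindex[OF inj]
    by (simp add: sum.cartesian_product comp_def case_prod_unfold)
  also have "\<dots> = (\<Sum>i=1..M. inverse (r i) * energy_n n (f \<circ> \<psi> i) (f \<circ> \<psi> i))"
    unfolding energy_n_def sum_distrib_left
    by (intro sum.cong refl) (simp add: r_word_Cons comp_assoc)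
  finally show ?thesis .
qed

lemma energy_n_nonneg: "0 \<le> energy_n n f f"
  unfolding energy_n_def
proof (rule sum_nonneg)
  fix w assume "w \<in> words n"
  then have "0 < r_word w" by (simp add: words_def r_word_pos)
  then show "0 \<le> inverse (r_word w) * energy0 (f \<circ> word_map w) (f \<circ> word_map w)"
    by (simp add: energy0_nonneg)
qed

lemma energy_n_max_min:
  "energy_n n (\<lambda>x. max a (f x)) (\<lambda>x. max a (f x)) + energy_n n (\<lambda>x. min a (f x)) (\<lambda>x. min a (f x)) \<le> energy_n n f f"
proof -
  have "(\<Sum>w\<in>words n. inverse (r_word w) * (energy0 ((\<lambda>x. max a (f x)) \<circ> word_map w) ((\<lambda>x. max a (f x)) \<circ> word_map w)
      + energy0 ((\<lambda>x. min a (f x)) \<circ> word_map w) ((\<lambda>x. min a (f x)) \<circ> word_map w)))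
    \<le> (\<Sum>w\<in>words n. inverse (r_word w) * energy0 (f \<circ> word_map w) (f \<circ> word_map w))"
    using r_word_pos energy0_max_min[of a "f \<circ> word_map w" for w]
    by (intro sum_mono mult_left_mono) (auto simp: words_def comp_def less_imp_le)
  then show ?thesis by (simp add: energy_n_def distrib_left sum.distrib)
qed

text \<open>
  From level 0 to level 1 this is the minimising property of the harmonic structure, and the
  self-similar decomposition transports it to all levels.
\<close>

lemma energy_n_mono: "energy_n n f f \<le> energy_n (Suc n) f f"
proof (induction n arbitrary: f)
  case 0
  then show ?case using minimum_le[of f f] by simp
next
  case (Suc n)
  show ?case
    unfolding energy_n_Suc[of "Suc n" f] energy_n_Suc[of n f]
    using Suc r_pos by (intro sum_mono mult_left_mono) (auto simp: less_imp_le)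
qed

lemma incseq_energy_n: "incseq (\<lambda>n. energy_n n f f)"
  by (intro incseq_SucI energy_n_mono)

lemma form_domainI:
  assumes "continuous_on F f" "\<And>n. energy_n n f f \<le> B" shows "f \<in> form_domain"
proof -
  obtain L where "(\<lambda>n. energy_n n f f) \<longlonglongrightarrow> L"
    by (rule incseq_convergent[OF incseq_energy_n[of f], of B]) (use assms(2) in auto)
  then have "convergent (\<lambda>n. energy_n n f f)" by (rule convergentI)
  then show ?thesis using assms(1) by (simp add: form_domain_def)
qed

lemma energy_tendsto: "f \<in> form_domain \<Longrightarrow> (\<lambda>n. energy_n n f f) \<longlonglongrightarrow> energy f f"
  by (simp add: form_domain_def energy_def convergent_LIMSEQ_iff)

lemma energy_n_le_energy: "f \<in> form_domain \<Longrightarrow> energy_n n f f \<le> energy f f"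
  using incseq_le[OF incseq_energy_n[of f] energy_tendsto] .

lemma energy_nonneg: "f \<in> form_domain \<Longrightarrow> 0 \<le> energy f f"
  by (rule order_trans[OF energy_n_nonneg energy_n_le_energy])

lemma energy_leI: "f \<in> form_domain \<Longrightarrow> (\<And>n. energy_n n f f \<le> B) \<Longrightarrow> energy f f \<le> B"
  by (rule LIMSEQ_le_const2[OF energy_tendsto[of f]]) auto

text \<open>
  The energy on a first-level cell is one of the nonnegative terms of the self-similar sum.
\<close>

lemma comp_psi_form_domain:
  assumes f: "f \<in> form_domain" and i: "i \<in> {1..M}"
  shows "f \<circ> \<psi> i \<in> form_domain" "energy (f \<circ> \<psi> i) (f \<circ> \<psi> i) \<le> r i * energy f f"
proof -
  have bound: "energy_n n (f \<circ> \<psi> i) (f \<circ> \<psi> i) \<le> r i * energy f f" for n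
  proof -
    have "inverse (r i) * energy_n n (f \<circ> \<psi> i) (f \<circ> \<psi> i) \<le> energy_n (Suc n) f f"
      unfolding energy_n_Suc using i energy_n_nonneg r_pos
      by (intro member_le_sum) (auto intro!: mult_nonneg_nonneg simp: less_imp_le)
    also have "\<dots> \<le> energy f f" using f by (rule energy_n_le_energy)
    finally show ?thesis using r_pos[OF i] by (simp add: field_simps)
  qed
  have "continuous_on F (f \<circ> \<psi> i)"
  proof (rule continuous_on_compose[OF continuous_on_psi[OF i]])
    show "continuous_on (\<psi> i ` F) f"
      using f maps_F[OF i] by (auto simp: form_domain_def elim: continuous_on_subset)
  qed
  from form_domainI[OF this bound] show "f \<circ> \<psi> i \<in> form_domain" .
  from energy_leI[OF this bound] show "energy (f \<circ> \<psi> i) (f \<circ> \<psi> i) \<le> r i * energy f f" .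
qed

lemma comp_word_map_form_domain:
  assumes "f \<in> form_domain" "set w \<subseteq> {1..M}"
  shows "f \<circ> word_map w \<in> form_domain \<and> energy (f \<circ> word_map w) (f \<circ> word_map w) \<le> r_word w * energy f f"
  using assms
proof (induction w arbitrary: f)
  case Nil
  then show ?case by (simp add: r_word_def)
next
  case (Cons i w)
  have i: "i \<in> {1..M}" and w: "set w \<subseteq> {1..M}" using Cons.prems by auto
  note c = comp_psi_form_domain[OF Cons.prems(1) i]
  have "energy (f \<circ> \<psi> i \<circ> word_map w) (f \<circ> \<psi> i \<circ> word_map w) \<le> r_word w * energy (f \<circ> \<psi> i) (f \<circ> \<psi> i)"
    using Cons.IH[OF c(1) w] by blast
  also have "\<dots> \<le> r_word w * (r i * energy f f)"
    using c(2) r_word_pos[OF w] by (intro mult_left_mono) auto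
  also have "\<dots> = r_word (i # w) * energy f f" by (simp add: r_word_Cons mult_ac)
  finally show ?case using Cons.IH[OF c(1) w] by (simp only: word_map_Cons comp_assoc simp_thms)
qed

text \<open>
  Otherwise the indicator function of \<open>A\<close> would be a nonconstant element of the kernel of \<open>A\<^sub>0\<close>.
\<close>

lemma boundary_graph_connected:
  assumes A: "A \<subseteq> boundary" "A \<noteq> {}" "A \<noteq> boundary"
  shows "\<exists>p\<in>A. \<exists>q\<in>boundary - A. 0 < A\<^sub>0 p q"
proof (rule ccontr)
  assume neg: "\<not> ?thesis"
  have zero: "A\<^sub>0 p q = 0" if "p \<in> A" "q \<in> boundary - A" for p q
    using neg that off_diagonal[of p q] A by force
  define f :: "'a \<Rightarrow> real" where "f = indicator A"
  have "(\<Sum>y\<in>boundary. A\<^sub>0 x y * f y) = 0" if x: "x \<in> boundary" for x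
  proof (cases "x \<in> A")
    case True
    have "(\<Sum>y\<in>boundary. A\<^sub>0 x y * f y) = (\<Sum>y\<in>boundary. A\<^sub>0 x y)"
      using zero[OF True] by (intro sum.cong) (auto simp: f_def indicator_def)
    then show ?thesis using row_sum_zero[OF x] by simp
  next
    case False
    then show ?thesis
      using zero[of _ x] x A symmetric[of x] by (intro sum.neutral) (auto simp: f_def indicator_def)
  qed
  then obtain c where c: "\<And>x. x \<in> boundary \<Longrightarrow> f x = c" using kernel[of f] by blast
  obtain x y where "x \<in> A" "y \<in> boundary - A" using A by blast
  then show False using c[of x] c[of y] A by (auto simp: f_def)
qed

text \<open>
  An edge of weight at least \<open>a\<close> bounds the increment across it by \<open>sqrt (2 * energy0 f f / a)\<close>, and
  the boundary is connected by such edges.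
\<close>

lemma energy0_controls_oscillation:
  obtains K where "0 \<le> K" "\<And>f p q. p \<in> boundary \<Longrightarrow> q \<in> boundary \<Longrightarrow> \<bar>f p - f q\<bar> \<le> K * sqrt (energy0 f f)"
proof -
  define S where "S = insert 1 {a. 0 < a \<and> a \<in> (\<lambda>(p, q). A\<^sub>0 p q) ` (boundary \<times> boundary)}"
  define a where "a = Min S"
  have S: "finite S" "S \<noteq> {}" using finite_boundary by (auto simp: S_def)
  have a_pos: "0 < a" using Min_in[OF S] by (auto simp: a_def S_def)
  have a_le: "a \<le> A\<^sub>0 p q" if "p \<in> boundary" "q \<in> boundary" "0 < A\<^sub>0 p q" for p q
    unfolding a_def using that by (intro Min_le S) (auto simp: S_def)
  have edge: "\<bar>f p - f q\<bar> \<le> sqrt (2 * energy0 f f / a)"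
    if pq: "p \<in> boundary" "q \<in> boundary" "0 < A\<^sub>0 p q" for f p q
  proof -
    have nn: "0 \<le> A\<^sub>0 x y * (f x - f y)\<^sup>2" if "x \<in> boundary" "y \<in> boundary" for x y
      using off_diagonal[OF that] by (cases "x = y") auto
    have "a * (f p - f q)\<^sup>2 \<le> A\<^sub>0 p q * (f p - f q)\<^sup>2"
      using a_le[OF pq] by (intro mult_right_mono) auto
    also have "\<dots> \<le> (\<Sum>y\<in>boundary. A\<^sub>0 p y * (f p - f y)\<^sup>2)"
      using finite_boundary pq nn by (intro member_le_sum) auto
    also have "\<dots> \<le> (\<Sum>x\<in>boundary. \<Sum>y\<in>boundary. A\<^sub>0 x y * (f x - f y)\<^sup>2)"
      using finite_boundary pq nn by (intro member_le_sum[of p boundary "\<lambda>x. \<Sum>y\<in>boundary. A\<^sub>0 x y * (f x - f y)\<^sup>2"] sum_nonneg) auto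
    finally have "(f p - f q)\<^sup>2 \<le> 2 * energy0 f f / a"
      using a_pos by (simp add: energy0_eq field_simps)
    then have "sqrt ((f p - f q)\<^sup>2) \<le> sqrt (2 * energy0 f f / a)" by (rule real_sqrt_le_mono)
    then show ?thesis by simp
  qed
  show ?thesis
  proof (rule that[of "card boundary * sqrt (2 / a)"])
    fix f :: "'a \<Rightarrow> real" and p q assume "p \<in> boundary" "q \<in> boundary"
    then have "\<bar>f p - f q\<bar> \<le> card boundary * sqrt (2 * energy0 f f / a)"
      using energy0_nonneg[of f] a_pos
      by (intro connected_graph_oscillation[OF finite_boundary boundary_graph_connected edge]) auto
    also have "\<dots> = card boundary * sqrt (2 / a) * sqrt (energy0 f f)"
      by (simp add: real_sqrt_mult[symmetric])
    finally show "\<bar>f p - f q\<bar> \<le> card boundary * sqrt (2 / a) * sqrt (energy0 f f)" .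
  qed (use a_pos in auto)
qed


section \<open>Harmonic extension and separation of points\<close>

definition boundary_min :: "('a \<Rightarrow> real) \<Rightarrow> real" where
  "boundary_min g = Min (g ` boundary)"

lemma boundary_min_le: "p \<in> boundary \<Longrightarrow> boundary_min g \<le> g p"
  using finite_boundary by (simp add: boundary_min_def)

lemma boundary_min_attained: obtains p where "p \<in> boundary" "boundary_min g = g p"
proof -
  have "boundary_min g \<in> g ` boundary"
    unfolding boundary_min_def using finite_boundary boundary_nonempty by (intro Min_in) auto
  then show ?thesis using that by blast
qed

text \<open>
  A minimiser may be truncated at the least and the greatest boundary value without raising its
  energy.  The range condition makes the values along a code lie in nested intervals.
\<close>

lemma harmonic_step_exists:
  "\<exists>g. (\<forall>p\<in>boundary. g p = f p) \<and> energy_n 1 g g = energy0 f f \<and>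
    (\<forall>x. \<exists>p\<in>boundary. \<exists>q\<in>boundary. f p \<le> g x \<and> g x \<le> f q)"
proof -
  obtain g where g: "\<forall>p\<in>boundary. g p = f p" "energy_n 1 g g = energy0 f f"
    using minimum_attained by blast
  obtain p where p: "p \<in> boundary" "boundary_min f = f p" by (rule boundary_min_attained)
  obtain q where q: "q \<in> boundary" "boundary_min (\<lambda>x. - f x) = - f q" by (rule boundary_min_attained)
  have le: "f p \<le> f x" "f x \<le> f q" if "x \<in> boundary" for x
    using boundary_min_le[OF that, of f] boundary_min_le[OF that, of "\<lambda>x. - f x"] p q by auto
  define h where "h x = max (f p) (min (f q) (g x))" for x
  have h: "\<forall>x\<in>boundary. h x = f x" using g le by (auto simp: h_def)
  have "energy_n 1 h h \<le> energy_n 1 (\<lambda>x. min (f q) (g x)) (\<lambda>x. min (f q) (g x))"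
    using energy_n_max_min[of 1 "f p" "\<lambda>x. min (f q) (g x)"]
      energy_n_nonneg[of 1 "\<lambda>x. min (f p) (min (f q) (g x))"] unfolding h_def by linarith
  also have "\<dots> \<le> energy_n 1 g g"
    using energy_n_max_min[of 1 "f q" g] energy_n_nonneg[of 1 "\<lambda>x. max (f q) (g x)"] by linarith
  finally have "energy_n 1 h h = energy0 f f" using g minimum_le[of h f] h by auto
  moreover have "f p \<le> h x" "h x \<le> f q" for x using le p by (auto simp: h_def)
  ultimately show ?thesis using h p q by blast
qed

definition harmonic_step :: "('a \<Rightarrow> real) \<Rightarrow> 'a \<Rightarrow> real" where
  "harmonic_step f = (SOME g. (\<forall>p\<in>boundary. g p = f p) \<and> energy_n 1 g g = energy0 f f \<and>
    (\<forall>x. \<exists>p\<in>boundary. \<exists>q\<in>boundary. f p \<le> g x \<and> g x \<le> f q))"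

lemma harmonic_step_boundary: "p \<in> boundary \<Longrightarrow> harmonic_step f p = f p"
  and harmonic_step_energy: "energy_n 1 (harmonic_step f) (harmonic_step f) = energy0 f f"
  and harmonic_step_range: "\<exists>p\<in>boundary. \<exists>q\<in>boundary. f p \<le> harmonic_step f x \<and> harmonic_step f x \<le> f q"
  using someI_ex[OF harmonic_step_exists[of f], folded harmonic_step_def] by blast+

text \<open>
  The boundary data that the harmonic step induces on the \<open>i\<close>-th first-level cell, pulled back to \<open>F\<close>.
\<close>

definition harmonic_child :: "('a \<Rightarrow> real) \<Rightarrow> nat \<Rightarrow> 'a \<Rightarrow> real" where
  "harmonic_child f i = harmonic_step f \<circ> \<psi> i"

lemma harmonic_child_energy: assumes "i \<in> {1..M}" shows "energy0 (harmonic_child f i) (harmonic_child f i) \<le> r i * energy0 f f"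
proof -
  have "inverse (r i) * energy0 (harmonic_child f i) (harmonic_child f i) \<le> energy_n (Suc 0) (harmonic_step f) (harmonic_step f)"
    unfolding energy_n_Suc harmonic_child_def energy_n_0 using assms energy0_nonneg r_pos
    by (intro member_le_sum[where f="\<lambda>i. inverse (r i) * energy0 (harmonic_step f \<circ> \<psi> i) (harmonic_step f \<circ> \<psi> i)"])
      (auto intro!: mult_nonneg_nonneg simp: less_imp_le)
  then show ?thesis using harmonic_step_energy[of f] r_pos[OF assms] by (simp add: field_simps)
qed

lemma harmonic_child_energy_sum:
  "(\<Sum>i=1..M. inverse (r i) * energy0 (harmonic_child f i) (harmonic_child f i)) = energy0 f f"
  using harmonic_step_energy[of f] by (simp add: energy_n_Suc harmonic_child_def)

fun descend :: "('a \<Rightarrow> real) \<Rightarrow> (nat \<Rightarrow> nat) \<Rightarrow> nat \<Rightarrow> 'a \<Rightarrow> real" where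
  "descend f \<tau> 0 = f"
| "descend f \<tau> (Suc k) = descend (harmonic_child f (\<tau> 0)) (shift \<tau>) k"

lemma descend_Suc': "descend f \<tau> (Suc k) = harmonic_child (descend f \<tau> k) (\<tau> k)"
proof (induction k arbitrary: f \<tau>)
  case (Suc k)
  show ?case using Suc[of "harmonic_child f (\<tau> 0)" "shift \<tau>"] by (simp add: shift_apply[of _ k])
qed simp

lemma descend_range:
  "\<exists>p\<in>boundary. \<exists>q\<in>boundary. f p \<le> descend f \<tau> k x \<and> descend f \<tau> k x \<le> f q" if "x \<in> boundary"
  using that
proof (induction k arbitrary: f \<tau> x)
  case (Suc k)
  obtain p q where pq: "harmonic_child f (\<tau> 0) p \<le> descend f \<tau> (Suc k) x" "descend f \<tau> (Suc k) x \<le> harmonic_child f (\<tau> 0) q"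
    using Suc.IH[OF Suc.prems, of "harmonic_child f (\<tau> 0)" "shift \<tau>"] by auto
  obtain p' where "p' \<in> boundary" "f p' \<le> harmonic_child f (\<tau> 0) p"
    using harmonic_step_range[of f "\<psi> (\<tau> 0) p"] by (auto simp: harmonic_child_def)
  moreover obtain q' where "q' \<in> boundary" "harmonic_child f (\<tau> 0) q \<le> f q'"
    using harmonic_step_range[of f "\<psi> (\<tau> 0) q"] by (auto simp: harmonic_child_def)
  ultimately show ?case using pq by (meson order_trans)
qed auto

text \<open>
  The value of the harmonic extension of the boundary data \<open>f\<close> at the point with code \<open>\<tau>\<close>.  The
  boundary minima increase along the code, and since the oscillations tend to zero their limit is
  also the limit of all other values.
\<close>

definition harmonic_code :: "('a \<Rightarrow> real) \<Rightarrow> (nat \<Rightarrow> nat) \<Rightarrow> real" where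
  "harmonic_code f \<tau> = lim (\<lambda>k. boundary_min (descend f \<tau> k))"

lemma harmonic_code_tendsto:
  "(\<lambda>k. boundary_min (descend f \<tau> k)) \<longlonglongrightarrow> harmonic_code f \<tau>"
proof -
  have "boundary_min (descend f \<tau> k) \<le> boundary_min (descend f \<tau> (Suc k))" for k
  proof -
    obtain p where p: "p \<in> boundary" "boundary_min (descend f \<tau> (Suc k)) = descend f \<tau> (Suc k) p"
      by (rule boundary_min_attained)
    obtain q where "q \<in> boundary" "descend f \<tau> k q \<le> descend f \<tau> (Suc k) p"
      unfolding descend_Suc' harmonic_child_def using harmonic_step_range[of "descend f \<tau> k" "\<psi> (\<tau> k) p"] by auto
    then show ?thesis using p boundary_min_le[of q "descend f \<tau> k"] by simp
  qed
  then have inc: "incseq (\<lambda>k. boundary_min (descend f \<tau> k))" by (rule incseq_SucI)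
  obtain q where q: "q \<in> boundary" "boundary_min (\<lambda>x. - f x) = - f q" by (rule boundary_min_attained)
  have "boundary_min (descend f \<tau> k) \<le> f q" for k
  proof -
    obtain p where p: "p \<in> boundary" "boundary_min (descend f \<tau> k) = descend f \<tau> k p"
      by (rule boundary_min_attained)
    obtain q' where "q' \<in> boundary" "descend f \<tau> k p \<le> f q'" using descend_range[OF p(1)] by blast
    then show ?thesis using p q boundary_min_le[of q' "\<lambda>x. - f x"] by simp
  qed
  then obtain L where "(\<lambda>k. boundary_min (descend f \<tau> k)) \<longlonglongrightarrow> L"
    using incseq_convergent[OF inc, of "f q"] by blast
  then show ?thesis unfolding harmonic_code_def by (metis limI)
qed

lemma harmonic_code_bounds:
  assumes "\<And>p. p \<in> boundary \<Longrightarrow> lo \<le> f p" "\<And>p. p \<in> boundary \<Longrightarrow> f p \<le> hi"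
  shows "lo \<le> harmonic_code f \<tau>" "harmonic_code f \<tau> \<le> hi"
proof -
  have "lo \<le> boundary_min (descend f \<tau> k) \<and> boundary_min (descend f \<tau> k) \<le> hi" for k
  proof -
    obtain p where p: "p \<in> boundary" "boundary_min (descend f \<tau> k) = descend f \<tau> k p"
      by (rule boundary_min_attained)
    show ?thesis using descend_range[OF p(1), of f \<tau> k] p assms by (metis order_trans)
  qed
  then show "lo \<le> harmonic_code f \<tau>" "harmonic_code f \<tau> \<le> hi"
    by (auto intro: LIMSEQ_le_const[OF harmonic_code_tendsto] LIMSEQ_le_const2[OF harmonic_code_tendsto])
qed

lemma harmonic_code_shift: "harmonic_code f \<tau> = harmonic_code (harmonic_child f (\<tau> 0)) (shift \<tau>)"
  using LIMSEQ_unique[OF LIMSEQ_Suc[OF harmonic_code_tendsto[of f \<tau>]]] harmonic_code_tendsto by auto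

lemma harmonic_code_descend: "harmonic_code f \<tau> = harmonic_code (descend f \<tau> k) ((shift ^^ k) \<tau>)"
proof (induction k arbitrary: f \<tau>)
  case (Suc k)
  show ?case using harmonic_code_shift[of f \<tau>] Suc[of "harmonic_child f (\<tau> 0)" "shift \<tau>"] by (simp add: funpow_swap1)
qed simp

definition r_max :: real where "r_max = Max (r ` {1..M})"

lemma r_le_max: "i \<in> {1..M} \<Longrightarrow> r i \<le> r_max"
  by (simp add: r_max_def)

lemma r_max_bounds: "0 < r_max" "r_max < 1"
proof -
  have "r_max \<in> r ` {1..M}" unfolding r_max_def using two_le_M by (intro Max_in) auto
  then show "0 < r_max" "r_max < 1" using r_bounds by auto
qed

text \<open>
  One step along the code multiplies the energy of the data by at most \<open>r_max\<close>.
\<close>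

lemma descend_energy:
  "\<tau> \<in> inf_words \<Longrightarrow> energy0 (descend f \<tau> k) (descend f \<tau> k) \<le> r_max ^ k * energy0 f f"
proof (induction k)
  case (Suc k)
  have "energy0 (descend f \<tau> (Suc k)) (descend f \<tau> (Suc k)) \<le> r (\<tau> k) * energy0 (descend f \<tau> k) (descend f \<tau> k)"
    unfolding descend_Suc' using harmonic_child_energy inf_wordsD Suc.prems by blast
  also have "\<dots> \<le> r_max * (r_max ^ k * energy0 f f)"
    using Suc r_le_max[OF inf_wordsD[OF Suc.prems]] energy0_nonneg r_max_bounds by (intro mult_mono) auto
  finally show ?case by simp
qed simp

lemma descend_oscillation:
  assumes "0 < (e::real)"
  obtains k where "\<And>\<tau> p q. \<tau> \<in> inf_words \<Longrightarrow> p \<in> boundary \<Longrightarrow> q \<in> boundary \<Longrightarrow>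
    \<bar>descend f \<tau> k p - descend f \<tau> k q\<bar> \<le> e"
proof -
  obtain K where K: "0 \<le> K"
    "\<And>f p q. p \<in> boundary \<Longrightarrow> q \<in> boundary \<Longrightarrow> \<bar>f p - f q\<bar> \<le> K * sqrt (energy0 f f)"
    using energy0_controls_oscillation by blast
  have "(\<lambda>k. K * sqrt (r_max ^ k * energy0 f f)) \<longlonglongrightarrow> K * sqrt (0 * energy0 f f)"
    using r_max_bounds by (intro tendsto_intros LIMSEQ_power_zero) auto
  then have "\<forall>\<^sub>F k in sequentially. K * sqrt (r_max ^ k * energy0 f f) < e"
    using assms by (intro order_tendstoD(2)) auto
  then obtain k where k: "K * sqrt (r_max ^ k * energy0 f f) < e"
    by (auto simp: eventually_sequentially)
  have "\<bar>descend f \<tau> k p - descend f \<tau> k q\<bar> \<le> e"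
    if "\<tau> \<in> inf_words" "p \<in> boundary" "q \<in> boundary" for \<tau> p q
  proof -
    have "\<bar>descend f \<tau> k p - descend f \<tau> k q\<bar> \<le> K * sqrt (energy0 (descend f \<tau> k) (descend f \<tau> k))"
      by (rule K(2)[OF that(2,3)])
    also have "\<dots> \<le> K * sqrt (r_max ^ k * energy0 f f)"
      using descend_energy[OF that(1)] K(1) by (intro mult_left_mono real_sqrt_le_mono) auto
    finally show ?thesis using k by simp
  qed
  then show ?thesis using that by blast
qed

lemma harmonic_code_near_boundary:
  assumes "p \<in> boundary" "\<And>q. q \<in> boundary \<Longrightarrow> \<bar>f p - f q\<bar> \<le> e"
  shows "\<bar>harmonic_code f \<tau> - f p\<bar> \<le> e"
  using harmonic_code_bounds[of "f p - e" f "f p + e" \<tau>] assms(2) by (force simp: abs_le_iff)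

text \<open>
  After \<open>k\<close> common letters both values lie in the range of the same data, whose oscillation is small.
\<close>

lemma harmonic_code_oscillation:
  assumes "0 < (e::real)"
  shows "\<exists>k. \<forall>\<tau> \<tau>'. \<tau> \<in> inf_words \<longrightarrow> \<tau>' \<in> inf_words \<longrightarrow> map \<tau> [0..<k] = map \<tau>' [0..<k] \<longrightarrow>
    \<bar>harmonic_code f \<tau> - harmonic_code f \<tau>'\<bar> \<le> e"
proof -
  obtain k where k: "\<And>\<tau> p q. \<tau> \<in> inf_words \<Longrightarrow> p \<in> boundary \<Longrightarrow> q \<in> boundary \<Longrightarrow>
    \<bar>descend f \<tau> k p - descend f \<tau> k q\<bar> \<le> e / 2"
    using descend_oscillation[of "e / 2"] assms by auto
  have same: "descend f \<tau> k = descend f \<tau>' k" if "map \<tau> [0..<k] = map \<tau>' [0..<k]" for f \<tau> \<tau>' k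
    using that
  proof (induction k arbitrary: f \<tau> \<tau>')
    case (Suc k)
    then have "\<tau> 0 = \<tau>' 0" "map (shift \<tau>) [0..<k] = map (shift \<tau>') [0..<k]" unfolding prefix_Suc by auto
    then show ?case using Suc.IH[of "shift \<tau>" "shift \<tau>'"] by simp
  qed simp
  obtain p where p: "p \<in> boundary" using boundary_nonempty by blast
  have "\<bar>harmonic_code f \<tau> - harmonic_code f \<tau>'\<bar> \<le> e"
    if t: "\<tau> \<in> inf_words" "\<tau>' \<in> inf_words" "map \<tau> [0..<k] = map \<tau>' [0..<k]" for \<tau> \<tau>'
  proof -
    have "\<bar>harmonic_code (descend f \<tau> k) ((shift ^^ k) \<tau>) - descend f \<tau> k p\<bar> \<le> e / 2"
      "\<bar>harmonic_code (descend f \<tau> k) ((shift ^^ k) \<tau>') - descend f \<tau> k p\<bar> \<le> e / 2"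
      using k[OF t(1) p] by (auto intro!: harmonic_code_near_boundary p simp del: le_divide_eq_numeral1)
    then have "\<bar>harmonic_code f \<tau> - descend f \<tau> k p\<bar> \<le> e / 2" "\<bar>harmonic_code f \<tau>' - descend f \<tau> k p\<bar> \<le> e / 2"
      unfolding harmonic_code_descend[of f \<tau> k] harmonic_code_descend[of f \<tau>' k] same[OF t(3), of f] by auto
    then show ?thesis by linarith
  qed
  then show ?thesis by (intro exI[of _ k] allI impI)
qed

text \<open>
  Along a post-critical code the point remains a vertex of every cell, and a harmonic step never
  changes the value at a vertex.
\<close>

lemma harmonic_code_boundary:
  assumes \<tau>: "\<tau> \<in> post_critical_set"
  shows "harmonic_code f \<tau> = f (coding \<tau>)"
proof -
  have val: "(shift ^^ k) \<tau> \<in> post_critical_set \<and> descend f \<tau> k (coding ((shift ^^ k) \<tau>)) = f (coding \<tau>)" for k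
  proof (induction k)
    case (Suc k)
    let ?s = "(shift ^^ k) \<tau>"
    have s: "?s \<in> post_critical_set" "?s \<in> inf_words" using Suc post_critical_inf_words by auto
    have "coding ?s \<in> boundary" using s by (auto simp: boundary_def)
    moreover have "coding ?s = \<psi> (\<tau> k) (coding (shift ?s))"
      using coding_shift[OF s(2)] by (simp add: funpow_shift)
    ultimately have "harmonic_child (descend f \<tau> k) (\<tau> k) (coding (shift ?s)) = descend f \<tau> k (coding ?s)"
      by (simp add: harmonic_child_def harmonic_step_boundary)
    then have "descend f \<tau> (Suc k) (coding ((shift ^^ Suc k) \<tau>)) = f (coding \<tau>)"
      using Suc by (simp only: descend_Suc' funpow.simps o_apply)
    then show ?case using s shift_post_critical by simp
  qed (use \<tau> in simp)
  have "\<bar>harmonic_code f \<tau> - f (coding \<tau>)\<bar> \<le> e" if e: "0 < e" for e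
  proof -
    obtain k where k: "\<And>\<tau> p q. \<tau> \<in> inf_words \<Longrightarrow> p \<in> boundary \<Longrightarrow> q \<in> boundary \<Longrightarrow>
      \<bar>descend f \<tau> k p - descend f \<tau> k q\<bar> \<le> e"
      using descend_oscillation[OF e, of f] by blast
    have b: "coding ((shift ^^ k) \<tau>) \<in> boundary" using val[of k] by (auto simp: boundary_def)
    have "\<bar>harmonic_code (descend f \<tau> k) ((shift ^^ k) \<tau>) - descend f \<tau> k (coding ((shift ^^ k) \<tau>))\<bar> \<le> e"
      using k[OF post_critical_inf_words[OF \<tau>] b] by (intro harmonic_code_near_boundary[OF b]) auto
    then show ?thesis using val[of k] harmonic_code_descend[of f \<tau> k] by simp
  qed
  then have "\<bar>harmonic_code f \<tau> - f (coding \<tau>)\<bar> \<le> 0" by (rule field_le_epsilon) simp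
  then show ?thesis by simp
qed

text \<open>
  The first \<open>n\<close> letters only rescale \<open>f\<close>, so this prescribes \<open>f\<close> on the vertices of level \<open>n\<close>; inside
  the cells of level \<open>n\<close> the extension is harmonic.
\<close>

fun extension_code :: "nat \<Rightarrow> ('a \<Rightarrow> real) \<Rightarrow> (nat \<Rightarrow> nat) \<Rightarrow> real" where
  "extension_code 0 f \<tau> = harmonic_code f \<tau>"
| "extension_code (Suc n) f \<tau> = extension_code n (f \<circ> \<psi> (\<tau> 0)) (shift \<tau>)"

lemma extension_code_boundary:
  "\<tau> \<in> post_critical_set \<Longrightarrow> extension_code n f \<tau> = f (coding \<tau>)"
proof (induction n arbitrary: f \<tau>)
  case 0
  then show ?case by (simp add: harmonic_code_boundary)
next
  case (Suc n)
  then show ?case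
    using coding_shift[OF post_critical_inf_words[OF Suc.prems]] shift_post_critical by simp
qed

lemma psi_injective:
  "i \<in> {1..M} \<Longrightarrow> x \<in> F \<Longrightarrow> y \<in> F \<Longrightarrow> \<psi> i x = \<psi> i y \<Longrightarrow> x = y"
  using inj_\<psi>[of i] by (auto dest: inj_onD)

text \<open>
  Injectivity cancels a common first letter.  If the first letters differ, the point is a vertex of
  both first-level cells.
\<close>

lemma equal_coding_cases:
  assumes \<tau>: "\<tau> \<in> inf_words" "\<tau>' \<in> inf_words" "coding \<tau> = coding \<tau>'"
  obtains (same) "\<tau> 0 = \<tau>' 0" "coding (shift \<tau>) = coding (shift \<tau>')"
  | (crossing) "shift \<tau> \<in> post_critical_set" "shift \<tau>' \<in> post_critical_set"
proof (cases "\<tau> 0 = \<tau>' 0")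
  case True
  have "\<psi> (\<tau> 0) (coding (shift \<tau>)) = \<psi> (\<tau> 0) (coding (shift \<tau>'))"
    using coding_shift[OF \<tau>(1)] coding_shift[OF \<tau>(2)] \<tau>(3) True by simp
  then have "coding (shift \<tau>) = coding (shift \<tau>')"
    by (rule psi_injective[OF inf_wordsD[OF \<tau>(1)] coding_in_F[OF shift_inf_words[OF \<tau>(1)]]
          coding_in_F[OF shift_inf_words[OF \<tau>(2)]]])
  then show ?thesis using True same by blast
next
  case False
  then show ?thesis
    by (intro crossing shift_post_criticalI[OF \<tau>] shift_post_criticalI[OF \<tau>(2,1) \<tau>(3)[symmetric]]) auto
qed

lemma harmonic_code_crossing:
  assumes "\<tau> \<in> inf_words" "shift \<tau> \<in> post_critical_set"
  shows "harmonic_code f \<tau> = harmonic_step f (coding \<tau>)"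
  using assms by (simp add: harmonic_code_shift[of f \<tau>] harmonic_code_boundary harmonic_child_def coding_shift[of \<tau>])

text \<open>
  Induction on a position at which the codes differ: when they first part, both values are the
  value of the harmonic step at the common vertex.
\<close>

lemma harmonic_code_well_defined:
  assumes "\<tau> \<in> inf_words" "\<tau>' \<in> inf_words" "coding \<tau> = coding \<tau>'"
  shows "harmonic_code f \<tau> = harmonic_code f \<tau>'"
proof -
  have "\<forall>f \<tau> \<tau>'. \<tau> \<in> inf_words \<longrightarrow> \<tau>' \<in> inf_words \<longrightarrow> coding \<tau> = coding \<tau>' \<longrightarrow>
    \<tau> k \<noteq> \<tau>' k \<longrightarrow> harmonic_code f \<tau> = harmonic_code f \<tau>'" for k
  proof (induction k)
    case 0
    show ?case
    proof (intro allI impI)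
      fix f \<tau> \<tau>' assume t: "\<tau> \<in> inf_words" "\<tau>' \<in> inf_words" "coding \<tau> = coding \<tau>'" "\<tau> 0 \<noteq> \<tau>' 0"
      show "harmonic_code f \<tau> = harmonic_code f \<tau>'"
        using harmonic_code_crossing[OF t(1) shift_post_criticalI[OF t]]
          harmonic_code_crossing[OF t(2) shift_post_criticalI[OF t(2,1) t(3,4)[symmetric]]] t(3) by simp
    qed
  next
    case (Suc k)
    show ?case
    proof (intro allI impI)
      fix f \<tau> \<tau>' assume t: "\<tau> \<in> inf_words" "\<tau>' \<in> inf_words" "coding \<tau> = coding \<tau>'" "\<tau> (Suc k) \<noteq> \<tau>' (Suc k)"
      from t(1-3) show "harmonic_code f \<tau> = harmonic_code f \<tau>'"
      proof (cases rule: equal_coding_cases)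
        case same
        then have "harmonic_code (harmonic_child f (\<tau> 0)) (shift \<tau>) = harmonic_code (harmonic_child f (\<tau> 0)) (shift \<tau>')"
          using Suc t shift_inf_words by (auto simp: shift_apply[of _ k])
        then show ?thesis using same harmonic_code_shift[of f \<tau>] harmonic_code_shift[of f \<tau>'] by simp
      next
        case crossing
        then show ?thesis using harmonic_code_crossing[of \<tau> f] harmonic_code_crossing[of \<tau>' f] t by simp
      qed
    qed
  qed
  note differ = this
  show ?thesis
  proof (cases "\<tau> = \<tau>'")
    case False
    then obtain k where "\<tau> k \<noteq> \<tau>' k" by (auto simp: fun_eq_iff)
    then show ?thesis by (rule differ[rule_format, OF assms])
  qed simp
qed


lemma extension_code_well_defined:
  assumes "\<tau> \<in> inf_words" "\<tau>' \<in> inf_words" "coding \<tau> = coding \<tau>'"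
  shows "extension_code n f \<tau> = extension_code n f \<tau>'"
  using assms
proof (induction n arbitrary: f \<tau> \<tau>')
  case 0
  then show ?case using harmonic_code_well_defined[of \<tau> \<tau>' f] by simp
next
  case (Suc n)
  from Suc.prems show ?case
  proof (cases rule: equal_coding_cases)
    case same
    show ?thesis unfolding extension_code.simps same(1)
      by (rule Suc.IH[OF shift_inf_words[OF Suc.prems(1)] shift_inf_words[OF Suc.prems(2)] same(2)])
  next
    case crossing
    then show ?thesis
      using extension_code_boundary[OF crossing(1), of n "f \<circ> \<psi> (\<tau> 0)"]
        extension_code_boundary[OF crossing(2), of n "f \<circ> \<psi> (\<tau>' 0)"]
        coding_shift[OF Suc.prems(1)] coding_shift[OF Suc.prems(2)] Suc.prems(3)
      by simp
  qed
qed

lemma extension_code_bounds: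
  assumes "\<And>p. p \<in> boundary \<Longrightarrow> lo \<le> f (word_map (map \<tau> [0..<n]) p)"
    "\<And>p. p \<in> boundary \<Longrightarrow> f (word_map (map \<tau> [0..<n]) p) \<le> hi"
  shows "lo \<le> extension_code n f \<tau> \<and> extension_code n f \<tau> \<le> hi"
  using assms
proof (induction n arbitrary: f \<tau>)
  case 0
  then show ?case using harmonic_code_bounds[of lo f hi] by simp
next
  case (Suc n)
  then show ?case unfolding prefix_Suc extension_code.simps by (intro Suc.IH) auto
qed

lemma extension_code_oscillation:
  assumes "0 < (e::real)"
  shows "\<exists>k. \<forall>\<tau> \<tau>'. \<tau> \<in> inf_words \<longrightarrow> \<tau>' \<in> inf_words \<longrightarrow> map \<tau> [0..<k] = map \<tau>' [0..<k] \<longrightarrow>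
    \<bar>extension_code n f \<tau> - extension_code n f \<tau>'\<bar> \<le> e"
proof (induction n arbitrary: f)
  case 0
  show ?case unfolding extension_code.simps by (rule harmonic_code_oscillation[OF assms])
next
  case (Suc n)
  let ?P = "\<lambda>f k. \<forall>\<tau> \<tau>'. \<tau> \<in> inf_words \<longrightarrow> \<tau>' \<in> inf_words \<longrightarrow> map \<tau> [0..<k] = map \<tau>' [0..<k] \<longrightarrow>
    \<bar>extension_code n f \<tau> - extension_code n f \<tau>'\<bar> \<le> e"
  have "\<forall>f. \<exists>k. ?P f k" using Suc.IH by (rule allI)
  from choice[OF this] obtain k where k: "\<forall>f. ?P f (k f)" ..
  define m where "m = Max ((\<lambda>i. k (f \<circ> \<psi> i)) ` {1..M})"
  show ?case
  proof (intro exI[of _ "Suc m"] allI impI)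
    fix \<tau> \<tau>' assume t: "\<tau> \<in> inf_words" "\<tau>' \<in> inf_words" "map \<tau> [0..<Suc m] = map \<tau>' [0..<Suc m]"
    have eq: "\<tau> 0 = \<tau>' 0" "map (shift \<tau>) [0..<m] = map (shift \<tau>') [0..<m]" using t(3) unfolding prefix_Suc by auto
    have "k (f \<circ> \<psi> (\<tau> 0)) \<le> m" unfolding m_def using inf_wordsD[OF t(1)] by (intro Max_ge) auto
    then have "map (shift \<tau>) [0..<k (f \<circ> \<psi> (\<tau> 0))] = map (shift \<tau>') [0..<k (f \<circ> \<psi> (\<tau> 0))]"
      using eq(2) by auto
    from k[rule_format, OF shift_inf_words[OF t(1)] shift_inf_words[OF t(2)] this]
    show "\<bar>extension_code (Suc n) f \<tau> - extension_code (Suc n) f \<tau>'\<bar> \<le> e" using eq(1) by simp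
  qed
qed

definition extension :: "nat \<Rightarrow> ('a \<Rightarrow> real) \<Rightarrow> 'a \<Rightarrow> real" where
  "extension n f x = extension_code n f (SOME \<tau>. \<tau> \<in> inf_words \<and> coding \<tau> = x)"

lemma extension_coding: assumes "\<tau> \<in> inf_words" shows "extension n f (coding \<tau>) = extension_code n f \<tau>"
proof -
  define \<sigma> where "\<sigma> = (SOME \<sigma>. \<sigma> \<in> inf_words \<and> coding \<sigma> = coding \<tau>)"
  have "\<exists>\<sigma>. \<sigma> \<in> inf_words \<and> coding \<sigma> = coding \<tau>" using assms by blast
  from someI_ex[OF this] have "\<sigma> \<in> inf_words" "coding \<sigma> = coding \<tau>" unfolding \<sigma>_def by blast+
  then show ?thesis unfolding extension_def \<sigma>_def[symmetric] using assms by (intro extension_code_well_defined)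
qed

lemma extension_boundary: "p \<in> boundary \<Longrightarrow> extension n f p = f p"
proof -
  assume "p \<in> boundary"
  then obtain \<tau> where "\<tau> \<in> post_critical_set" "p = coding \<tau>" by (auto simp: boundary_def)
  then show ?thesis
    using extension_coding[OF post_critical_inf_words, of \<tau> n f] extension_code_boundary[of \<tau> n f] by simp
qed

lemma coding_case_nat: "i \<in> {1..M} \<Longrightarrow> \<tau> \<in> inf_words \<Longrightarrow> coding (case_nat i \<tau>) = \<psi> i (coding \<tau>)"
  using coding_shift[OF case_nat_inf_words, of i \<tau>] by simp

lemma extension_psi:
  assumes "i \<in> {1..M}" "x \<in> F"
  shows "extension 0 f (\<psi> i x) = extension 0 (harmonic_child f i) x"
    "extension (Suc n) f (\<psi> i x) = extension n (f \<circ> \<psi> i) x"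
proof -
  obtain \<tau> where \<tau>: "\<tau> \<in> inf_words" "coding \<tau> = x" using assms(2) by (rule coding_surj)
  note c = case_nat_inf_words[OF assms(1) \<tau>(1)]
  show "extension 0 f (\<psi> i x) = extension 0 (harmonic_child f i) x"
    using extension_coding[OF c, of 0 f] extension_coding[OF \<tau>(1), of 0] coding_case_nat[OF assms(1) \<tau>(1)] \<tau>(2)
      harmonic_code_shift[of f "case_nat i \<tau>"] by simp
  show "extension (Suc n) f (\<psi> i x) = extension n (f \<circ> \<psi> i) x"
    using extension_coding[OF c, of "Suc n" f] extension_coding[OF \<tau>(1), of n] coding_case_nat[OF assms(1) \<tau>(1)] \<tau>(2)
    by simp
qed

lemma words_cover:
  assumes "x \<in> F" obtains \<tau> where "\<tau> \<in> inf_words" "coding \<tau> = x" "\<And>k. map \<tau> [0..<k] \<in> words k" "\<And>k. x \<in> cell (map \<tau> [0..<k])"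
proof -
  obtain \<tau> where \<tau>: "\<tau> \<in> inf_words" "coding \<tau> = x" using assms by (rule coding_surj)
  show ?thesis using that[OF \<tau> prefix_in_words[OF \<tau>(1)]] coding_in_cell[OF \<tau>(1)] \<tau>(2) by simp
qed

lemma coding_append_exists:
  assumes "w \<in> words k" "x \<in> cell w"
  obtains \<tau> where "\<tau> \<in> inf_words" "coding \<tau> = x" "map \<tau> [0..<k] = w"
proof -
  obtain y where y: "y \<in> F" "x = word_map w y" using assms by (auto simp: cell_def)
  obtain \<sigma> where \<sigma>: "\<sigma> \<in> inf_words" "coding \<sigma> = y" using y(1) by (rule coding_surj)
  have "\<exists>\<tau>. \<tau> \<in> inf_words \<and> coding \<tau> = word_map w y \<and> map \<tau> [0..<k] = w" if "w \<in> words k" for w k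
    using that
  proof (induction w arbitrary: k)
    case Nil
    then show ?case using \<sigma> by (auto simp: words_def)
  next
    case (Cons i w)
    then obtain k' where k': "k = Suc k'" "w \<in> words k'" "i \<in> {1..M}" by (auto simp: words_def)
    obtain \<tau> where "\<tau> \<in> inf_words" "coding \<tau> = word_map w y" "map \<tau> [0..<k'] = w"
      using Cons.IH[OF k'(2)] by blast
    then show ?case
      using k' coding_case_nat case_nat_inf_words
      by (intro exI[of _ "case_nat i \<tau>"]) (simp add: prefix_Suc del: upt_Suc)
  qed
  from this[OF assms(1)] show ?thesis using that y(2) by auto
qed

text \<open>
  The finitely many cells of level \<open>k\<close> that miss \<open>x\<close> form a closed set, so a point close to \<open>x\<close> shares
  a cell of level \<open>k\<close> with \<open>x\<close>.
\<close>

lemma continuous_on_extension: "continuous_on F (extension n f)"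
  unfolding continuous_on_iff
proof (intro ballI allI impI)
  fix x and e :: real assume x: "x \<in> F" and e: "0 < e"
  obtain k where k: "\<And>\<tau> \<tau>'. \<tau> \<in> inf_words \<Longrightarrow> \<tau>' \<in> inf_words \<Longrightarrow> map \<tau> [0..<k] = map \<tau>' [0..<k] \<Longrightarrow>
    \<bar>extension_code n f \<tau> - extension_code n f \<tau>'\<bar> \<le> e / 2"
    using extension_code_oscillation[of "e / 2" n f] e half_gt_zero by metis
  define V where "V = (\<Union>w\<in>{w \<in> words k. x \<notin> cell w}. cell w)"
  have "finite {w \<in> words k. x \<notin> cell w}" using finite_words by simp
  then have "closed V" unfolding V_def using compact_cell
    by (intro compact_imp_closed compact_UN) (auto simp: words_def)
  moreover have "x \<notin> V" by (auto simp: V_def)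
ultimately have "open (- V)" "x \<in> - V" by auto
  then obtain d where d: "0 < d" "\<And>y. dist y x < d \<Longrightarrow> y \<in> - V" unfolding open_dist by blast
  show "\<exists>d>0. \<forall>y\<in>F. dist y x < d \<longrightarrow> dist (extension n f y) (extension n f x) < e"
  proof (intro exI[of _ d] conjI ballI impI d(1))
    fix y assume y: "y \<in> F" "dist y x < d"
    obtain \<tau> where \<tau>: "\<tau> \<in> inf_words" "coding \<tau> = y" "\<And>k. map \<tau> [0..<k] \<in> words k" "\<And>k. y \<in> cell (map \<tau> [0..<k])"
      using y(1) by (rule words_cover) blast
    have "y \<notin> V" using d(2)[of y] y(2) by auto
    then have "x \<in> cell (map \<tau> [0..<k])" using \<tau>(3,4)[of k] by (auto simp: V_def)
    then obtain \<sigma> where \<sigma>: "\<sigma> \<in> inf_words" "coding \<sigma> = x" "map \<sigma> [0..<k] = map \<tau> [0..<k]"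
      using coding_append_exists[OF \<tau>(3)] by blast
    have "\<bar>extension n f y - extension n f x\<bar> \<le> e / 2"
      using k[OF \<tau>(1) \<sigma>(1)] \<sigma> \<tau> extension_coding[of \<sigma> n f] extension_coding[of \<tau> n f] by simp
    then show "dist (extension n f y) (extension n f x) < e" using e by (simp add: dist_real_def)
  qed
qed

lemma energy_n_cong: "(\<And>x. x \<in> F \<Longrightarrow> f x = g x) \<Longrightarrow> energy_n n f f = energy_n n g g"
proof (induction n arbitrary: f g)
  case 0
  then show ?case using boundary_subset_F by (auto intro!: energy0_cong)
next
  case (Suc n)
  show ?case unfolding energy_n_Suc
  proof (intro sum.cong refl arg_cong2[where f="(*)"])
    fix i assume "i \<in> {1..M}"
    then show "energy_n n (f \<circ> \<psi> i) (f \<circ> \<psi> i) = energy_n n (g \<circ> \<psi> i) (g \<circ> \<psi> i)"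
      using psi_in_F Suc.prems by (intro Suc.IH) auto
  qed
qed

text \<open>
  Every step of the construction attains the minimum, so no level adds energy.
\<close>

lemma energy_n_extension_0: "energy_n m (extension 0 f) (extension 0 f) = energy0 f f"
proof (induction m arbitrary: f)
  case 0
  then show ?case using extension_boundary by (auto intro!: energy0_cong)
next
  case (Suc m)
  have "energy_n m (extension 0 f \<circ> \<psi> i) (extension 0 f \<circ> \<psi> i) = energy0 (harmonic_child f i) (harmonic_child f i)"
    if "i \<in> {1..M}" for i
  proof -
    have "energy_n m (extension 0 f \<circ> \<psi> i) (extension 0 f \<circ> \<psi> i)
      = energy_n m (extension 0 (harmonic_child f i)) (extension 0 (harmonic_child f i))"
      using extension_psi(1)[OF that] by (intro energy_n_cong) simp
    then show ?thesis using Suc by simp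
  qed
  then have "energy_n (Suc m) (extension 0 f) (extension 0 f) = (\<Sum>i=1..M. inverse (r i) * energy0 (harmonic_child f i) (harmonic_child f i))"
    unfolding energy_n_Suc by (intro sum.cong) auto
  then show ?case using harmonic_child_energy_sum[of f] by simp
qed

lemma extension_energy_bounded: "\<exists>B. \<forall>m. energy_n m (extension n f) (extension n f) \<le> B"
proof (induction n arbitrary: f)
  case 0
  then show ?case using energy_n_extension_0 by auto
next
  case (Suc n)
  let ?P = "\<lambda>f B. \<forall>m. energy_n m (extension n f) (extension n f) \<le> B"
  have "\<forall>f. \<exists>B. ?P f B" using Suc by (rule allI)
  from choice[OF this] obtain B where B: "\<forall>f. ?P f (B f)" ..
  have "energy_n m (extension (Suc n) f) (extension (Suc n) f) \<le> (\<Sum>i=1..M. inverse (r i) * B (f \<circ> \<psi> i))" for m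
  proof -
    have "energy_n (Suc m) (extension (Suc n) f) (extension (Suc n) f)
      = (\<Sum>i=1..M. inverse (r i) * energy_n m (extension n (f \<circ> \<psi> i)) (extension n (f \<circ> \<psi> i)))"
      unfolding energy_n_Suc using extension_psi(2)
      by (intro sum.cong refl arg_cong2[where f="(*)"] energy_n_cong) simp
    also have "\<dots> \<le> (\<Sum>i=1..M. inverse (r i) * B (f \<circ> \<psi> i))"
      using B r_pos by (intro sum_mono mult_left_mono) (auto simp: less_imp_le)
    finally show ?thesis using energy_n_mono order_trans by blast
  qed
  then show ?case by blast
qed

lemma extension_form_domain: "extension n f \<in> form_domain"
  using extension_energy_bounded[of n f] continuous_on_extension form_domainI by blast

text \<open>
  On the vertices of a fine level take the value 1 in the cells that contain \<open>y\<close> and 0 elsewhere.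
  Cells of \<open>x\<close> and cells of \<open>y\<close> are then disjoint, so the harmonic extension is constant on each of
  them.  It follows that the infimum in the definition of the resistance is over a nonempty set.
\<close>

lemma form_domain_separates:
  assumes "x \<in> F" "y \<in> F" "x \<noteq> y"
  obtains f where "f \<in> form_domain" "f x = 0" "f y = 1"
proof -
  have "0 < dist x y / 2" using assms by simp
  then obtain n where n: "\<And>w u v. w \<in> words n \<Longrightarrow> u \<in> cell w \<Longrightarrow> v \<in> cell w \<Longrightarrow> dist u v < dist x y / 2"
    by (rule cells_shrink) blast
  define g :: "'a \<Rightarrow> real" where "g p = (if \<exists>w\<in>words n. y \<in> cell w \<and> p \<in> cell w then 1 else 0)" for p
  have in_cell: "word_map w p \<in> cell w" if "p \<in> boundary" for w p
    using that boundary_subset_F by (auto simp: cell_def)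
  obtain \<sigma> where \<sigma>: "\<sigma> \<in> inf_words" "coding \<sigma> = x" "\<And>k. map \<sigma> [0..<k] \<in> words k" "\<And>k. x \<in> cell (map \<sigma> [0..<k])"
    using assms(1) by (rule words_cover) blast
  obtain \<tau> where \<tau>: "\<tau> \<in> inf_words" "coding \<tau> = y" "\<And>k. map \<tau> [0..<k] \<in> words k" "\<And>k. y \<in> cell (map \<tau> [0..<k])"
    using assms(2) by (rule words_cover) blast
  have "g (word_map (map \<tau> [0..<n]) p) = 1" if "p \<in> boundary" for p
    using in_cell[OF that] \<tau>(3,4) by (auto simp: g_def)
  then have y: "extension n g y = 1"
    using extension_code_bounds[of 1 g \<tau> n 1] extension_coding[OF \<tau>(1), of n g] \<tau>(2) by auto
  have "g (word_map (map \<sigma> [0..<n]) p) = 0" if "p \<in> boundary" for p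
  proof -
    have "\<not> (y \<in> cell w \<and> word_map (map \<sigma> [0..<n]) p \<in> cell w)" if "w \<in> words n" for w
      using n[OF that, of y "word_map (map \<sigma> [0..<n]) p"]
        n[OF \<sigma>(3) \<sigma>(4), of "word_map (map \<sigma> [0..<n]) p"] in_cell[OF \<open>p \<in> boundary\<close>, of "map \<sigma> [0..<n]"]
        dist_triangle_half_l[of x "word_map (map \<sigma> [0..<n]) p" "dist x y" y]
      by (auto simp: dist_commute)
    then show ?thesis by (auto simp: g_def)
  qed
  then have x: "extension n g x = 0"
    using extension_code_bounds[of 0 g \<sigma> n 0] extension_coding[OF \<sigma>(1), of n g] \<sigma>(2) by auto
  show ?thesis using that extension_form_domain x y by blast
qed

section \<open>The resistance metric\<close>

text \<open>
  Fix a boundary point \<open>p0\<close> and a code of \<open>x\<close>, and compare the images of \<open>p0\<close> under the maps of two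
  successive prefixes.  Inside one cell the increment is controlled because the first-level cells form
  a connected graph and the energy controls the oscillation on the vertices of each of them.  After
  \<open>n\<close> letters rescaling supplies the factor \<open>r_max ^ n\<close> for the energy, hence \<open>sqrt r_max ^ n\<close> for the
  increment, and the geometric series converges.
\<close>

lemma energy_controls_oscillation:
  obtains K where "0 < K" "\<And>f x y. f \<in> form_domain \<Longrightarrow> x \<in> F \<Longrightarrow> y \<in> F \<Longrightarrow> (f x - f y)\<^sup>2 \<le> K * energy f f"
proof -
  obtain K where K: "0 \<le> K"
    "\<And>f p q. p \<in> boundary \<Longrightarrow> q \<in> boundary \<Longrightarrow> \<bar>f p - f q\<bar> \<le> K * sqrt (energy0 f f)"
    by (rule energy0_controls_oscillation) blast
  obtain p0 where p0: "p0 \<in> boundary" using boundary_nonempty by blast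
  have p0F: "p0 \<in> F" using p0 boundary_subset_F by blast
  define K1 where "K1 = K * (1 + 2 * M)"
  have step: "\<bar>f p0 - f (\<psi> i p0)\<bar> \<le> K1 * sqrt (energy f f)" if f: "f \<in> form_domain" and i: "i \<in> {1..M}" for f i
  proof -
    define D where "D = K * sqrt (energy f f)"
    have D: "0 \<le> D" using K energy_nonneg[OF f] by (simp add: D_def)
    have cell_osc: "\<bar>f (\<psi> j p) - f (\<psi> j q)\<bar> \<le> D" if "j \<in> {1..M}" "p \<in> boundary" "q \<in> boundary" for j p q
    proof -
      note c = comp_psi_form_domain[OF f that(1)]
      have "energy0 (f \<circ> \<psi> j) (f \<circ> \<psi> j) \<le> energy (f \<circ> \<psi> j) (f \<circ> \<psi> j)"
        using energy_n_le_energy[OF c(1), of 0] by simp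
      also have "\<dots> \<le> r j * energy f f" by (rule c(2))
      also have "\<dots> \<le> 1 * energy f f"
        using r_less_1[OF that(1)] energy_nonneg[OF f] by (intro mult_right_mono) auto
      finally have "K * sqrt (energy0 (f \<circ> \<psi> j) (f \<circ> \<psi> j)) \<le> D"
        unfolding D_def using K(1) by (intro mult_left_mono real_sqrt_le_mono) auto
      with K(2)[OF that(2,3), of "f \<circ> \<psi> j"] show ?thesis by simp
    qed
    define G where "G j = f (\<psi> j p0)" for j
    have osc: "\<bar>G j - G i\<bar> \<le> card {1..M} * (2 * D)" if "j \<in> {1..M}" for j
    proof (rule connected_graph_oscillation[where adj = "\<lambda>i j. \<psi> i ` F \<inter> \<psi> j ` F \<noteq> {}"])
      fix A assume "A \<subseteq> {1..M}" "A \<noteq> {}" "A \<noteq> {1..M}"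
      then obtain i j where "i \<in> A" "j \<in> {1..M} - A" "\<psi> i ` F \<inter> \<psi> j ` F \<noteq> {}" by (rule cells_connected)
      then show "\<exists>u\<in>A. \<exists>v\<in>{1..M} - A. \<psi> u ` F \<inter> \<psi> v ` F \<noteq> {}" by blast
    next
      fix u v assume uv: "u \<in> {1..M}" "v \<in> {1..M}" "\<psi> u ` F \<inter> \<psi> v ` F \<noteq> {}"
      show "\<bar>G u - G v\<bar> \<le> 2 * D"
      proof (cases "u = v")
        case False
        obtain p q where pq: "p \<in> boundary" "q \<in> boundary" "\<psi> u p = \<psi> v q"
          by (rule cells_meet_in_boundary[OF uv(1,2) False uv(3)])
        have "\<bar>f (\<psi> u p0) - f (\<psi> u p)\<bar> \<le> D" "\<bar>f (\<psi> v q) - f (\<psi> v p0)\<bar> \<le> D"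
          using cell_osc uv pq p0 by blast+
        then show ?thesis using pq(3) by (simp add: G_def)
      qed (use D in simp)
    qed (use i that D in auto)
    obtain j q where j: "j \<in> {1..M}" "q \<in> boundary" "p0 = \<psi> j q" by (rule boundary_preimage[OF p0])
    have "\<bar>f p0 - G j\<bar> \<le> D" using cell_osc[OF j(1,2) p0] j(3) by (simp add: G_def)
    moreover have "\<bar>G j - G i\<bar> \<le> M * (2 * D)" using osc[OF j(1)] by simp
    ultimately have "\<bar>f p0 - G i\<bar> \<le> D + M * (2 * D)" by linarith
    also have "\<dots> = K1 * sqrt (energy f f)" by (simp add: K1_def D_def algebra_simps)
    finally show ?thesis by (simp add: G_def)
  qed
  define q where "q = sqrt r_max"
  have q: "0 < q" "q < 1" using r_max_bounds by (auto simp: q_def)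
  define K2 where "K2 = K1 / (1 - q)"
  have K2: "0 \<le> K2" "K1 = K2 * (1 - q)" using q K by (auto simp: K2_def K1_def)
  have base: "\<bar>f p0 - f x\<bar> \<le> K2 * sqrt (energy f f)" if f: "f \<in> form_domain" and x: "x \<in> F" for f x
  proof -
    obtain \<tau> where \<tau>: "\<tau> \<in> inf_words" "coding \<tau> = x" using x by (rule coding_surj)
    define a where "a n = word_map (map \<tau> [0..<n]) p0" for n
    have letters: "set (map \<tau> [0..<n]) \<subseteq> {1..M}" for n using inf_wordsD[OF \<tau>(1)] by auto
    have aF: "a n \<in> F" for n unfolding a_def using word_map_in_F[OF letters p0F] .
    have r_word_le: "r_word (map \<tau> [0..<n]) \<le> r_max ^ n" for n
    proof (induction n)
      case (Suc n)
      have "r_word (map \<tau> [0..<Suc n]) = r_word (map \<tau> [0..<n]) * r (\<tau> n)" by (simp add: r_word_def)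
      also have "\<dots> \<le> r_max ^ n * r_max"
        using Suc r_le_max[OF inf_wordsD[OF \<tau>(1)], of n] r_pos[OF inf_wordsD[OF \<tau>(1)], of n] r_max_bounds
        by (intro mult_mono) auto
      finally show ?case by (simp add: mult.commute)
    qed (simp add: r_word_def)
    have inc: "\<bar>f (a n) - f (a (Suc n))\<bar> \<le> K1 * q ^ n * sqrt (energy f f)" for n
    proof -
      let ?w = "map \<tau> [0..<n]"
      note c = comp_word_map_form_domain[OF f letters[of n]]
      have "\<bar>(f \<circ> word_map ?w) p0 - (f \<circ> word_map ?w) (\<psi> (\<tau> n) p0)\<bar>
        \<le> K1 * sqrt (energy (f \<circ> word_map ?w) (f \<circ> word_map ?w))"
        using step[of "f \<circ> word_map ?w" "\<tau> n"] c inf_wordsD[OF \<tau>(1)] by blast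
      also have "\<dots> \<le> K1 * sqrt (r_max ^ n * energy f f)"
      proof (intro mult_left_mono real_sqrt_le_mono)
        show "energy (f \<circ> word_map ?w) (f \<circ> word_map ?w) \<le> r_max ^ n * energy f f"
          using c r_word_le[of n] mult_right_mono[OF r_word_le[of n] energy_nonneg[OF f]] by linarith
      qed (use K2 q in auto)
      also have "\<dots> = K1 * q ^ n * sqrt (energy f f)" by (simp add: q_def real_sqrt_mult real_sqrt_power)
      finally show ?thesis by (simp add: a_def word_map_append)
    qed
    have part: "\<bar>f p0 - f (a n)\<bar> \<le> K2 * (1 - q ^ n) * sqrt (energy f f)" for n
    proof (induction n)
      case (Suc n)
      have "\<bar>f p0 - f (a (Suc n))\<bar> \<le> K2 * (1 - q ^ n) * sqrt (energy f f) + K1 * q ^ n * sqrt (energy f f)"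
        using Suc inc[of n] by linarith
      also have "\<dots> = K2 * (1 - q ^ Suc n) * sqrt (energy f f)" by (simp add: K2(2) algebra_simps)
      finally show ?case .
    qed (simp add: a_def)
    have "a \<longlonglongrightarrow> x"
    proof (rule metric_LIMSEQ_I)
      fix e :: real assume "0 < e"
      then obtain m where m: "\<And>w x y. w \<in> words m \<Longrightarrow> x \<in> cell w \<Longrightarrow> y \<in> cell w \<Longrightarrow> dist x y < e"
        by (rule cells_shrink) blast
      have "dist (a n) x < e" if "m \<le> n" for n
      proof -
        have "a n \<in> cell (map \<tau> [0..<n])" using p0F by (simp add: a_def cell_def)
        then have "a n \<in> cell (map \<tau> [0..<m])" using cell_prefix_mono[OF \<tau>(1) that] by blast
        then show ?thesis using m[OF prefix_in_words[OF \<tau>(1)]] coding_in_cell[OF \<tau>(1), of m] \<tau>(2) by blast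
      qed
      then show "\<exists>m. \<forall>n\<ge>m. dist (a n) x < e" by blast
    qed
    moreover have "continuous_on F f" using f by (simp add: form_domain_def)
    ultimately have lim: "(\<lambda>n. f (a n)) \<longlonglongrightarrow> f x"
      using continuous_on_tendsto_compose[of F f a x] x aF by simp
    have "(\<lambda>n. \<bar>f p0 - f (a n)\<bar>) \<longlonglongrightarrow> \<bar>f p0 - f x\<bar>" by (intro tendsto_intros lim)
    moreover have "\<bar>f p0 - f (a n)\<bar> \<le> K2 * sqrt (energy f f)" for n
    proof -
      have "K2 * (1 - q ^ n) * sqrt (energy f f) \<le> K2 * 1 * sqrt (energy f f)"
        using K2 q energy_nonneg[OF f] by (intro mult_right_mono mult_left_mono) auto
      then show ?thesis using part[of n] by simp
    qed
    ultimately show ?thesis by (intro LIMSEQ_le_const2) auto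
  qed
  show ?thesis
  proof (rule that[of "(2 * K2)\<^sup>2 + 1"])
    fix f x y assume fxy: "f \<in> form_domain" "x \<in> F" "y \<in> F"
    have "\<bar>f x - f y\<bar> \<le> 2 * K2 * sqrt (energy f f)" using base[OF fxy(1,2)] base[OF fxy(1,3)] by linarith
    then have "\<bar>f x - f y\<bar>\<^sup>2 \<le> (2 * K2 * sqrt (energy f f))\<^sup>2" by (intro power_mono) auto
    then have "(f x - f y)\<^sup>2 \<le> (2 * K2)\<^sup>2 * energy f f"
      using energy_nonneg[OF fxy(1)] by (simp add: power_mult_distrib)
    then show "(f x - f y)\<^sup>2 \<le> ((2 * K2)\<^sup>2 + 1) * energy f f"
      using energy_nonneg[OF fxy(1)] by (simp add: algebra_simps)
  qed (simp add: add_nonneg_pos)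
qed

lemma energy_n_affine: "energy_n n (\<lambda>x. a * f x + b) (\<lambda>x. a * f x + b) = a\<^sup>2 * energy_n n f f"
proof (induction n arbitrary: f)
  case 0
  have "(a * f x + b - (a * f y + b))\<^sup>2 = a\<^sup>2 * (f x - f y)\<^sup>2" for x y
    by (simp add: power2_eq_square algebra_simps)
  then show ?case by (simp add: energy0_eq sum_distrib_left mult_ac)
next
  case (Suc n)
  have "energy_n n ((\<lambda>x. a * f x + b) \<circ> \<psi> i) ((\<lambda>x. a * f x + b) \<circ> \<psi> i) = a\<^sup>2 * energy_n n (f \<circ> \<psi> i) (f \<circ> \<psi> i)" for i
    using Suc[of "f \<circ> \<psi> i"] by (simp add: comp_def)
  then show ?case by (simp add: energy_n_Suc sum_distrib_left mult_ac)
qed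

lemma affine_form_domain:
  assumes f: "f \<in> form_domain"
  shows "(\<lambda>x. a * f x + b) \<in> form_domain" "energy (\<lambda>x. a * f x + b) (\<lambda>x. a * f x + b) = a\<^sup>2 * energy f f"
proof -
  have lim: "(\<lambda>n. energy_n n (\<lambda>x. a * f x + b) (\<lambda>x. a * f x + b)) \<longlonglongrightarrow> a\<^sup>2 * energy f f"
    unfolding energy_n_affine by (intro tendsto_intros energy_tendsto f)
  have "continuous_on F f" using f by (simp add: form_domain_def)
  then have "continuous_on F (\<lambda>x. a * f x + b)" by (intro continuous_intros)
  with lim show "(\<lambda>x. a * f x + b) \<in> form_domain" unfolding form_domain_def by (auto intro: convergentI)
  show "energy (\<lambda>x. a * f x + b) (\<lambda>x. a * f x + b) = a\<^sup>2 * energy f f"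
    unfolding energy_def[of "\<lambda>x. a * f x + b"] using lim by (rule limI)
qed

lemma max_min_form_domain:
  assumes f: "f \<in> form_domain"
  shows "(\<lambda>x. max a (f x)) \<in> form_domain" "(\<lambda>x. min a (f x)) \<in> form_domain"
    "energy (\<lambda>x. max a (f x)) (\<lambda>x. max a (f x)) + energy (\<lambda>x. min a (f x)) (\<lambda>x. min a (f x)) \<le> energy f f"
proof -
  have le: "energy_n n (\<lambda>x. max a (f x)) (\<lambda>x. max a (f x)) + energy_n n (\<lambda>x. min a (f x)) (\<lambda>x. min a (f x)) \<le> energy f f" for n
    using energy_n_max_min[of n a f] energy_n_le_energy[OF f, of n] by linarith
  have cont: "continuous_on F f" using f by (simp add: form_domain_def)
  show 1: "(\<lambda>x. max a (f x)) \<in> form_domain"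
  proof (rule form_domainI)
    show "energy_n n (\<lambda>x. max a (f x)) (\<lambda>x. max a (f x)) \<le> energy f f" for n
      using le[of n] energy_n_nonneg[of n "\<lambda>x. min a (f x)"] by linarith
  qed (intro continuous_intros cont)
  show 2: "(\<lambda>x. min a (f x)) \<in> form_domain"
  proof (rule form_domainI)
    show "energy_n n (\<lambda>x. min a (f x)) (\<lambda>x. min a (f x)) \<le> energy f f" for n
      using le[of n] energy_n_nonneg[of n "\<lambda>x. max a (f x)"] by linarith
  qed (intro continuous_intros cont)
  show "energy (\<lambda>x. max a (f x)) (\<lambda>x. max a (f x)) + energy (\<lambda>x. min a (f x)) (\<lambda>x. min a (f x)) \<le> energy f f"
    by (rule LIMSEQ_le_const2[OF tendsto_add[OF energy_tendsto[OF 1] energy_tendsto[OF 2]]]) (use le in blast)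
qed

lemma resistance_self: "resistance x x = 0"
  by (simp add: resistance_def)

text \<open>
  Normalise \<open>f\<close> affinely to the values 0 and 1.  The infimum is positive because the energy controls
  the oscillation.
\<close>

lemma sq_diff_le_resistance:
  assumes f: "f \<in> form_domain" and xy: "x \<in> F" "y \<in> F"
  shows "(f x - f y)\<^sup>2 \<le> resistance x y * energy f f"
proof (cases "x = y")
  case False
  define S where "S = {energy g g | g. g \<in> form_domain \<and> g x = 0 \<and> g y = 1}"
  have R: "resistance x y = inverse (Inf S)" using False by (simp add: resistance_def S_def)
  obtain K where K: "0 < K" "\<And>g. g \<in> form_domain \<Longrightarrow> (g x - g y)\<^sup>2 \<le> K * energy g g"
    by (rule energy_controls_oscillation) (use xy in blast)
  have lower: "inverse K \<le> s" if "s \<in> S" for s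
  proof -
    from that obtain g where g: "s = energy g g" "g \<in> form_domain" "g x = 0" "g y = 1" by (auto simp: S_def)
    then have "1 \<le> K * s" using K(2)[of g] by simp
    then show ?thesis using K(1) by (simp add: field_simps)
  qed
  have bdd: "bdd_below S" using lower by (auto simp: bdd_below_def)
  obtain h where "h \<in> form_domain" "h x = 0" "h y = 1" by (rule form_domain_separates[OF xy False])
  then have "S \<noteq> {}" unfolding S_def by blast
  then have "inverse K \<le> Inf S" using lower by (rule cInf_greatest)
  then have pos: "0 < Inf S" using K(1) by (meson less_le_trans positive_imp_inverse_positive)
  show ?thesis
  proof (cases "f x = f y")
    case True
    then show ?thesis using R pos energy_nonneg[OF f] by simp
  next
    case False
    define a where "a = 1 / (f y - f x)"
    define g where "g z = a * f z + (- a * f x)" for z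
    have "g \<in> form_domain" "energy g g = a\<^sup>2 * energy f f"
      unfolding g_def using affine_form_domain[OF f, of a "- a * f x"] by auto
    moreover have "g x = 0" by (simp add: g_def)
    moreover have "g y = a * (f y - f x)" by (simp add: g_def algebra_simps)
    then have "g y = 1" using False by (simp add: a_def)
    ultimately have "a\<^sup>2 * energy f f \<in> S" unfolding S_def by (intro CollectI exI[of _ g]) simp
    then have "Inf S \<le> a\<^sup>2 * energy f f" using bdd by (rule cInf_lower)
    moreover have "a\<^sup>2 * energy f f = energy f f / (f y - f x)\<^sup>2" by (simp add: a_def power_divide)
    moreover have "0 < (f y - f x)\<^sup>2" using False by simp
    ultimately have "Inf S * (f y - f x)\<^sup>2 \<le> energy f f" by (simp add: pos_le_divide_eq)
    then have "(f y - f x)\<^sup>2 \<le> inverse (Inf S) * energy f f" using pos by (simp add: field_simps)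
    then show ?thesis by (simp add: R power2_commute)
  qed
qed (simp add: resistance_self)

text \<open>
  With the preceding lemma this characterises the resistance as the best constant in a Poincare type
  inequality.
\<close>

lemma resistance_leI:
  assumes xy: "x \<in> F" "y \<in> F" and L: "0 \<le> L"
    and bound: "\<And>f. f \<in> form_domain \<Longrightarrow> (f x - f y)\<^sup>2 \<le> L * energy f f"
  shows "resistance x y \<le> L"
proof (cases "x = y")
  case False
  define S where "S = {energy g g | g. g \<in> form_domain \<and> g x = 0 \<and> g y = 1}"
  have R: "resistance x y = inverse (Inf S)" using False by (simp add: resistance_def S_def)
  have le: "1 \<le> L * s" if "s \<in> S" for s
  proof -
    from that obtain g where g: "s = energy g g" "g \<in> form_domain" "g x = 0" "g y = 1" by (auto simp: S_def)
    then show ?thesis using bound[of g] by simp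
  qed
  obtain h where "h \<in> form_domain" "h x = 0" "h y = 1" by (rule form_domain_separates[OF xy False])
  then have ne: "S \<noteq> {}" unfolding S_def by blast
  then obtain s where "s \<in> S" by blast
  with le[of s] L have pos: "0 < L" by (cases "L = 0") auto
  have "inverse L \<le> s" if "s \<in> S" for s using le[OF that] pos by (simp add: field_simps)
  with ne have "inverse L \<le> Inf S" by (rule cInf_greatest)
  then show ?thesis unfolding R using pos by (metis inverse_inverse_eq le_imp_inverse_le positive_imp_inverse_positive)
qed (use L in \<open>simp add: resistance_self\<close>)

lemma resistance_nonneg:
  assumes "x \<in> F" "y \<in> F" shows "0 \<le> resistance x y"
proof (cases "x = y")
  case False
  obtain f where f: "f \<in> form_domain" "f x = 0" "f y = 1" by (rule form_domain_separates[OF assms False])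
  then have "1 \<le> resistance x y * energy f f" using sq_diff_le_resistance[OF f(1) assms] by simp
  then show ?thesis using energy_nonneg[OF f(1)] mult_nonpos_nonneg[of "resistance x y" "energy f f"] by linarith
qed (simp add: resistance_self)

lemma resistance_sym: assumes "x \<in> F" "y \<in> F" shows "resistance x y = resistance y x"
proof -
  have "resistance u v \<le> resistance v u" if "u \<in> F" "v \<in> F" for u v
    using that sq_diff_le_resistance[of _ v u]
    by (intro resistance_leI resistance_nonneg) (auto simp: power2_commute)
  then show ?thesis using assms by (simp add: order_antisym)
qed

text \<open>
  Cut \<open>f\<close> at the level \<open>f y\<close>.  If this level lies between \<open>f x\<close> and \<open>f z\<close>, the two halves carry the two
  increments and their energies add up to at most the energy of \<open>f\<close>; otherwise one of the increments
  alone dominates.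
\<close>

lemma resistance_triangle:
  assumes F: "x \<in> F" "y \<in> F" "z \<in> F"
  shows "resistance x z \<le> resistance x y + resistance y z"
proof (rule resistance_leI[OF F(1,3)])
  note nn = resistance_nonneg[OF F(1,2)] resistance_nonneg[OF F(2,3)]
  show "0 \<le> resistance x y + resistance y z" using nn by simp
  fix f assume f: "f \<in> form_domain"
  define a where "a = f y"
  define g h where "g = (\<lambda>x. max a (f x))" and "h = (\<lambda>x. min a (f x))"
  note gh = max_min_form_domain[OF f, of a, folded g_def h_def]
  have E: "0 \<le> energy g g" "0 \<le> energy h h" "0 \<le> energy f f" using gh f energy_nonneg by auto
  have split: "(u + v)\<^sup>2 \<le> (resistance x y + resistance y z) * energy f f"
    if "u\<^sup>2 \<le> resistance x y * energy k k" "v\<^sup>2 \<le> resistance y z * energy l l"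
      "0 \<le> energy k k" "0 \<le> energy l l" "energy k k + energy l l \<le> energy f f" for u v k l
  proof -
    have "(u + v)\<^sup>2 \<le> (resistance x y + resistance y z) * (energy k k + energy l l)"
      using that nn by (intro square_sum_le) auto
    also have "\<dots> \<le> (resistance x y + resistance y z) * energy f f"
      using that nn by (intro mult_left_mono) auto
    finally show ?thesis .
  qed
  have far: "(f x - f z)\<^sup>2 \<le> (resistance x y + resistance y z) * energy f f"
    if "\<bar>f x - f z\<bar> \<le> \<bar>f x - a\<bar> \<or> \<bar>f x - f z\<bar> \<le> \<bar>a - f z\<bar>"
  proof -
    have "(f x - f z)\<^sup>2 \<le> (f x - a)\<^sup>2 \<or> (f x - f z)\<^sup>2 \<le> (a - f z)\<^sup>2"
      using that by (simp add: abs_le_square_iff)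
    moreover have "(f x - a)\<^sup>2 \<le> resistance x y * energy f f" "(a - f z)\<^sup>2 \<le> resistance y z * energy f f"
      unfolding a_def using F f sq_diff_le_resistance by auto
    moreover have "0 \<le> resistance x y * energy f f" "0 \<le> resistance y z * energy f f" using nn E by auto
    ultimately show ?thesis by (auto simp: algebra_simps)
  qed
  consider "f z \<le> a" "a \<le> f x" | "f x \<le> a" "a \<le> f z"
    | "\<bar>f x - f z\<bar> \<le> \<bar>f x - a\<bar> \<or> \<bar>f x - f z\<bar> \<le> \<bar>a - f z\<bar>" by linarith
  then show "(f x - f z)\<^sup>2 \<le> (resistance x y + resistance y z) * energy f f"
  proof cases
    case 1
    then have vals: "g x = f x" "g y = a" "h y = a" "h z = f z" by (auto simp: g_def h_def a_def)
    have "(f x - a)\<^sup>2 \<le> resistance x y * energy g g" "(a - f z)\<^sup>2 \<le> resistance y z * energy h h"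
      using sq_diff_le_resistance[OF gh(1) F(1,2)] sq_diff_le_resistance[OF gh(2) F(2,3)] vals by simp_all
    from split[OF this] show ?thesis using E gh(3) by simp
  next
    case 2
    then have vals: "h x = f x" "h y = a" "g y = a" "g z = f z" by (auto simp: g_def h_def a_def)
    have "(f x - a)\<^sup>2 \<le> resistance x y * energy h h" "(a - f z)\<^sup>2 \<le> resistance y z * energy g g"
      using sq_diff_le_resistance[OF gh(2) F(1,2)] sq_diff_le_resistance[OF gh(1) F(2,3)] vals by simp_all
    from split[OF this] show ?thesis using E gh(3) by simp
  next
    case 3
    then show ?thesis by (rule far)
  qed
qed

text \<open>
  Pulling a function back from a cell to \<open>F\<close> multiplies its energy by at most \<open>r_word w\<close>.
\<close>

lemma resistance_cell_bound:
  obtains K where "0 < K"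
    "\<And>w x y. set w \<subseteq> {1..M} \<Longrightarrow> x \<in> cell w \<Longrightarrow> y \<in> cell w \<Longrightarrow> resistance x y \<le> K * r_word w"
proof -
  obtain K where K: "0 < K" "\<And>f x y. f \<in> form_domain \<Longrightarrow> x \<in> F \<Longrightarrow> y \<in> F \<Longrightarrow> (f x - f y)\<^sup>2 \<le> K * energy f f"
    by (rule energy_controls_oscillation) blast
  show ?thesis
  proof (rule that[OF K(1)])
    fix w x y assume w: "set w \<subseteq> {1..M}" and xy: "x \<in> cell w" "y \<in> cell w"
    obtain x' y' where xy': "x' \<in> F" "y' \<in> F" "x = word_map w x'" "y = word_map w y'" using xy by (auto simp: cell_def)
    show "resistance x y \<le> K * r_word w"
    proof (rule resistance_leI)
      show "x \<in> F" "y \<in> F" using xy cell_subset[OF w] by auto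
      show "0 \<le> K * r_word w" using K(1) r_word_pos[OF w] by simp
      fix f assume f: "f \<in> form_domain"
      note c = comp_word_map_form_domain[OF f w]
      have "(f x - f y)\<^sup>2 \<le> K * energy (f \<circ> word_map w) (f \<circ> word_map w)"
        using K(2)[of "f \<circ> word_map w" x' y'] c xy' by simp
      also have "\<dots> \<le> K * (r_word w * energy f f)" using c K(1) by (intro mult_left_mono) auto
      finally show "(f x - f y)\<^sup>2 \<le> K * r_word w * energy f f" by (simp add: mult.assoc)
    qed
  qed
qed

section \<open>Similarity dimension and covering numbers\<close>

text \<open>
  The sum is continuous and strictly decreasing, equals \<open>M\<close> at 0 and tends to zero.
\<close>

lemma dim_H_spec: "0 < dim_H" "(\<Sum>i=1..M. r i powr dim_H) = 1"
proof -
  define g where "g d = (\<Sum>i=1..M. r i powr d)" for d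
  have r_ne: "r i \<noteq> 0" if "i \<in> {1..M}" for i using r_pos[OF that] by simp
  have cont: "continuous_on S g" for S
    unfolding g_def using r_ne by (intro continuous_intros) auto
  have anti: "g b < g a" if "a < b" for a b
    unfolding g_def
  proof (rule sum_strict_mono)
    show "{1..M} \<noteq> {}" using two_le_M by auto
    show "r i powr b < r i powr a" if "i \<in> {1..M}" for i
    proof -
      have "ln (r i) < 0" using r_bounds[OF that] by simp
      then have "b * ln (r i) < a * ln (r i)" by (rule mult_strict_right_mono_neg[OF \<open>a < b\<close>])
      then show ?thesis using r_pos[OF that] by (simp add: powr_def)
    qed
  qed simp
  have "g 0 = (\<Sum>i=1..M. 1)" unfolding g_def using r_ne by (intro sum.cong) auto
  then have g0: "1 < g 0" using two_le_M by simp
  have "(\<lambda>n. real M * r_max ^ n) \<longlonglongrightarrow> real M * 0" using r_max_bounds by (intro tendsto_intros LIMSEQ_power_zero) auto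
  then have "\<forall>\<^sub>F n in sequentially. M * r_max ^ n < 1" by (intro order_tendstoD(2)) auto
  then obtain n where n: "M * r_max ^ n < 1" by (auto simp: eventually_sequentially)
  have "g n \<le> (\<Sum>i=1..M. r_max ^ n)"
    unfolding g_def
  proof (rule sum_mono)
    fix i assume i: "i \<in> {1..M}"
    then show "r i powr real n \<le> r_max ^ n"
      using power_mono[OF r_le_max[OF i], of n] r_pos[OF i] by (simp add: powr_realpow)
  qed
  with n have gn: "g n < 1" by simp
  obtain d where d: "0 \<le> d" "d \<le> real n" "g d = 1"
    using IVT2'[of g "real n" 1 0] g0 gn cont by auto
  have d_pos: "0 < d" using d(1,3) g0 by (cases "d = 0") auto
  \<comment> \<open>the description operator in \<open>dim_H\<close> needs uniqueness\<close>
  have "\<exists>!d. 0 < d \<and> g d = 1"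
  proof (rule ex1I[of _ d])
    fix d' assume "0 < d' \<and> g d' = 1"
    then show "d' = d" using anti[of d d'] anti[of d' d] d(3) by (cases d d' rule: linorder_cases) auto
  qed (use d d_pos in simp)
  from theI'[OF this] show "0 < dim_H" "(\<Sum>i=1..M. r i powr dim_H) = 1"
    unfolding dim_H_def g_def by auto
qed

definition r_min :: real where "r_min = Min (r ` {1..M})"

lemma r_min_le: "i \<in> {1..M} \<Longrightarrow> r_min \<le> r i"
  by (simp add: r_min_def)

lemma r_min_pos: "0 < r_min"
proof -
  have "r_min \<in> r ` {1..M}" unfolding r_min_def using two_le_M by (intro Min_in) auto
  then show ?thesis using r_bounds by auto
qed

text \<open>
  Subdivide until the weight of a cell drops to \<open>\<epsilon>\<close>.  One subdivision replaces \<open>\<epsilon>\<close> by \<open>\<epsilon> / r i\<close>, and the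
  cardinality bound reproduces itself because the numbers \<open>r i powr dim_H\<close> sum to one.  The range of
  \<open>\<epsilon>\<close> extends up to \<open>1 / r_min\<close> since the last subdivision may overshoot by a factor \<open>1 / r i\<close>.
\<close>

lemma cells_of_small_resistance:
  assumes "0 < \<epsilon>" "r_min * \<epsilon> \<le> 1"
  shows "\<exists>W. finite W \<and> (\<forall>w\<in>W. set w \<subseteq> {1..M} \<and> r_word w \<le> \<epsilon>) \<and> F \<subseteq> (\<Union>w\<in>W. cell w) \<and>
    card W \<le> (r_min * \<epsilon>) powr (- dim_H)"
proof -
  let ?cover = "\<lambda>\<epsilon> W. finite W \<and> (\<forall>w\<in>W. set w \<subseteq> {1..M} \<and> r_word w \<le> \<epsilon>) \<and> F \<subseteq> (\<Union>w\<in>W. cell w) \<and>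
    card W \<le> (r_min * \<epsilon>) powr (- dim_H)"
  have large: "?cover \<epsilon> {[]}" if "1 \<le> \<epsilon>" "r_min * \<epsilon> \<le> 1" for \<epsilon>
  proof -
    have pos: "0 < r_min * \<epsilon>" using that r_min_pos by simp
    then have "\<bar>r_min * \<epsilon>\<bar> \<le> 1" using that(2) by linarith
    then have "(r_min * \<epsilon>) powr dim_H \<le> 1" using dim_H_spec(1) by (intro powr_le1) auto
    then have "1 \<le> (r_min * \<epsilon>) powr (- dim_H)"
      unfolding powr_minus using pos by (intro one_le_inverse) auto
    moreover have "real (card {[] :: nat list}) = 1" by simp
    ultimately have 1: "card {[] :: nat list} \<le> (r_min * \<epsilon>) powr (- dim_H)" by linarith
    have 2: "\<forall>w\<in>{[]}. set w \<subseteq> {1..M} \<and> r_word w \<le> \<epsilon>" using that(1) by (simp add: r_word_def)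
    have 3: "F \<subseteq> (\<Union>w\<in>{[]}. cell w)" by (simp add: cell_def)
    show ?thesis by (intro conjI finite.intros 1 2 3)
  qed
  have "\<exists>W. ?cover \<epsilon> W" if "r_max ^ n \<le> \<epsilon>" "0 < \<epsilon>" "r_min * \<epsilon> \<le> 1" for n \<epsilon>
    using that
  proof (induction n arbitrary: \<epsilon>)
    case 0
    then have "1 \<le> \<epsilon>" by simp
    from large[OF this 0(3)] show ?case by (rule exI[of "?cover \<epsilon>"])
  next
    case (Suc n)
    show ?case
    proof (cases "1 \<le> \<epsilon>")
      case True
      from large[OF this Suc.prems(3)] show ?thesis by (rule exI[of "?cover \<epsilon>"])
    next
      case False
      have "\<exists>W. ?cover (\<epsilon> / r i) W" if i: "i \<in> {1..M}" for i
      proof (rule Suc.IH)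
        have "r_max ^ n * r i \<le> r_max ^ n * r_max" using r_le_max[OF i] r_max_bounds by (intro mult_left_mono) auto
        then show "r_max ^ n \<le> \<epsilon> / r i" using Suc.prems(1) r_pos[OF i] by (simp add: field_simps)
        show "0 < \<epsilon> / r i" using Suc.prems r_pos[OF i] by simp
        have "r_min * \<epsilon> \<le> r i * 1" using r_min_le[OF i] r_min_pos False Suc.prems by (intro mult_mono) auto
        then show "r_min * (\<epsilon> / r i) \<le> 1" using r_pos[OF i] by (simp add: field_simps)
      qed
      then have "\<forall>i\<in>{1..M}. \<exists>W. ?cover (\<epsilon> / r i) W" by (rule ballI)
      from bchoice[OF this] obtain W where W: "\<forall>i\<in>{1..M}. ?cover (\<epsilon> / r i) (W i)" ..
      define V where "V = (\<Union>i\<in>{1..M}. (#) i ` W i)"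
      have 1: "finite V" unfolding V_def using W by simp
      have 2: "set w \<subseteq> {1..M} \<and> r_word w \<le> \<epsilon>" if w: "w \<in> V" for w
      proof -
        obtain i v where iv: "i \<in> {1..M}" "v \<in> W i" "w = i # v" using w by (auto simp: V_def)
        then have v: "set v \<subseteq> {1..M}" "r_word v \<le> \<epsilon> / r i" using W by blast+
        then have "r i * r_word v \<le> \<epsilon>" using r_pos[OF iv(1)] by (simp add: field_simps)
        then show ?thesis using v(1) iv by (simp add: r_word_Cons)
      qed
      have 3: "F \<subseteq> (\<Union>w\<in>V. cell w)"
      proof
        fix x assume "x \<in> F"
        then obtain i y where iy: "i \<in> {1..M}" "y \<in> F" "x = \<psi> i y" using self_similar by blast
        have "F \<subseteq> (\<Union>w\<in>W i. cell w)" using W iy(1) by simp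
        then obtain v where "v \<in> W i" "y \<in> cell v" using iy(2) by blast
        then have "x \<in> cell (i # v)" "i # v \<in> V" using iy by (auto simp: cell_def V_def)
        then show "x \<in> (\<Union>w\<in>V. cell w)" by blast
      qed
      have 4: "card V \<le> (r_min * \<epsilon>) powr (- dim_H)"
      proof -
        have "card V \<le> (\<Sum>i\<in>{1..M}. card ((#) i ` W i))" unfolding V_def by (rule card_UN_le) simp
        also have "\<dots> \<le> (\<Sum>i\<in>{1..M}. card (W i))" using W by (intro sum_mono card_image_le) simp
        finally have "real (card V) \<le> real (\<Sum>i\<in>{1..M}. card (W i))" by (rule of_nat_mono)
        also have "\<dots> = (\<Sum>i\<in>{1..M}. real (card (W i)))" by (rule of_nat_sum)
        also have "\<dots> \<le> (\<Sum>i\<in>{1..M}. (r_min * \<epsilon>) powr (- dim_H) * r i powr dim_H)"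
        proof (rule sum_mono)
          fix i assume i: "i \<in> {1..M}"
          have "real (card (W i)) \<le> (r_min * (\<epsilon> / r i)) powr (- dim_H)" using W i by simp
          also have "\<dots> = (r_min * \<epsilon>) powr (- dim_H) * r i powr dim_H"
          proof -
            have "r_min * (\<epsilon> / r i) = (r_min * \<epsilon>) / r i" by simp
            then have "(r_min * (\<epsilon> / r i)) powr (- dim_H) = (r_min * \<epsilon>) powr (- dim_H) / r i powr (- dim_H)"
              using r_pos[OF i] r_min_pos Suc.prems(2) by (simp only: powr_divide)
            then show ?thesis by (simp only: powr_minus divide_inverse inverse_inverse_eq)
          qed
          finally show "real (card (W i)) \<le> (r_min * \<epsilon>) powr (- dim_H) * r i powr dim_H" .
        qed
        also have "\<dots> = (r_min * \<epsilon>) powr (- dim_H)"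
          by (simp only: sum_distrib_left[symmetric] dim_H_spec(2) mult_1_right)
        finally show ?thesis .
      qed
      have "?cover \<epsilon> V" by (intro conjI ballI 1 3 4) (use 2 in blast)+
      then show ?thesis by (rule exI[of "?cover \<epsilon>"])
    qed
  qed
  note cover = this
  obtain n where "r_max ^ n < \<epsilon>" using real_arch_pow_inv[OF assms(1) r_max_bounds(2)] by blast
  then show ?thesis by (intro cover[of n] assms less_imp_le)
qed

lemma resistance_bounded: obtains B where "\<And>x y. x \<in> F \<Longrightarrow> y \<in> F \<Longrightarrow> resistance x y \<le> B"
proof -
  obtain K where K: "\<And>w x y. set w \<subseteq> {1..M} \<Longrightarrow> x \<in> cell w \<Longrightarrow> y \<in> cell w \<Longrightarrow> resistance x y \<le> K * r_word w"
    by (rule resistance_cell_bound) blast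
  show ?thesis using K[of "[]"] by (intro that[of "K * r_word []"]) (auto simp: cell_def)
qed

lemma resistance_entropy:
  obtains K where "\<And>\<epsilon>. 0 < \<epsilon> \<Longrightarrow> \<epsilon> \<le> 1 \<Longrightarrow>
    \<exists>N\<subseteq>F. finite N \<and> card N \<le> K * \<epsilon> powr (- dim_H) \<and> (\<forall>x\<in>F. \<exists>y\<in>N. resistance x y \<le> \<epsilon>)"
proof -
  obtain K0 where K0: "0 < K0"
    "\<And>w x y. set w \<subseteq> {1..M} \<Longrightarrow> x \<in> cell w \<Longrightarrow> y \<in> cell w \<Longrightarrow> resistance x y \<le> K0 * r_word w"
    by (rule resistance_cell_bound) blast
  define K where "K = max 1 K0"
  obtain z where z: "z \<in> F" using F_nonempty by blast
  show ?thesis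
  proof (rule that[of "(r_min / K) powr (- dim_H)"])
    fix \<epsilon> :: real assume \<epsilon>: "0 < \<epsilon>" "\<epsilon> \<le> 1"
    have K: "1 \<le> K" by (simp add: K_def)
    have "r_min < 1" using r_min_le[of 1] r_less_1[of 1] two_le_M by simp
    then have "r_min * (\<epsilon> / K) \<le> 1 * 1" using r_min_pos \<epsilon> K by (intro mult_mono) (auto simp: field_simps)
    then obtain W where W: "finite W" "\<And>w. w \<in> W \<Longrightarrow> set w \<subseteq> {1..M} \<and> r_word w \<le> \<epsilon> / K" "F \<subseteq> (\<Union>w\<in>W. cell w)"
      "card W \<le> (r_min * (\<epsilon> / K)) powr (- dim_H)"
      using cells_of_small_resistance[of "\<epsilon> / K"] \<epsilon> K by auto
    define N where "N = (\<lambda>w. word_map w z) ` W"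
    have "N \<subseteq> F" using W(2) word_map_in_F z by (auto simp: N_def)
    moreover have "finite N" using W(1) by (simp add: N_def)
    moreover have "card N \<le> (r_min / K) powr (- dim_H) * \<epsilon> powr (- dim_H)"
    proof -
      have "real (card N) \<le> real (card W)" unfolding N_def using card_image_le[OF W(1)] by simp
      also have "\<dots> \<le> (r_min * (\<epsilon> / K)) powr (- dim_H)" by (rule W(4))
      also have "\<dots> = (r_min / K) powr (- dim_H) * \<epsilon> powr (- dim_H)"
        using r_min_pos \<epsilon> K by (simp add: powr_mult[symmetric])
      finally show ?thesis .
    qed
    moreover have "\<exists>y\<in>N. resistance x y \<le> \<epsilon>" if x: "x \<in> F" for x
    proof -
      obtain w where w: "w \<in> W" "x \<in> cell w" using W(3) x by blast
      have "word_map w z \<in> cell w" using z by (simp add: cell_def)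
      then have "resistance x (word_map w z) \<le> K0 * r_word w" using K0(2) w W(2) by blast
      also have "\<dots> \<le> K * (\<epsilon> / K)"
        using W(2)[OF w(1)] r_word_pos[of w] K by (intro mult_mono) (auto simp: K_def)
      finally show ?thesis using w(1) K by (intro bexI[of _ "word_map w z"]) (auto simp: N_def)
    qed
    ultimately show "\<exists>N\<subseteq>F. finite N \<and> card N \<le> (r_min / K) powr (- dim_H) * \<epsilon> powr (- dim_H) \<and>
      (\<forall>x\<in>F. \<exists>y\<in>N. resistance x y \<le> \<epsilon>)" by blast
  qed
qed

end

section \<open>Chaining in pseudometric spaces of polynomial entropy\<close>

text \<open>
  Continuity follows from the estimate with the exponent \<open>\<delta> / 2\<close>.
\<close>

lemma ess_holder_onI:
  assumes \<delta>: "0 < \<delta>" and nonneg: "\<And>x y. x \<in> S \<Longrightarrow> y \<in> S \<Longrightarrow> 0 \<le> d x y"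
    and holder: "\<And>\<eta>. 0 < \<eta> \<Longrightarrow> \<eta> < \<delta> \<Longrightarrow> \<exists>c. \<forall>x\<in>S. \<forall>y\<in>S. dist (f x) (f y) \<le> c * d x y powr \<eta>"
  shows "ess_holder_on \<delta> S d f"
proof -
  obtain c where c: "\<And>x y. x \<in> S \<Longrightarrow> y \<in> S \<Longrightarrow> dist (f x) (f y) \<le> c * d x y powr (\<delta> / 2)"
    using holder[of "\<delta> / 2"] \<delta> by auto
  have "\<exists>h>0. \<forall>y\<in>S. d x y < h \<longrightarrow> dist (f x) (f y) < e" if x: "x \<in> S" and e: "0 < e" for x e
  proof (intro exI[of _ "(e / (\<bar>c\<bar> + 1)) powr (2 / \<delta>)"] conjI ballI impI)
    fix y assume y: "y \<in> S" "d x y < (e / (\<bar>c\<bar> + 1)) powr (2 / \<delta>)"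
    have "dist (f x) (f y) \<le> c * d x y powr (\<delta> / 2)" using c x y by blast
    also have "\<dots> \<le> (\<bar>c\<bar> + 1) * d x y powr (\<delta> / 2)" by (intro mult_right_mono) auto
    also have "\<dots> < (\<bar>c\<bar> + 1) * ((e / (\<bar>c\<bar> + 1)) powr (2 / \<delta>)) powr (\<delta> / 2)"
      using nonneg[OF x y(1)] y \<delta> by (intro mult_strict_left_mono powr_less_mono2) auto
    also have "\<dots> = e" using e \<delta> by (simp add: powr_powr)
    finally show "dist (f x) (f y) < e" .
  qed (use e in auto)
  then show ?thesis unfolding ess_holder_on_def using \<delta> holder by blast
qed

lemma AE_summable_of_moments:
  fixes Z :: "nat \<Rightarrow> 'w \<Rightarrow> real"
  assumes meas: "\<And>n. Z n \<in> borel_measurable \<Omega>" and nonneg: "\<And>n \<omega>. 0 \<le> Z n \<omega>"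
    and bound: "\<And>n. (\<integral>\<^sup>+\<omega>. ennreal (Z n \<omega>) \<partial>\<Omega>) \<le> ennreal (b n)" and b: "\<And>n. 0 \<le> b n" "summable b"
  shows "AE \<omega> in \<Omega>. summable (\<lambda>n. Z n \<omega>)"
proof -
  have "(\<integral>\<^sup>+\<omega>. (\<Sum>n. ennreal (Z n \<omega>)) \<partial>\<Omega>) = (\<Sum>n. \<integral>\<^sup>+\<omega>. ennreal (Z n \<omega>) \<partial>\<Omega>)"
    using meas by (intro nn_integral_suminf) auto
  also have "\<dots> \<le> (\<Sum>n. ennreal (b n))" using bound by (intro suminf_le) auto
  also have "\<dots> = ennreal (\<Sum>n. b n)" using b by (intro suminf_ennreal2) auto
  finally have "(\<integral>\<^sup>+\<omega>. (\<Sum>n. ennreal (Z n \<omega>)) \<partial>\<Omega>) \<noteq> \<infinity>" by (auto simp: top_unique)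
  then have "AE \<omega> in \<Omega>. (\<Sum>n. ennreal (Z n \<omega>)) \<noteq> \<infinity>"
    using meas by (intro nn_integral_PInf_AE) auto
  then show ?thesis using nonneg by (auto elim!: eventually_mono intro!: summable_suminf_not_top)
qed

text \<open>
  The exponent \<open>d\<close> bounds the growth of covering numbers; the centres of the covering balls are
  points of \<open>T\<close> itself.
\<close>

locale pseudometric_with_entropy =
  fixes T :: "'i set" and \<rho> :: "'i \<Rightarrow> 'i \<Rightarrow> real" and K d :: real
  assumes rho_nonneg: "s \<in> T \<Longrightarrow> t \<in> T \<Longrightarrow> 0 \<le> \<rho> s t"
    and rho_refl: "s \<in> T \<Longrightarrow> \<rho> s s = 0"
    and rho_sym: "s \<in> T \<Longrightarrow> t \<in> T \<Longrightarrow> \<rho> s t = \<rho> t s"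
    and rho_triangle: "s \<in> T \<Longrightarrow> t \<in> T \<Longrightarrow> u \<in> T \<Longrightarrow> \<rho> s u \<le> \<rho> s t + \<rho> t u"
    and d_pos: "0 < d"
    and covering: "0 < \<epsilon> \<Longrightarrow> \<epsilon> \<le> 1 \<Longrightarrow>
      \<exists>N\<subseteq>T. finite N \<and> card N \<le> K * \<epsilon> powr (- d) \<and> (\<forall>x\<in>T. \<exists>y\<in>N. \<rho> x y \<le> \<epsilon>)"
begin

text \<open>
  Covering numbers alone do not prevent a net from having quadratically many close pairs.  Here all
  of them are controlled through linearly many pairs, each close pair having a common partner \<open>c\<close>.
  Around a point \<open>z\<close> of \<open>S\<close> the balls with radii \<open>k * b\<close> cannot double their cardinality \<open>p + 1\<close> times in a
  row, so for some \<open>k \<le> p\<close> the ball \<open>B (k + 1)\<close> is at most twice as large as \<open>B k\<close>.  Join \<open>z\<close> to all of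
  \<open>B (k + 1)\<close>: every pair at distance at most \<open>b\<close> that meets \<open>B k\<close> lies in it.  Then remove \<open>B k\<close> and repeat.
  The price is the factor \<open>p + 1\<close> in the distances, which is logarithmic in the size of \<open>S\<close>.
\<close>

lemma sparse_pairs:
  fixes b :: real
  assumes "finite S" "S \<subseteq> T" "card S \<le> 2 ^ p" "0 \<le> b"
  shows "\<exists>U\<subseteq>S \<times> S. card U \<le> 2 * card S \<and> (\<forall>(s, t)\<in>U. \<rho> s t \<le> real (p + 1) * b) \<and>
    (\<forall>s\<in>S. \<forall>t\<in>S. \<rho> s t \<le> b \<longrightarrow> (\<exists>c. (c, s) \<in> U \<and> (c, t) \<in> U))"
  using assms(1-3)
proof (induction "card S" arbitrary: S rule: less_induct)
  case less
  show ?case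
  proof (cases "S = {}")
    case False
    then obtain z where z: "z \<in> S" "z \<in> T" using less.prems by blast
    define B where "B k = {s \<in> S. \<rho> z s \<le> real k * b}" for k :: nat
    have fB: "finite (B k)" for k using less.prems by (simp add: B_def)
    have B_sub: "B k \<subseteq> S" for k by (auto simp: B_def)
    have zB: "z \<in> B k" for k using z rho_refl[of z] assms(4) by (simp add: B_def)
    have B_mono: "B k \<subseteq> B (Suc k)" for k
    proof
      fix s assume "s \<in> B k"
      moreover have "real k * b \<le> real (Suc k) * b" using assms(4) by (intro mult_right_mono) auto
      ultimately show "s \<in> B (Suc k)" by (auto simp: B_def)
    qed
    have "\<exists>k\<le>p. card (B (Suc k)) \<le> 2 * card (B k)"
    proof (rule ccontr)
      assume neg: "\<not> ?thesis"
      have "2 ^ k \<le> card (B k)" if "k \<le> Suc p" for k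
        using that
      proof (induction k)
        case 0
        have "card (B 0) \<noteq> 0" using zB[of 0] fB[of 0] by auto
        then show ?case by simp
      next
        case (Suc k)
        then show ?case using neg by (auto simp: not_le dest!: spec[of _ k])
      qed
      from this[of "Suc p"] have "2 ^ Suc p \<le> card S"
        using card_mono[OF less.prems(1) B_sub, of "Suc p"] by simp
      moreover have "(0::nat) < 2 ^ p" by simp
      ultimately show False using less.prems(3) by (simp only: power_Suc)
    qed
    then obtain k where k: "k \<le> p" "card (B (Suc k)) \<le> 2 * card (B k)" by blast
    define S' where "S' = S - B k"
    have cS: "card S = card S' + card (B k)"
      unfolding S'_def using card_Diff_subset[OF fB B_sub, of k] card_mono[OF less.prems(1) B_sub, of k] by simp
    have "card S' < card S" using less.prems(1) z zB B_sub by (auto simp: S'_def intro!: psubset_card_mono)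
    moreover have "finite S'" "S' \<subseteq> T" "card S' \<le> 2 ^ p" using less.prems cS by (auto simp: S'_def)
    ultimately obtain U where U: "U \<subseteq> S' \<times> S'" "card U \<le> 2 * card S'" "\<forall>(s, t)\<in>U. \<rho> s t \<le> real (p + 1) * b"
      "\<forall>s\<in>S'. \<forall>t\<in>S'. \<rho> s t \<le> b \<longrightarrow> (\<exists>c. (c, s) \<in> U \<and> (c, t) \<in> U)"
      using less.hyps[of S'] by blast
    define U' where "U' = U \<union> {z} \<times> B (Suc k)"
    show ?thesis
    proof (intro exI[of _ U'] conjI ballI impI)
      show "U' \<subseteq> S \<times> S" using U(1) z B_sub by (auto simp: U'_def S'_def)
      have "card U' \<le> card U + card ({z} \<times> B (Suc k))" unfolding U'_def by (rule card_Un_le)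
      also have "\<dots> \<le> 2 * card S' + 2 * card (B k)"
        using U(2) k(2) by (simp add: card_cartesian_product_singleton)
      finally show "card U' \<le> 2 * card S" using cS by simp
      have "real (Suc k) * b \<le> real (p + 1) * b" using k assms(4) by (intro mult_right_mono) auto
      then show "case x of (s, t) \<Rightarrow> \<rho> s t \<le> real (p + 1) * b" if "x \<in> U'" for x
        using that U(3) by (auto simp: U'_def B_def)
      fix s t assume st: "s \<in> S" "t \<in> S" "\<rho> s t \<le> b"
      have grow: "y \<in> B (Suc k)" if "x \<in> B k" "y \<in> S" "\<rho> x y \<le> b" for x y
      proof -
        have "\<rho> z y \<le> \<rho> z x + \<rho> x y" using that z less.prems(2) by (intro rho_triangle) (auto simp: B_def)
        then show ?thesis using that by (auto simp: B_def algebra_simps)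
      qed
      show "\<exists>c. (c, s) \<in> U' \<and> (c, t) \<in> U'"
      proof (cases "s \<in> B k \<or> t \<in> B k")
        case True
        moreover have "\<rho> t s \<le> b" using st rho_sym[of s t] less.prems(2) by (metis subsetD)
        ultimately have "s \<in> B (Suc k)" "t \<in> B (Suc k)"
          using grow[of s t] grow[of t s] st B_mono[of k] by auto
        then show ?thesis by (auto simp: U'_def)
      next
        case False
        then have "s \<in> S'" "t \<in> S'" using st by (auto simp: S'_def)
        then show ?thesis using U(4) st(3) by (auto simp: U'_def)
      qed
    qed
  qed auto
qed

text \<open>
  Accumulate the nets of all coarser scales; their sizes form a geometric series.
\<close>

lemma nested_nets:
  obtains N :: "nat \<Rightarrow> 'i set" and K' :: real where
    "\<And>n. finite (N n)" "\<And>n. N n \<subseteq> T" "\<And>n. N n \<subseteq> N (Suc n)"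
    "\<And>n. card (N n) \<le> K' * 2 powr (real n * d)" "\<And>n x. x \<in> T \<Longrightarrow> \<exists>y\<in>N n. \<rho> x y \<le> (1 / 2) ^ n"
proof -
  have half: "(((1::real) / 2) ^ n) powr (- d) = 2 powr (real n * d)" for n
    by (simp add: powr_realpow[symmetric] powr_powr powr_divide powr_minus_divide)
  have "\<forall>n. \<exists>N. N \<subseteq> T \<and> finite N \<and> card N \<le> K * 2 powr (real n * d) \<and> (\<forall>x\<in>T. \<exists>y\<in>N. \<rho> x y \<le> (1 / 2) ^ n)"
    using covering[of "(1 / 2) ^ n" for n, unfolded half] by (simp add: power_le_one)
  from choice[OF this] obtain N0 where N0: "\<And>n. N0 n \<subseteq> T" "\<And>n. finite (N0 n)"
    "\<And>n. card (N0 n) \<le> K * 2 powr (real n * d)" "\<And>n x. x \<in> T \<Longrightarrow> \<exists>y\<in>N0 n. \<rho> x y \<le> (1 / 2) ^ n"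
    by blast
  define N where "N n = (\<Union>k\<le>n. N0 k)" for n
  define q where "q = 2 powr d"
  have q: "1 < q" using d_pos by (simp add: q_def)
  have qn: "2 powr (real n * d) = q ^ n" for n
    by (simp add: q_def powr_powr[symmetric] powr_realpow[symmetric] mult.commute)
  have K: "0 \<le> K"
    using N0(3)[of 0] by simp
  \<comment> \<open>chosen so that \<open>K' + K * q = K' * q\<close>\<close>
  define K' where "K' = K * q / (q - 1)"
  have "card (N n) \<le> K' * q ^ n" for n
  proof (induction n)
    case 0
    have "K \<le> K'" unfolding K'_def using q K by (simp add: field_simps)
    then show ?case using N0(3)[of 0] by (simp add: N_def)
  next
    case (Suc n)
    have "N (Suc n) = N n \<union> N0 (Suc n)" by (auto simp: N_def atMost_Suc)
    then have "real (card (N (Suc n))) \<le> real (card (N n)) + real (card (N0 (Suc n)))"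
      using card_Un_le[of "N n" "N0 (Suc n)"] by simp
    also have "\<dots> \<le> K' * q ^ n + K * q ^ Suc n"
      using Suc N0(3)[of "Suc n"] unfolding qn by simp
    also have "\<dots> = K' * q ^ Suc n"
      unfolding K'_def using q by (simp add: field_simps)
    finally show ?case .
  qed
  moreover have "N0 n \<subseteq> N n" "finite (N n)" "N n \<subseteq> T" "N n \<subseteq> N (Suc n)" for n
    using N0(1,2) by (auto simp: N_def intro: le_SucI)
  moreover from this have "\<exists>y\<in>N n. \<rho> x y \<le> (1 / 2) ^ n" if "x \<in> T" for n x using N0(4)[OF that, of n] by blast
  ultimately show ?thesis by (intro that[of N K', unfolded qn])
qed

text \<open>
  The pairs in \<open>P n\<close> are those along which increments have to be compared: from a point of the net
  \<open>n + 1\<close> to the net \<open>n\<close>, and between close points within the net \<open>n\<close>.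
\<close>

lemma chaining_pairs:
  obtains N :: "nat \<Rightarrow> 'i set" and P :: "nat \<Rightarrow> ('i \<times> 'i) set" and A K' :: real where
    "\<And>n. finite (N n)" "\<And>n. N n \<subseteq> T" "\<And>n. N n \<subseteq> N (Suc n)"
    "\<And>n x. x \<in> T \<Longrightarrow> \<exists>y\<in>N n. \<rho> x y \<le> (1 / 2) ^ n"
    "\<And>n. finite (P n)" "\<And>n. P n \<subseteq> T \<times> T" "\<And>n. card (P n) \<le> K' * 2 powr (real n * d)"
    "0 < A" "\<And>n s t. (s, t) \<in> P n \<Longrightarrow> \<rho> s t \<le> A * real (n + 1) * (1 / 2) ^ n"
    "\<And>n t. t \<in> N (Suc n) \<Longrightarrow> \<exists>u\<in>N n. \<rho> t u \<le> (1 / 2) ^ n \<and> (t, u) \<in> P n"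
    "\<And>n s t. s \<in> N n \<Longrightarrow> t \<in> N n \<Longrightarrow> \<rho> s t \<le> 5 * (1 / 2) ^ n \<Longrightarrow> \<exists>c. (c, s) \<in> P n \<and> (c, t) \<in> P n"
proof -
  obtain N :: "nat \<Rightarrow> 'i set" and K' where N: "\<And>n. finite (N n)" "\<And>n. N n \<subseteq> T" "\<And>n. N n \<subseteq> N (Suc n)"
    "\<And>n. card (N n) \<le> K' * 2 powr (real n * d)" "\<And>n x. x \<in> T \<Longrightarrow> \<exists>y\<in>N n. \<rho> x y \<le> (1 / 2) ^ n"
    by (rule nested_nets) blast
  \<comment> \<open>the net \<open>n\<close> has at most \<open>2 ^ (L * (n + 1))\<close> points, so sparse pairs cost a factor linear in \<open>n\<close>\<close>
  obtain L :: nat where L: "max K' (2 powr d) < 2 ^ L"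
    using real_arch_pow[of 2 "max K' (2 powr d)"] by auto
  have small: "card (N n) \<le> 2 ^ (L * (n + 1))" for n
  proof -
    have "real (card (N n)) \<le> K' * (2 powr d) ^ n"
      using N(4)[of n] by (simp add: powr_power)
    also have "\<dots> \<le> 2 ^ L * (2 ^ L) ^ n"
      using L by (intro mult_mono power_mono) auto
    also have "\<dots> = 2 ^ (L * (n + 1))" by (simp add: power_mult power_add)
    finally have "real (card (N n)) \<le> real (2 ^ (L * (n + 1)))" by simp
    then show ?thesis by (simp only: of_nat_le_iff)
  qed
  let ?Q = "\<lambda>n U. U \<subseteq> N n \<times> N n \<and> card U \<le> 2 * card (N n) \<and>
    (\<forall>(s, t)\<in>U. \<rho> s t \<le> real (L * (n + 1) + 1) * (5 * (1 / 2) ^ n)) \<and>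
    (\<forall>s\<in>N n. \<forall>t\<in>N n. \<rho> s t \<le> 5 * (1 / 2) ^ n \<longrightarrow> (\<exists>c. (c, s) \<in> U \<and> (c, t) \<in> U))"
  have "\<exists>U. ?Q n U" for n
    by (rule sparse_pairs[OF N(1) N(2) small]) simp
  then have "\<forall>n. \<exists>U. ?Q n U" by (rule allI)
  from choice[OF this] obtain U where Q: "\<forall>n. ?Q n (U n)" ..
  have U: "U n \<subseteq> N n \<times> N n" "card (U n) \<le> 2 * card (N n)" for n using Q by simp_all
  have U_le: "\<rho> s t \<le> real (L * (n + 1) + 1) * (5 * (1 / 2) ^ n)" if "(s, t) \<in> U n" for n s t
    using Q that by blast
  have U_near: "\<exists>c. (c, s) \<in> U n \<and> (c, t) \<in> U n"
    if "s \<in> N n" "t \<in> N n" "\<rho> s t \<le> 5 * (1 / 2) ^ n" for n s t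
    using Q that by simp
  have "\<forall>n. \<exists>\<pi>. \<forall>t\<in>T. \<pi> t \<in> N n \<and> \<rho> t (\<pi> t) \<le> (1 / 2) ^ n"
  proof
    fix n
    have "\<forall>t\<in>T. \<exists>u. u \<in> N n \<and> \<rho> t u \<le> (1 / 2) ^ n" using N(5) by blast
    then show "\<exists>\<pi>. \<forall>t\<in>T. \<pi> t \<in> N n \<and> \<rho> t (\<pi> t) \<le> (1 / 2) ^ n" by (rule bchoice)
  qed
  from choice[OF this] obtain \<pi> where \<pi>: "\<forall>n. \<forall>t\<in>T. \<pi> n t \<in> N n \<and> \<rho> t (\<pi> n t) \<le> (1 / 2) ^ n" ..
  define P where "P n = U n \<union> (\<lambda>t. (t, \<pi> n t)) ` N (Suc n)" for n
  define A :: real where "A = 5 * (L + 1)"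
  show ?thesis
  proof (rule that[of N P "K' * (2 + 2 powr d)" A])
    fix n
    show "finite (P n)" using N(1) finite_subset[OF U(1)] by (auto simp: P_def)
    show "P n \<subseteq> T \<times> T" using U(1)[of n] N(2)[of n] N(2)[of "Suc n"] \<pi>
      unfolding P_def by blast
    have "card (P n) \<le> card (U n) + card (N (Suc n))"
      unfolding P_def using card_Un_le[of "U n"] card_image_le[OF N(1)[of "Suc n"]] by (meson add_left_mono order_trans)
    then have "real (card (P n)) \<le> 2 * real (card (N n)) + real (card (N (Suc n)))" using U(2)[of n] by linarith
    also have "\<dots> \<le> 2 * (K' * 2 powr (real n * d)) + K' * 2 powr (real (Suc n) * d)" using N(4)[of n] N(4)[of "Suc n"] by linarith
    also have "\<dots> = K' * (2 + 2 powr d) * 2 powr (real n * d)" by (simp add: powr_add algebra_simps)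
    finally show "card (P n) \<le> K' * (2 + 2 powr d) * 2 powr (real n * d)" .
    fix s t
    assume "(s, t) \<in> P n"
    then consider "(s, t) \<in> U n" | "s \<in> N (Suc n)" "t = \<pi> n s" by (auto simp: P_def)
    then show "\<rho> s t \<le> A * real (n + 1) * (1 / 2) ^ n"
    proof cases
      case 1
      have "real (L * (n + 1) + 1) * (5 * (1 / 2) ^ n) \<le> real ((L + 1) * (n + 1)) * (5 * (1 / 2) ^ n)"
        by (intro mult_right_mono) (auto simp: algebra_simps)
      also have "\<dots> = A * real (n + 1) * (1 / 2) ^ n" unfolding A_def by (simp only: of_nat_mult of_nat_add mult_ac)
      finally show ?thesis using U_le[OF 1] by linarith
    next
      case 2
      then have "\<rho> s t \<le> 1 * (1 / 2) ^ n" using \<pi> N(2)[of "Suc n"] by auto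
      also have "\<dots> \<le> A * real (n + 1) * (1 / 2) ^ n"
        by (intro mult_right_mono) (auto simp: A_def algebra_simps)
      finally show ?thesis .
    qed
  next
    fix n t assume "t \<in> N (Suc n)"
    then show "\<exists>u\<in>N n. \<rho> t u \<le> (1 / 2) ^ n \<and> (t, u) \<in> P n"
      using \<pi> N(2)[of "Suc n"] by (intro bexI[of _ "\<pi> n t"]) (auto simp: P_def)
  next
    fix n s t assume "s \<in> N n" "t \<in> N n" "\<rho> s t \<le> 5 * (1 / 2) ^ n"
    then obtain c where "(c, s) \<in> U n" "(c, t) \<in> U n" using U_near by blast
    then show "\<exists>c. (c, s) \<in> P n \<and> (c, t) \<in> P n" unfolding P_def by blast
  next
    show "0 < A" by (simp add: A_def)
    show "finite (N n)" "N n \<subseteq> T" "N n \<subseteq> N (Suc n)" for n by (rule N)+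
    show "\<exists>y\<in>N n. \<rho> x y \<le> (1 / 2) ^ n" if "x \<in> T" for n x using that by (rule N)
  qed
qed

text \<open>
  Descend from \<open>s\<close> and \<open>t\<close> through the nets to the level \<open>n\<close> of their distance.  The increments on the way
  form geometric series, and the end points are close enough for the second hypothesis.
\<close>

lemma holder_of_chaining:
  fixes f :: "'i \<Rightarrow> 'e::metric_space"
  assumes N: "\<And>n. finite (N n)" "\<And>n. N n \<subseteq> T" "\<And>n. N n \<subseteq> N (Suc n)"
    and link: "\<And>n t. t \<in> N (Suc n) \<Longrightarrow> \<exists>u\<in>N n. \<rho> t u \<le> (1 / 2) ^ n \<and> dist (f t) (f u) \<le> c * 2 powr (- \<eta> * n)"
    and near: "\<And>n s t. s \<in> N n \<Longrightarrow> t \<in> N n \<Longrightarrow> \<rho> s t \<le> 5 * (1 / 2) ^ n \<Longrightarrow> dist (f s) (f t) \<le> 2 * (c * 2 powr (- \<eta> * n))"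
    and \<eta>: "0 < \<eta>" and c: "0 \<le> c"
  shows "\<exists>C. \<forall>s\<in>\<Union>(range N). \<forall>t\<in>\<Union>(range N). dist (f s) (f t) \<le> C * \<rho> s t powr \<eta>"
proof -
  define q where "q = 2 powr (- \<eta>)"
  have q: "0 < q" "q < 1" using \<eta> by (auto simp: q_def powr_less_one)
  have qn: "2 powr (- \<eta> * real n) = q ^ n" for n
    using powr_realpow[OF q(1), of n] by (simp add: q_def powr_powr)
  define A where "A = c / (1 - q)"
  have A: "0 \<le> A" "c = A * (1 - q)" using q c by (auto simp: A_def)
  \<comment> \<open>the subtracted terms are the remainders of the two geometric series\<close>
  have chain: "\<exists>u\<in>N n. \<rho> s u \<le> 2 * (1 / 2) ^ n - 2 * (1 / 2) ^ (n + k) \<and> dist (f s) (f u) \<le> A * (q ^ n - q ^ (n + k))"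
    if "s \<in> N (n + k)" for n k s
    using that
  proof (induction k arbitrary: s)
    case 0
    then have "s \<in> N n" "\<rho> s s = 0" using rho_refl[of s] N(2)[of n] by auto
    then show ?case by (intro bexI[of _ s]) auto
  next
    case (Suc k)
    then obtain v where v: "v \<in> N (n + k)" "\<rho> s v \<le> (1 / 2) ^ (n + k)" "dist (f s) (f v) \<le> c * q ^ (n + k)"
      using link[of s "n + k"] qn[of "n + k"] by auto
    obtain u where u: "u \<in> N n" "\<rho> v u \<le> 2 * (1 / 2) ^ n - 2 * (1 / 2) ^ (n + k)" "dist (f v) (f u) \<le> A * (q ^ n - q ^ (n + k))"
      using Suc.IH[OF v(1)] by blast
    have "s \<in> T" "v \<in> T" "u \<in> T" using Suc.prems v u N(2) by blast+
    then have "\<rho> s u \<le> \<rho> s v + \<rho> v u" by (rule rho_triangle)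
    then have "\<rho> s u \<le> 2 * (1 / 2) ^ n - 2 * (1 / 2) ^ (n + Suc k)" using v(2) u(2) by simp
    moreover have "dist (f s) (f u) \<le> dist (f s) (f v) + dist (f v) (f u)" by (rule dist_triangle)
    then have "dist (f s) (f u) \<le> A * (q ^ n - q ^ (n + Suc k))"
      using v(3) u(3) A(2) by (simp add: algebra_simps)
    ultimately show ?case using u(1) by blast
  qed
  have mono: "N n \<subseteq> N m" if "n \<le> m" for n m using lift_Suc_mono_le[of N, OF N(3) that] .
  have project: "\<exists>u\<in>N n. \<rho> s u \<le> 2 * (1 / 2) ^ n \<and> dist (f s) (f u) \<le> A * q ^ n"
    if s: "s \<in> \<Union>(range N)" for s n
  proof -
    obtain m where "s \<in> N m" using s by blast
    then have "s \<in> N (n + m)" using mono[of m "n + m"] by auto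
    from chain[OF this] obtain u where u: "u \<in> N n" "\<rho> s u \<le> 2 * (1 / 2) ^ n - 2 * (1 / 2) ^ (n + m)"
      "dist (f s) (f u) \<le> A * (q ^ n - q ^ (n + m))" by blast
    have "A * (q ^ n - q ^ (n + m)) \<le> A * q ^ n" using A q by (intro mult_left_mono) auto
    moreover have "0 \<le> (1 / 2 :: real) ^ (n + m)" by simp
    ultimately have "\<rho> s u \<le> 2 * (1 / 2) ^ n" "dist (f s) (f u) \<le> A * q ^ n" using u by linarith+
    with u(1) show ?thesis by blast
  qed
  define B where "B = 2 * A + 2 * c"
  have B: "0 \<le> B" using A c by (simp add: B_def)
  have close: "dist (f s) (f t) \<le> B * q ^ n"
    if st: "s \<in> \<Union>(range N)" "t \<in> \<Union>(range N)" "\<rho> s t \<le> (1 / 2) ^ n" for s t n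
  proof -
    obtain u where u: "u \<in> N n" "\<rho> s u \<le> 2 * (1 / 2) ^ n" "dist (f s) (f u) \<le> A * q ^ n" using project st(1) by blast
    obtain v where v: "v \<in> N n" "\<rho> t v \<le> 2 * (1 / 2) ^ n" "dist (f t) (f v) \<le> A * q ^ n" using project st(2) by blast
    have inT: "s \<in> T" "t \<in> T" "u \<in> T" "v \<in> T" using st u v N(2) by blast+
    have "\<rho> u v \<le> \<rho> u s + \<rho> s v" "\<rho> s v \<le> \<rho> s t + \<rho> t v" using inT by (auto intro: rho_triangle)
    \<comment> \<open>two descents of length at most \<open>2 * (1 / 2) ^ n\<close> each, and the distance of \<open>s\<close> and \<open>t\<close>\<close>
    then have "\<rho> u v \<le> 5 * (1 / 2) ^ n" using u(2) v(2) st(3) rho_sym[of u s] inT by simp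
    then have "dist (f u) (f v) \<le> 2 * (c * q ^ n)" using near[OF u(1) v(1)] qn[of n] by simp
    moreover have "dist (f s) (f t) \<le> dist (f s) (f u) + dist (f u) (f v) + dist (f t) (f v)"
      using dist_triangle[of "f s" "f t" "f u"] dist_triangle[of "f u" "f t" "f v"] by (simp add: dist_commute)
    ultimately show ?thesis using u(3) v(3) by (simp add: B_def algebra_simps)
  qed
  \<comment> \<open>distances above 1: compare through the coarsest net, which is finite\<close>
  define G where "G = 2 * A + (\<Sum>(u, v)\<in>N 0 \<times> N 0. dist (f u) (f v))"
  have far: "dist (f s) (f t) \<le> G" if st: "s \<in> \<Union>(range N)" "t \<in> \<Union>(range N)" for s t
  proof -
    obtain u where u: "u \<in> N 0" "dist (f s) (f u) \<le> A" using project[OF st(1), of 0] by auto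
    obtain v where v: "v \<in> N 0" "dist (f t) (f v) \<le> A" using project[OF st(2), of 0] by auto
    have "dist (f u) (f v) \<le> (\<Sum>(u, v)\<in>N 0 \<times> N 0. dist (f u) (f v))"
      using member_le_sum[of "(u, v)" "N 0 \<times> N 0" "\<lambda>(u, v). dist (f u) (f v)"] u v N(1)[of 0] by auto
    moreover have "dist (f s) (f t) \<le> dist (f s) (f u) + dist (f u) (f v) + dist (f t) (f v)"
      using dist_triangle[of "f s" "f t" "f u"] dist_triangle[of "f u" "f t" "f v"] by (simp add: dist_commute)
    ultimately show ?thesis using u v by (simp add: G_def)
  qed
  have G: "0 \<le> G" unfolding G_def using A by (intro add_nonneg_nonneg sum_nonneg) auto
  show ?thesis
  proof (intro exI[of _ "B * 2 powr \<eta> + G"] ballI)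
    fix s t assume st: "s \<in> \<Union>(range N)" "t \<in> \<Union>(range N)"
    have inT: "s \<in> T" "t \<in> T" using st N(2) by blast+
    consider "\<rho> s t = 0" | "0 < \<rho> s t" "\<rho> s t \<le> 1" | "1 < \<rho> s t" using rho_nonneg[OF inT] by linarith
    then show "dist (f s) (f t) \<le> (B * 2 powr \<eta> + G) * \<rho> s t powr \<eta>"
    proof cases
      case 1
      have "(\<lambda>n. B * q ^ n) \<longlonglongrightarrow> B * 0" using q by (intro tendsto_intros LIMSEQ_power_zero) auto
      moreover have "dist (f s) (f t) \<le> B * q ^ n" for n using close[OF st] 1 by simp
      ultimately have "dist (f s) (f t) \<le> 0" by (intro LIMSEQ_le_const[of _ "0::real"]) auto
      then show ?thesis using 1 by simp
    next
      case 2
      obtain k where "(1 / 2) ^ k < \<rho> s t" using real_arch_pow_inv[OF 2(1), of "1 / 2"] by auto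
      \<comment> \<open>\<open>n = m - 1\<close> is the level of the distance of \<open>s\<close> and \<open>t\<close>\<close>
      define m where "m = (LEAST m. (1 / 2) ^ m < \<rho> s t)"
      have m: "(1 / 2) ^ m < \<rho> s t" unfolding m_def by (rule LeastI) fact
      have "m \<noteq> 0" using m 2 by (intro notI) simp
      then obtain n where n: "m = Suc n" by (cases m) auto
      have le: "\<rho> s t \<le> (1 / 2) ^ n" using not_less_Least[of n "\<lambda>m. (1 / 2) ^ m < \<rho> s t"] n by (simp add: m_def)
      have "q ^ n = ((1 / 2) ^ n) powr \<eta>"
        using qn[of n] by (simp add: powr_realpow[symmetric] powr_powr powr_divide powr_minus_divide mult.commute)
      also have "\<dots> \<le> (2 * \<rho> s t) powr \<eta>" using m n \<eta> by (intro powr_mono2) auto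
      also have "\<dots> = 2 powr \<eta> * \<rho> s t powr \<eta>" using 2 by (simp add: powr_mult)
      finally have "B * q ^ n \<le> B * (2 powr \<eta> * \<rho> s t powr \<eta>)" using B by (rule mult_left_mono)
      also have "\<dots> \<le> (B * 2 powr \<eta> + G) * \<rho> s t powr \<eta>" using G by (simp add: algebra_simps)
      finally show ?thesis using close[OF st le] by simp
    next
      case 3
      have "G * 1 \<le> (B * 2 powr \<eta> + G) * \<rho> s t powr \<eta>"
        using G B 3 \<eta> by (intro mult_mono ge_one_powr_ge_zero) auto
      then show ?thesis using far[OF st] by simp
    qed
  qed
qed

lemma holder_limit:
  fixes f :: "'i \<Rightarrow> 'e::metric_space"
  assumes holder: "\<And>s t. s \<in> D \<Longrightarrow> t \<in> D \<Longrightarrow> dist (f s) (f t) \<le> c * \<rho> s t powr \<eta>" and D: "D \<subseteq> T"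
    and s: "s \<in> T" "\<And>n. a n \<in> D" "\<And>n. \<rho> s (a n) \<le> (1 / 2) ^ n" "(\<lambda>n. f (a n)) \<longlonglongrightarrow> x"
    and t: "t \<in> T" "\<And>n. b n \<in> D" "\<And>n. \<rho> t (b n) \<le> (1 / 2) ^ n" "(\<lambda>n. f (b n)) \<longlonglongrightarrow> y"
    and \<eta>: "0 < \<eta>"
  shows "dist x y \<le> \<bar>c\<bar> * \<rho> s t powr \<eta>"
proof (rule LIMSEQ_le)
  show "(\<lambda>n. dist (f (a n)) (f (b n))) \<longlonglongrightarrow> dist x y" using s t by (intro tendsto_intros)
  have "(\<lambda>n. \<rho> s t + 2 * (1 / 2) ^ n) \<longlonglongrightarrow> \<rho> s t + 2 * 0"
    by (intro tendsto_intros LIMSEQ_power_zero) auto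
  then have "(\<lambda>n. (\<rho> s t + 2 * (1 / 2) ^ n) powr \<eta>) \<longlonglongrightarrow> \<rho> s t powr \<eta>"
    using rho_nonneg[OF s(1) t(1)] \<eta> by (intro tendsto_powr2) auto
  then show "(\<lambda>n. \<bar>c\<bar> * (\<rho> s t + 2 * (1 / 2) ^ n) powr \<eta>) \<longlonglongrightarrow> \<bar>c\<bar> * \<rho> s t powr \<eta>"
    by (intro tendsto_mult tendsto_const)
  have "dist (f (a n)) (f (b n)) \<le> \<bar>c\<bar> * (\<rho> s t + 2 * (1 / 2) ^ n) powr \<eta>" for n
  proof -
    have inT: "a n \<in> T" "b n \<in> T" using s t D by auto
    have "\<rho> (a n) (b n) \<le> \<rho> (a n) s + \<rho> s (b n)" "\<rho> s (b n) \<le> \<rho> s t + \<rho> t (b n)"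
      using inT s(1) t(1) by (auto intro: rho_triangle)
    then have "\<rho> (a n) (b n) \<le> \<rho> s t + 2 * (1 / 2) ^ n" using s(3)[of n] t(3)[of n] rho_sym[OF inT(1) s(1)] by simp
    then have "\<rho> (a n) (b n) powr \<eta> \<le> (\<rho> s t + 2 * (1 / 2) ^ n) powr \<eta>"
      using rho_nonneg[OF inT] \<eta> by (intro powr_mono2) auto
    then have "\<bar>c\<bar> * \<rho> (a n) (b n) powr \<eta> \<le> \<bar>c\<bar> * (\<rho> s t + 2 * (1 / 2) ^ n) powr \<eta>" by (intro mult_left_mono) auto
    moreover have "c * \<rho> (a n) (b n) powr \<eta> \<le> \<bar>c\<bar> * \<rho> (a n) (b n) powr \<eta>" by (intro mult_right_mono) auto
    ultimately show ?thesis using holder[OF s(2) t(2), of n n] by linarith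
  qed
  then show "\<exists>N. \<forall>n\<ge>N. dist (f (a n)) (f (b n)) \<le> \<bar>c\<bar> * (\<rho> s t + 2 * (1 / 2) ^ n) powr \<eta>" by blast
qed

end

section \<open>Processes with moment bounds\<close>

lemma linear_le_powr:
  assumes "0 < (\<delta>::real)"
  obtains B where "1 \<le> B" "\<And>n. real (n + 1) \<le> B * 2 powr (\<delta> * real n)"
proof -
  have "real (n + 1) \<le> (1 + 1 / (\<delta> * ln 2)) * 2 powr (\<delta> * real n)" for n
  proof -
    have pos: "0 < \<delta> * ln 2" using assms by simp
    have "1 + \<delta> * real n * ln 2 \<le> 2 powr (\<delta> * real n)"
      using exp_ge_add_one_self[of "\<delta> * real n * ln 2"] by (simp add: powr_def)
    then have "(1 + 1 / (\<delta> * ln 2)) * (1 + \<delta> * real n * ln 2) \<le> (1 + 1 / (\<delta> * ln 2)) * 2 powr (\<delta> * real n)"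
      using pos by (intro mult_left_mono) auto
    moreover have "real (n + 1) \<le> (1 + 1 / (\<delta> * ln 2)) * (1 + \<delta> * real n * ln 2)"
      using assms pos by (simp add: field_simps)
    ultimately show ?thesis by linarith
  qed
  then show ?thesis using assms by (intro that[of "1 + 1 / (\<delta> * ln 2)"]) auto
qed

locale process_with_moments = pseudometric_with_entropy T \<rho> K d
  for T :: "'i set" and \<rho> :: "'i \<Rightarrow> 'i \<Rightarrow> real" and K d :: real +
  fixes \<Omega> :: "'w measure" and X :: "'i \<Rightarrow> 'w \<Rightarrow> 'e::polish_space" and C \<beta> \<theta> :: real
  assumes X_measurable: "t \<in> T \<Longrightarrow> X t \<in> borel_measurable \<Omega>"
    and C_nonneg: "0 \<le> C" and \<beta>_pos: "0 < \<beta>" and d_less_\<theta>: "d < \<theta>"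
    and moments: "s \<in> T \<Longrightarrow> t \<in> T \<Longrightarrow>
      (\<integral>\<^sup>+\<omega>. ennreal (dist (X s \<omega>) (X t \<omega>) powr \<beta>) \<partial>\<Omega>) \<le> ennreal (C * \<rho> s t powr \<theta>)"
begin

lemma dist_powr_measurable:
  "s \<in> T \<Longrightarrow> t \<in> T \<Longrightarrow> (\<lambda>\<omega>. dist (X s \<omega>) (X t \<omega>) powr \<beta>) \<in> borel_measurable \<Omega>"
  using X_measurable by measurable

text \<open>
  The expected sum over \<open>P n\<close> of the \<open>\<beta>\<close>-th powers of the increments, multiplied by \<open>2 powr (\<eta> * \<beta> * n)\<close>, is
  up to a constant at most \<open>(n + 1) powr \<theta> * 2 powr (- gap * n)\<close>, where \<open>gap = \<theta> - d - \<eta> * \<beta>\<close> is positive.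
  This is summable, so almost surely the sums are bounded.
\<close>

lemma pairs_uniformly_close:
  assumes P: "\<And>n. finite (P n)" "\<And>n. P n \<subseteq> T \<times> T" "\<And>n. card (P n) \<le> K' * 2 powr (real n * d)"
    and A: "0 < A" "\<And>n s t. (s, t) \<in> P n \<Longrightarrow> \<rho> s t \<le> A * real (n + 1) * (1 / 2) ^ n"
    and \<eta>: "0 < \<eta>" "\<eta> < (\<theta> - d) / \<beta>"
  shows "AE \<omega> in \<Omega>. \<exists>c\<ge>0. \<forall>n. \<forall>(s, t)\<in>P n. dist (X s \<omega>) (X t \<omega>) \<le> c * 2 powr (- \<eta> * real n)"
proof -
  define gap where "gap = \<theta> - d - \<eta> * \<beta>"
  have gap: "0 < gap" using \<eta>(2) \<beta>_pos by (simp add: gap_def field_simps)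
  have \<theta>_pos: "0 < \<theta>" using d_pos d_less_\<theta> by simp
  \<comment> \<open>with \<open>n + 1 \<le> B * 2 powr (\<delta> * n)\<close> half of the gap is spent on the factor \<open>n + 1\<close> in the distances\<close>
  define \<delta> where "\<delta> = gap / (2 * \<theta>)"
  have "0 < \<delta>" using gap \<theta>_pos by (simp add: \<delta>_def)
  then obtain B where B: "1 \<le> B" "\<And>n. real (n + 1) \<le> B * 2 powr (\<delta> * real n)"
    by (rule linear_le_powr) blast
  define Z where "Z n \<omega> = (\<Sum>(s, t)\<in>P n. 2 powr (\<eta> * \<beta> * real n) * dist (X s \<omega>) (X t \<omega>) powr \<beta>)" for n \<omega>
  define b where "b n = \<bar>K'\<bar> * C * (A * B) powr \<theta> * 2 powr (- (gap / 2) * real n)" for n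
  have close: "\<rho> s t powr \<theta> \<le> (A * B) powr \<theta> * 2 powr ((\<delta> - 1) * \<theta> * real n)" if "(s, t) \<in> P n" for n s t
  proof -
    have inT: "s \<in> T" "t \<in> T" using that P(2) by blast+
    have half: "(1 / 2 :: real) ^ n = 2 powr (- real n)"
      by (simp add: powr_minus powr_realpow power_one_over field_simps)
    have "\<rho> s t \<le> A * real (n + 1) * (1 / 2) ^ n" by (rule A(2)[OF that])
    also have "\<dots> \<le> A * (B * 2 powr (\<delta> * real n)) * 2 powr (- real n)"
      unfolding half using A(1) B(2)[of n] by (intro mult_right_mono mult_left_mono) auto
    also have "\<dots> = A * B * 2 powr ((\<delta> - 1) * real n)" by (simp add: powr_add[symmetric] algebra_simps)
    finally have "\<rho> s t powr \<theta> \<le> (A * B * 2 powr ((\<delta> - 1) * real n)) powr \<theta>"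
      using rho_nonneg[OF inT] \<theta>_pos by (intro powr_mono2) auto
    also have "\<dots> = (A * B) powr \<theta> * 2 powr ((\<delta> - 1) * \<theta> * real n)"
      using A(1) B(1) by (simp add: powr_mult powr_powr mult_ac)
    finally show ?thesis .
  qed
  have moment: "(\<integral>\<^sup>+\<omega>. ennreal (Z n \<omega>) \<partial>\<Omega>) \<le> ennreal (b n)" for n
  proof -
    let ?a = "2 powr (\<eta> * \<beta> * real n)"
    let ?m = "?a * (C * ((A * B) powr \<theta> * 2 powr ((\<delta> - 1) * \<theta> * real n)))"
    have "(\<integral>\<^sup>+\<omega>. ennreal (Z n \<omega>) \<partial>\<Omega>)
      = (\<integral>\<^sup>+\<omega>. (\<Sum>p\<in>P n. ennreal ?a * ennreal (dist (X (fst p) \<omega>) (X (snd p) \<omega>) powr \<beta>)) \<partial>\<Omega>)"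
      by (intro nn_integral_cong) (simp add: Z_def sum_ennreal[symmetric] ennreal_mult case_prod_unfold)
    also have "\<dots> = (\<Sum>p\<in>P n. ennreal ?a * (\<integral>\<^sup>+\<omega>. ennreal (dist (X (fst p) \<omega>) (X (snd p) \<omega>) powr \<beta>) \<partial>\<Omega>))"
    proof -
      have "(\<lambda>\<omega>. ennreal (dist (X (fst p) \<omega>) (X (snd p) \<omega>) powr \<beta>)) \<in> borel_measurable \<Omega>" if "p \<in> P n" for p
        using that P(2)[of n] dist_powr_measurable[of "fst p" "snd p"] by auto
      then show ?thesis by (simp add: nn_integral_sum nn_integral_cmult)
    qed
    also have "\<dots> \<le> (\<Sum>p\<in>P n. ennreal ?m)"
    proof (rule sum_mono)
      fix p assume p: "p \<in> P n"
      have inT: "fst p \<in> T" "snd p \<in> T" using p P(2)[of n] by auto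
      have "(\<integral>\<^sup>+\<omega>. ennreal (dist (X (fst p) \<omega>) (X (snd p) \<omega>) powr \<beta>) \<partial>\<Omega>) \<le> ennreal (C * \<rho> (fst p) (snd p) powr \<theta>)"
        by (rule moments[OF inT])
      also have "\<dots> \<le> ennreal (C * ((A * B) powr \<theta> * 2 powr ((\<delta> - 1) * \<theta> * real n)))"
        using close[of "fst p" "snd p" n] p C_nonneg by (intro ennreal_leI mult_left_mono) auto
      finally show "ennreal ?a * (\<integral>\<^sup>+\<omega>. ennreal (dist (X (fst p) \<omega>) (X (snd p) \<omega>) powr \<beta>) \<partial>\<Omega>) \<le> ennreal ?m"
        using C_nonneg by (subst ennreal_mult) (auto intro!: mult_left_mono mult_nonneg_nonneg)
    qed
    also have "\<dots> = ennreal (real (card (P n)) * ?m)"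
      using C_nonneg by (simp add: ennreal_mult ennreal_of_nat_eq_real_of_nat)
    also have "\<dots> \<le> ennreal (b n)"
    proof (rule ennreal_leI)
      have "real (card (P n)) * ?m \<le> \<bar>K'\<bar> * 2 powr (real n * d) * ?m"
        using P(3)[of n] C_nonneg
        by (intro mult_right_mono order_trans[OF P(3)] mult_nonneg_nonneg) auto
      also have "\<dots> = \<bar>K'\<bar> * C * (A * B) powr \<theta> * (2 powr (real n * d) * ?a * 2 powr ((\<delta> - 1) * \<theta> * real n))"
        by (simp add: mult_ac)
      also have "2 powr (real n * d) * ?a * 2 powr ((\<delta> - 1) * \<theta> * real n)
        = 2 powr (real n * d + \<eta> * \<beta> * real n + (\<delta> - 1) * \<theta> * real n)"
        by (simp add: powr_add)
      also have "real n * d + \<eta> * \<beta> * real n + (\<delta> - 1) * \<theta> * real n = - (gap / 2) * real n"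
      proof -
        have "\<delta> * \<theta> = gap / 2" using \<theta>_pos by (simp add: \<delta>_def)
        then have "(\<delta> - 1) * \<theta> = gap / 2 - \<theta>" by (simp add: algebra_simps)
        then have "(\<delta> - 1) * \<theta> * real n = (gap / 2 - \<theta>) * real n" by simp
        then show ?thesis by (simp add: gap_def field_simps)
      qed
      finally show "real (card (P n)) * ?m \<le> b n" by (simp add: b_def)
    qed
    finally show ?thesis .
  qed
  have "AE \<omega> in \<Omega>. summable (\<lambda>n. Z n \<omega>)"
  proof (rule AE_summable_of_moments[OF _ _ moment])
    show "Z n \<in> borel_measurable \<Omega>" for n
    proof -
      have "(\<lambda>\<omega>. dist (X (fst p) \<omega>) (X (snd p) \<omega>) powr \<beta>) \<in> borel_measurable \<Omega>" if "p \<in> P n" for p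
        using that P(2)[of n] dist_powr_measurable[of "fst p" "snd p"] by auto
      then show ?thesis unfolding Z_def case_prod_unfold by (intro borel_measurable_sum borel_measurable_times) auto
    qed
    show "0 \<le> Z n \<omega>" for n \<omega> unfolding Z_def by (intro sum_nonneg) auto
    show "0 \<le> b n" for n unfolding b_def using C_nonneg by (intro mult_nonneg_nonneg) auto
    have "(2::real) powr (- (gap / 2) * real n) = (2 powr (- (gap / 2))) ^ n" for n
      by (simp add: powr_power mult.commute)
    moreover have "(2::real) powr (- (gap / 2)) < 1" using gap by (simp add: powr_less_one)
    ultimately show "summable b"
      unfolding b_def by (intro summable_mult) (simp add: summable_geometric)
  qed
  then show ?thesis
  proof eventually_elim
    fix \<omega> assume "summable (\<lambda>n. Z n \<omega>)"
    then obtain S where S: "\<And>n. Z n \<omega> \<le> S"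
      using summable_imp_bounded[of "\<lambda>n. Z n \<omega>"] unfolding bounded_iff by (fastforce simp: abs_le_iff)
    have Z_nonneg: "0 \<le> Z n \<omega>" for n unfolding Z_def by (intro sum_nonneg) auto
    show "\<exists>c\<ge>0. \<forall>n. \<forall>(s, t)\<in>P n. dist (X s \<omega>) (X t \<omega>) \<le> c * 2 powr (- \<eta> * real n)"
    proof (intro exI[of _ "S powr (1 / \<beta>)"] conjI allI ballI)
      fix n p assume p: "p \<in> P n"
      obtain s t where st: "p = (s, t)" by (cases p)
      let ?D = "dist (X s \<omega>) (X t \<omega>)"
      have "2 powr (\<eta> * \<beta> * real n) * ?D powr \<beta> \<le> Z n \<omega>"
        unfolding Z_def
        using member_le_sum[of p "P n" "\<lambda>(s, t). 2 powr (\<eta> * \<beta> * real n) * dist (X s \<omega>) (X t \<omega>) powr \<beta>"] p P(1) st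
        by auto
      also have "\<dots> \<le> S" by (rule S)
      finally have "(2 powr (\<eta> * real n) * ?D) powr \<beta> \<le> S" by (simp add: powr_mult powr_powr mult_ac)
      then have "((2 powr (\<eta> * real n) * ?D) powr \<beta>) powr (1 / \<beta>) \<le> S powr (1 / \<beta>)"
        using \<beta>_pos by (intro powr_mono2) auto
      then have "2 powr (\<eta> * real n) * ?D \<le> S powr (1 / \<beta>)" using \<beta>_pos by (simp add: powr_powr)
      then have "?D \<le> S powr (1 / \<beta>) * 2 powr (- \<eta> * real n)"
        by (simp add: powr_minus field_simps)
      then show "case p of (s, t) \<Rightarrow> dist (X s \<omega>) (X t \<omega>) \<le> S powr (1 / \<beta>) * 2 powr (- \<eta> * real n)"
        by (simp add: st)
    qed simp
  qed
qed

text \<open>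
  Countably many exponents tending to the critical one suffice, as the estimate for a larger exponent
  implies the one for a smaller exponent.
\<close>

lemma holder_on_dense_set:
  "\<exists>D a. D \<subseteq> T \<and> (\<forall>t\<in>T. \<forall>n. a t n \<in> D \<and> \<rho> t (a t n) \<le> (1 / 2) ^ n) \<and>
    (AE \<omega> in \<Omega>. \<forall>\<eta>. 0 < \<eta> \<and> \<eta> < (\<theta> - d) / \<beta> \<longrightarrow>
      (\<exists>c. \<forall>s\<in>D. \<forall>t\<in>D. dist (X s \<omega>) (X t \<omega>) \<le> c * \<rho> s t powr \<eta>))"
proof -
  obtain N P A K' where N: "\<And>n. finite (N n)" "\<And>n. N n \<subseteq> T" "\<And>n. N n \<subseteq> N (Suc n)"
    "\<And>n x. x \<in> T \<Longrightarrow> \<exists>y\<in>N n. \<rho> x y \<le> (1 / 2) ^ n"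
    and P: "\<And>n. finite (P n)" "\<And>n. P n \<subseteq> T \<times> T" "\<And>n. card (P n) \<le> K' * 2 powr (real n * d)"
    "0 < A" "\<And>n s t. (s, t) \<in> P n \<Longrightarrow> \<rho> s t \<le> A * real (n + 1) * (1 / 2) ^ n"
    and link: "\<And>n t. t \<in> N (Suc n) \<Longrightarrow> \<exists>u\<in>N n. \<rho> t u \<le> (1 / 2) ^ n \<and> (t, u) \<in> P n"
    and near: "\<And>n s t. s \<in> N n \<Longrightarrow> t \<in> N n \<Longrightarrow> \<rho> s t \<le> 5 * (1 / 2) ^ n \<Longrightarrow> \<exists>c. (c, s) \<in> P n \<and> (c, t) \<in> P n"
    by (rule chaining_pairs) (rule that; assumption)
  define \<delta> where "\<delta> = (\<theta> - d) / \<beta>"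
  have \<delta>: "0 < \<delta>" using d_less_\<theta> \<beta>_pos by (simp add: \<delta>_def)
  \<comment> \<open>exponents increasing to the critical one\<close>
  define e where "e k = \<delta> * (1 - 1 / real (k + 2))" for k :: nat
  have e: "0 < e k" "e k < \<delta>" for k
  proof -
    have "0 < 1 - 1 / real (k + 2)" "1 - 1 / real (k + 2) < 1" by (simp_all add: field_simps)
    with \<delta> show "0 < e k" "e k < \<delta>" by (simp_all add: e_def)
  qed
  have "AE \<omega> in \<Omega>. \<forall>k. \<exists>c\<ge>0. \<forall>n. \<forall>(s, t)\<in>P n. dist (X s \<omega>) (X t \<omega>) \<le> c * 2 powr (- e k * real n)"
    using e unfolding \<delta>_def AE_all_countable by (intro allI pairs_uniformly_close[OF P])
  then have AE: "AE \<omega> in \<Omega>. \<forall>\<eta>. 0 < \<eta> \<and> \<eta> < (\<theta> - d) / \<beta> \<longrightarrow>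
      (\<exists>c. \<forall>s\<in>\<Union>(range N). \<forall>t\<in>\<Union>(range N). dist (X s \<omega>) (X t \<omega>) \<le> c * \<rho> s t powr \<eta>)"
  proof eventually_elim
    fix \<omega> assume *: "\<forall>k. \<exists>c\<ge>0. \<forall>n. \<forall>(s, t)\<in>P n. dist (X s \<omega>) (X t \<omega>) \<le> c * 2 powr (- e k * real n)"
    show "\<forall>\<eta>. 0 < \<eta> \<and> \<eta> < (\<theta> - d) / \<beta> \<longrightarrow>
      (\<exists>c. \<forall>s\<in>\<Union>(range N). \<forall>t\<in>\<Union>(range N). dist (X s \<omega>) (X t \<omega>) \<le> c * \<rho> s t powr \<eta>)"
    proof (intro allI impI, elim conjE)
      fix \<eta> assume \<eta>: "0 < \<eta>" "\<eta> < (\<theta> - d) / \<beta>"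
      have "e \<longlonglongrightarrow> \<delta> * (1 - 0)"
        unfolding e_def by (intro tendsto_intros LIMSEQ_ignore_initial_segment[OF lim_1_over_n])
      then have "\<forall>\<^sub>F k in sequentially. \<eta> < e k" using \<eta>(2) by (intro order_tendstoD(1)) (auto simp: \<delta>_def)
      then obtain k where k: "\<eta> < e k" by (auto simp: eventually_sequentially)
      obtain c where c: "0 \<le> c" "\<And>n s t. (s, t) \<in> P n \<Longrightarrow> dist (X s \<omega>) (X t \<omega>) \<le> c * 2 powr (- e k * real n)"
        using * by blast
      have close: "dist (X s \<omega>) (X t \<omega>) \<le> c * 2 powr (- \<eta> * real n)" if "(s, t) \<in> P n" for n s t
      proof -
        have "- e k * real n \<le> - \<eta> * real n" using k by (intro mult_right_mono) auto
        then have "c * 2 powr (- e k * real n) \<le> c * 2 powr (- \<eta> * real n)"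
          using c(1) by (intro mult_left_mono powr_mono) auto
        then show ?thesis using c(2)[OF that] by simp
      qed
      show "\<exists>c. \<forall>s\<in>\<Union>(range N). \<forall>t\<in>\<Union>(range N). dist (X s \<omega>) (X t \<omega>) \<le> c * \<rho> s t powr \<eta>"
      proof (rule holder_of_chaining[where N = N and f = "\<lambda>t. X t \<omega>" and c = c and \<eta> = \<eta>])
        fix n t assume "t \<in> N (Suc n)"
        then show "\<exists>u\<in>N n. \<rho> t u \<le> (1 / 2) ^ n \<and> dist (X t \<omega>) (X u \<omega>) \<le> c * 2 powr (- \<eta> * real n)"
          using link close by meson
      next
        fix n s t assume "s \<in> N n" "t \<in> N n" "\<rho> s t \<le> 5 * (1 / 2) ^ n"
        then obtain z where "(z, s) \<in> P n" "(z, t) \<in> P n" using near by blast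
        then have "dist (X z \<omega>) (X s \<omega>) \<le> c * 2 powr (- \<eta> * real n)" "dist (X z \<omega>) (X t \<omega>) \<le> c * 2 powr (- \<eta> * real n)"
          using close by blast+
        then show "dist (X s \<omega>) (X t \<omega>) \<le> 2 * (c * 2 powr (- \<eta> * real n))"
          using dist_triangle[of "X s \<omega>" "X t \<omega>" "X z \<omega>"] by (simp add: dist_commute)
      qed (rule N \<eta>(1) c(1))+
    qed
  qed
  have "\<forall>n. \<exists>\<pi>. \<forall>t\<in>T. \<pi> t \<in> N n \<and> \<rho> t (\<pi> t) \<le> (1 / 2) ^ n"
  proof
    fix n
    have "\<forall>t\<in>T. \<exists>u. u \<in> N n \<and> \<rho> t u \<le> (1 / 2) ^ n" using N(4) by blast
    then show "\<exists>\<pi>. \<forall>t\<in>T. \<pi> t \<in> N n \<and> \<rho> t (\<pi> t) \<le> (1 / 2) ^ n" by (rule bchoice)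
  qed
  from choice[OF this] obtain \<pi> where \<pi>: "\<forall>n. \<forall>t\<in>T. \<pi> n t \<in> N n \<and> \<rho> t (\<pi> n t) \<le> (1 / 2) ^ n" ..
  show ?thesis
  proof (intro exI[of _ "\<Union>(range N)"] exI[of _ "\<lambda>t n. \<pi> n t"] conjI ballI allI AE)
    show "\<Union>(range N) \<subseteq> T" using N(2) by blast
    show "\<pi> n t \<in> \<Union>(range N)" "\<rho> t (\<pi> n t) \<le> (1 / 2) ^ n" if "t \<in> T" for t n using \<pi> that by blast+
  qed
qed

text \<open>
  The moments of the distances are summable along the approximating sequence.
\<close>

lemma approximation_converges:
  assumes t: "t \<in> T" and a: "\<And>n. a n \<in> T" "\<And>n. \<rho> t (a n) \<le> (1 / 2) ^ n"
  shows "AE \<omega> in \<Omega>. (\<lambda>n. X (a n) \<omega>) \<longlonglongrightarrow> X t \<omega>"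
proof -
  have \<theta>_pos: "0 < \<theta>" using d_pos d_less_\<theta> by simp
  have "AE \<omega> in \<Omega>. summable (\<lambda>n. dist (X t \<omega>) (X (a n) \<omega>) powr \<beta>)"
  proof (rule AE_summable_of_moments)
    show "(\<lambda>\<omega>. dist (X t \<omega>) (X (a n) \<omega>) powr \<beta>) \<in> borel_measurable \<Omega>" for n
      by (rule dist_powr_measurable[OF t a(1)])
    show "(\<integral>\<^sup>+\<omega>. ennreal (dist (X t \<omega>) (X (a n) \<omega>) powr \<beta>) \<partial>\<Omega>) \<le> ennreal (C * (2 powr (- \<theta>)) ^ n)" for n
    proof -
      have half: "(1 / 2 :: real) ^ n = 2 powr (- real n)"
        by (simp add: powr_minus powr_realpow power_one_over field_simps)
      have "\<rho> t (a n) powr \<theta> \<le> (2 powr (- real n)) powr \<theta>"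
        using rho_nonneg[OF t a(1)] \<theta>_pos a(2)[of n] unfolding half by (intro powr_mono2) simp_all
      also have "\<dots> = (2 powr (- \<theta>)) ^ n"
        by (simp add: powr_power powr_powr mult.commute)
      finally have "ennreal (C * \<rho> t (a n) powr \<theta>) \<le> ennreal (C * (2 powr (- \<theta>)) ^ n)"
        using C_nonneg by (rule ennreal_leI[OF mult_left_mono])
      then show ?thesis by (rule order_trans[OF moments[OF t a(1)[of n]]])
    qed
    show "summable (\<lambda>n. C * (2 powr (- \<theta>)) ^ n)"
      using \<theta>_pos by (intro summable_mult summable_geometric) (simp add: powr_less_one)
  qed (use C_nonneg in auto)
  then show ?thesis
  proof eventually_elim
    fix \<omega> assume "summable (\<lambda>n. dist (X t \<omega>) (X (a n) \<omega>) powr \<beta>)"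
    then have "(\<lambda>n. dist (X t \<omega>) (X (a n) \<omega>) powr \<beta>) \<longlonglongrightarrow> 0" by (rule summable_LIMSEQ_zero)
    then have "(\<lambda>n. (dist (X t \<omega>) (X (a n) \<omega>) powr \<beta>) powr (1 / \<beta>)) \<longlonglongrightarrow> 0 powr (1 / \<beta>)"
      using \<beta>_pos by (intro tendsto_powr2) auto
    then have "(\<lambda>n. dist (X t \<omega>) (X (a n) \<omega>)) \<longlonglongrightarrow> 0" using \<beta>_pos by (simp add: powr_powr)
    then have "(\<lambda>n. dist (X (a n) \<omega>) (X t \<omega>)) \<longlonglongrightarrow> 0" by (simp only: dist_commute[of "X t \<omega>"])
    then show "(\<lambda>n. X (a n) \<omega>) \<longlonglongrightarrow> X t \<omega>" by (rule iffD2[OF tendsto_dist_iff])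
  qed
qed

text \<open>
  Outside a null set the paths are Hoelder continuous on a dense set and are extended by continuity; on the null set the value is constant to keep measurability.
\<close>

theorem holder_version:
  obtains Y where "\<And>t. t \<in> T \<Longrightarrow> Y t \<in> borel_measurable \<Omega>" "\<And>t. t \<in> T \<Longrightarrow> AE \<omega> in \<Omega>. Y t \<omega> = X t \<omega>"
    "AE \<omega> in \<Omega>. ess_holder_on ((\<theta> - d) / \<beta>) T \<rho> (\<lambda>t. Y t \<omega>)"
proof -
  define \<delta> where "\<delta> = (\<theta> - d) / \<beta>"
  have \<delta>: "0 < \<delta>" using d_less_\<theta> \<beta>_pos by (simp add: \<delta>_def)
  obtain D a where D: "D \<subseteq> T" and a': "\<forall>t\<in>T. \<forall>n. a t n \<in> D \<and> \<rho> t (a t n) \<le> (1 / 2) ^ n"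
    and AE: "AE \<omega> in \<Omega>. \<forall>\<eta>. 0 < \<eta> \<and> \<eta> < \<delta> \<longrightarrow>
      (\<exists>c. \<forall>s\<in>D. \<forall>t\<in>D. dist (X s \<omega>) (X t \<omega>) \<le> c * \<rho> s t powr \<eta>)"
    using holder_on_dense_set unfolding \<delta>_def[symmetric] by (elim exE conjE) (rule that)
  have a: "a t n \<in> D" "\<rho> t (a t n) \<le> (1 / 2) ^ n" if "t \<in> T" for t n using a' that by blast+
  obtain Z where Z: "Z \<in> null_sets \<Omega>" "\<And>\<omega>. \<omega> \<in> space \<Omega> - Z \<Longrightarrow> \<forall>\<eta>. 0 < \<eta> \<and> \<eta> < \<delta> \<longrightarrow>
      (\<exists>c. \<forall>s\<in>D. \<forall>t\<in>D. dist (X s \<omega>) (X t \<omega>) \<le> c * \<rho> s t powr \<eta>)"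
    by (rule AE_E3[OF AE]) (rule that)
  define e0 :: 'e where "e0 = undefined"
  define Y where "Y t \<omega> = (if \<omega> \<in> Z then e0 else lim (\<lambda>n. X (a t n) \<omega>))" for t \<omega>
  have conv: "(\<lambda>n. X (a t n) \<omega>) \<longlonglongrightarrow> Y t \<omega>" if \<omega>: "\<omega> \<in> space \<Omega> - Z" and t: "t \<in> T" for t \<omega>
  proof -
    have "\<exists>c. \<forall>s\<in>D. \<forall>t\<in>D. dist (X s \<omega>) (X t \<omega>) \<le> c * \<rho> s t powr (\<delta> / 2)"
      using Z(2)[OF \<omega>, rule_format, of "\<delta> / 2"] \<delta> by simp
    then obtain c where c: "\<And>s t. s \<in> D \<Longrightarrow> t \<in> D \<Longrightarrow> dist (X s \<omega>) (X t \<omega>) \<le> c * \<rho> s t powr (\<delta> / 2)"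
      by blast
    have "Cauchy (\<lambda>n. X (a t n) \<omega>)"
    proof (rule metric_CauchyI)
      fix \<epsilon> :: real assume \<epsilon>: "0 < \<epsilon>"
      have "(\<lambda>n. 2 * (1 / 2 :: real) ^ n) \<longlonglongrightarrow> 2 * 0" by (intro tendsto_intros LIMSEQ_power_zero) auto
      then have "(\<lambda>n. (2 * (1 / 2 :: real) ^ n) powr (\<delta> / 2)) \<longlonglongrightarrow> 0 powr (\<delta> / 2)"
        using \<delta> by (intro tendsto_powr2) auto
      then have "(\<lambda>n. \<bar>c\<bar> * (2 * (1 / 2 :: real) ^ n) powr (\<delta> / 2)) \<longlonglongrightarrow> \<bar>c\<bar> * 0 powr (\<delta> / 2)"
        by (intro tendsto_mult tendsto_const)
      then have "\<forall>\<^sub>F n in sequentially. \<bar>c\<bar> * (2 * (1 / 2 :: real) ^ n) powr (\<delta> / 2) < \<epsilon>"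
        using \<epsilon> by (intro order_tendstoD(2)) auto
      then obtain m where m: "\<bar>c\<bar> * (2 * (1 / 2 :: real) ^ m) powr (\<delta> / 2) < \<epsilon>" by (auto simp: eventually_sequentially)
      have "dist (X (a t i) \<omega>) (X (a t j) \<omega>) < \<epsilon>" if ij: "m \<le> i" "m \<le> j" for i j
      proof -
        have inT: "a t i \<in> T" "a t j \<in> T" using a(1)[OF t] D by auto
        have "(1 / 2 :: real) ^ i \<le> (1 / 2) ^ m" "(1 / 2 :: real) ^ j \<le> (1 / 2) ^ m"
          using ij by (auto intro: power_decreasing)
        moreover have "\<rho> (a t i) (a t j) \<le> \<rho> (a t i) t + \<rho> t (a t j)" by (rule rho_triangle[OF inT(1) t inT(2)])
        ultimately have "\<rho> (a t i) (a t j) \<le> 2 * (1 / 2) ^ m"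
          using a(2)[OF t, of i] a(2)[OF t, of j] rho_sym[OF inT(1) t] by linarith
        then have "\<rho> (a t i) (a t j) powr (\<delta> / 2) \<le> (2 * (1 / 2) ^ m) powr (\<delta> / 2)"
          using rho_nonneg[OF inT] \<delta> by (intro powr_mono2) auto
        then have "\<bar>c\<bar> * \<rho> (a t i) (a t j) powr (\<delta> / 2) \<le> \<bar>c\<bar> * (2 * (1 / 2) ^ m) powr (\<delta> / 2)"
          by (intro mult_left_mono) auto
        moreover have "c * \<rho> (a t i) (a t j) powr (\<delta> / 2) \<le> \<bar>c\<bar> * \<rho> (a t i) (a t j) powr (\<delta> / 2)"
          by (intro mult_right_mono) auto
        ultimately show ?thesis using c[OF a(1)[OF t] a(1)[OF t], of i j] m by linarith
      qed
      then show "\<exists>m. \<forall>i\<ge>m. \<forall>j\<ge>m. dist (X (a t i) \<omega>) (X (a t j) \<omega>) < \<epsilon>" by blast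
    qed
    then show ?thesis using \<omega> by (simp add: Y_def Cauchy_convergent_iff convergent_LIMSEQ_iff)
  qed
  have not_Z: "AE \<omega> in \<Omega>. \<omega> \<in> space \<Omega> - Z"
    using AE_not_in[OF Z(1)] AE_space by eventually_elim simp
  show ?thesis
  proof (rule that[of Y])
    fix t assume t: "t \<in> T"
    show "Y t \<in> borel_measurable \<Omega>"
    proof (rule borel_measurable_LIMSEQ_metric)
      fix n
      have "X (a t n) \<in> borel_measurable \<Omega>" using X_measurable a(1)[OF t] D by blast
      moreover have "Z \<in> sets \<Omega>" using Z(1) by auto
      ultimately show "(\<lambda>\<omega>. if \<omega> \<in> Z then e0 else X (a t n) \<omega>) \<in> borel_measurable \<Omega>"
        by (intro measurable_If_set) (auto intro: sets.Int)
    next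
      fix \<omega> assume "\<omega> \<in> space \<Omega>"
      then show "(\<lambda>n. if \<omega> \<in> Z then e0 else X (a t n) \<omega>) \<longlonglongrightarrow> Y t \<omega>"
        using conv[OF _ t, of \<omega>] by (cases "\<omega> \<in> Z") (auto simp: Y_def)
    qed
    have "AE \<omega> in \<Omega>. (\<lambda>n. X (a t n) \<omega>) \<longlonglongrightarrow> X t \<omega>"
      using a D t by (intro approximation_converges) auto
    with not_Z show "AE \<omega> in \<Omega>. Y t \<omega> = X t \<omega>"
      by eventually_elim (use conv[OF _ t] LIMSEQ_unique in blast)
  next
    from not_Z show "AE \<omega> in \<Omega>. ess_holder_on ((\<theta> - d) / \<beta>) T \<rho> (\<lambda>t. Y t \<omega>)"
    proof eventually_elim
      fix \<omega> assume \<omega>: "\<omega> \<in> space \<Omega> - Z"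
      show "ess_holder_on ((\<theta> - d) / \<beta>) T \<rho> (\<lambda>t. Y t \<omega>)"
      proof (rule ess_holder_onI)
        fix \<eta> assume \<eta>: "0 < \<eta>" "\<eta> < (\<theta> - d) / \<beta>"
        then obtain c where c: "\<And>s t. s \<in> D \<Longrightarrow> t \<in> D \<Longrightarrow> dist (X s \<omega>) (X t \<omega>) \<le> c * \<rho> s t powr \<eta>"
          using Z(2)[OF \<omega>] unfolding \<delta>_def by blast
        have "dist (Y s \<omega>) (Y t \<omega>) \<le> \<bar>c\<bar> * \<rho> s t powr \<eta>" if s: "s \<in> T" and t: "t \<in> T" for s t
          by (rule holder_limit[where f = "\<lambda>t. X t \<omega>", OF c D s a(1)[OF s] a(2)[OF s] conv[OF \<omega> s]
                t a(1)[OF t] a(2)[OF t] conv[OF \<omega> t] \<eta>(1)])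
        then show "\<exists>c. \<forall>x\<in>T. \<forall>y\<in>T. dist (Y x \<omega>) (Y y \<omega>) \<le> c * \<rho> x y powr \<eta>" by blast
      qed (use \<delta> rho_nonneg in \<open>auto simp: \<delta>_def\<close>)
    qed
  qed
qed

text \<open>
  A process whose paths are already continuous need not be modified: the estimate on the dense set
  passes to the limit.  This yields the better exponents on the sections of a jointly continuous
  version.
\<close>

theorem continuous_process_holder:
  assumes cont: "AE \<omega> in \<Omega>. \<forall>x\<in>T. \<forall>e>0. \<exists>h>0. \<forall>y\<in>T. \<rho> x y < h \<longrightarrow> dist (X x \<omega>) (X y \<omega>) < e"
  shows "AE \<omega> in \<Omega>. ess_holder_on ((\<theta> - d) / \<beta>) T \<rho> (\<lambda>t. X t \<omega>)"
proof -
  obtain D a where D: "D \<subseteq> T" and a': "\<forall>t\<in>T. \<forall>n. a t n \<in> D \<and> \<rho> t (a t n) \<le> (1 / 2) ^ n"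
    and AE: "AE \<omega> in \<Omega>. \<forall>\<eta>. 0 < \<eta> \<and> \<eta> < (\<theta> - d) / \<beta> \<longrightarrow>
      (\<exists>c. \<forall>s\<in>D. \<forall>t\<in>D. dist (X s \<omega>) (X t \<omega>) \<le> c * \<rho> s t powr \<eta>)"
    using holder_on_dense_set by (elim exE conjE) (rule that)
  have a: "a t n \<in> D" "\<rho> t (a t n) \<le> (1 / 2) ^ n" if "t \<in> T" for t n using a' that by blast+
  from AE cont show ?thesis
  proof eventually_elim
    fix \<omega> assume H: "\<forall>\<eta>. 0 < \<eta> \<and> \<eta> < (\<theta> - d) / \<beta> \<longrightarrow>
        (\<exists>c. \<forall>s\<in>D. \<forall>t\<in>D. dist (X s \<omega>) (X t \<omega>) \<le> c * \<rho> s t powr \<eta>)"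
      and cont: "\<forall>x\<in>T. \<forall>e>0. \<exists>h>0. \<forall>y\<in>T. \<rho> x y < h \<longrightarrow> dist (X x \<omega>) (X y \<omega>) < e"
    have conv: "(\<lambda>n. X (a t n) \<omega>) \<longlonglongrightarrow> X t \<omega>" if t: "t \<in> T" for t
    proof (rule metric_LIMSEQ_I)
      fix e :: real assume "0 < e"
      then obtain h where h: "0 < h" "\<And>y. y \<in> T \<Longrightarrow> \<rho> t y < h \<Longrightarrow> dist (X t \<omega>) (X y \<omega>) < e" using cont t by blast
      obtain m where m: "(1 / 2) ^ m < h" using real_arch_pow_inv[OF h(1), of "1 / 2"] by auto
      have "dist (X (a t n) \<omega>) (X t \<omega>) < e" if "m \<le> n" for n
      proof -
        have "(1 / 2 :: real) ^ n \<le> (1 / 2) ^ m" using that by (intro power_decreasing) auto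
        then have "\<rho> t (a t n) < h" using a(2)[OF t, of n] m by linarith
        then show ?thesis using h(2)[of "a t n"] a(1)[OF t, of n] D by (auto simp: dist_commute)
      qed
      then show "\<exists>m. \<forall>n\<ge>m. dist (X (a t n) \<omega>) (X t \<omega>) < e" by blast
    qed
    show "ess_holder_on ((\<theta> - d) / \<beta>) T \<rho> (\<lambda>t. X t \<omega>)"
    proof (rule ess_holder_onI)
      fix \<eta> assume \<eta>: "0 < \<eta>" "\<eta> < (\<theta> - d) / \<beta>"
      then obtain c where c: "\<And>s t. s \<in> D \<Longrightarrow> t \<in> D \<Longrightarrow> dist (X s \<omega>) (X t \<omega>) \<le> c * \<rho> s t powr \<eta>"
        using H by blast
      have "dist (X s \<omega>) (X t \<omega>) \<le> \<bar>c\<bar> * \<rho> s t powr \<eta>" if s: "s \<in> T" and t: "t \<in> T" for s t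
        by (rule holder_limit[where f = "\<lambda>t. X t \<omega>", OF c D s a(1)[OF s] a(2)[OF s] conv[OF s]
              t a(1)[OF t] a(2)[OF t] conv[OF t] \<eta>(1)])
      then show "\<exists>c. \<forall>x\<in>T. \<forall>y\<in>T. dist (X x \<omega>) (X y \<omega>) \<le> c * \<rho> x y powr \<eta>" by blast
    qed (use d_less_\<theta> \<beta>_pos rho_nonneg in auto)
  qed
qed

end

section \<open>Processes indexed by time and space\<close>

lemma unit_interval_entropy:
  fixes \<epsilon> :: real assumes \<epsilon>: "0 < \<epsilon>" "\<epsilon> \<le> 1"
  shows "\<exists>N\<subseteq>{0..1::real}. finite N \<and> card N \<le> 2 * \<epsilon> powr (- 1) \<and> (\<forall>x\<in>{0..1}. \<exists>y\<in>N. dist x y \<le> \<epsilon>)"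
proof -
  define m where "m = nat \<lfloor>1 / \<epsilon>\<rfloor>"
  have m: "real m \<le> 1 / \<epsilon>" using \<epsilon> by (simp add: m_def)
  define N where "N = (\<lambda>k. real k * \<epsilon>) ` {..m}"
  have "N \<subseteq> {0..1}"
  proof
    fix y assume "y \<in> N"
    then obtain k where k: "k \<le> m" "y = real k * \<epsilon>" by (auto simp: N_def)
    then have "real k \<le> 1 / \<epsilon>" using m by linarith
    then show "y \<in> {0..1}" using k \<epsilon> by (simp add: field_simps)
  qed
  moreover have "finite N" by (simp add: N_def)
  moreover have "card N \<le> 2 * \<epsilon> powr (- 1)"
  proof -
    have "card N \<le> m + 1" unfolding N_def using card_image_le[of "{..m}" "\<lambda>k. real k * \<epsilon>"] by simp
    then have "real (card N) \<le> real m + 1" by simp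
    also have "\<dots> \<le> 1 / \<epsilon> + 1 / \<epsilon>" using m \<epsilon> by (intro add_mono) auto
    also have "\<dots> = 2 * \<epsilon> powr (- 1)" using \<epsilon> by (simp add: powr_minus divide_inverse)
    finally show ?thesis .
  qed
  moreover have "\<exists>y\<in>N. dist x y \<le> \<epsilon>" if x: "x \<in> {0..1}" for x
  proof -
    define k where "k = nat \<lfloor>x / \<epsilon>\<rfloor>"
    have "0 \<le> x / \<epsilon>" using x \<epsilon> by simp
    then have k: "real k \<le> x / \<epsilon>" "x / \<epsilon> < real k + 1" by (simp_all add: k_def)
    have "x / \<epsilon> \<le> 1 / \<epsilon>" using x \<epsilon> by (intro divide_right_mono) auto
    then have "k \<le> m" unfolding k_def m_def by (intro nat_mono floor_mono)
    then have "real k * \<epsilon> \<in> N" by (auto simp: N_def)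
    moreover have "real k * \<epsilon> \<le> x" "x < real k * \<epsilon> + \<epsilon>" using k \<epsilon> by (simp_all add: field_simps)
    then have "dist x (real k * \<epsilon>) \<le> \<epsilon>" by (simp add: dist_real_def)
    ultimately show ?thesis by blast
  qed
  ultimately show ?thesis by blast
qed

lemma unit_interval_pseudometric: "pseudometric_with_entropy {0..1::real} dist 2 1"
  using unit_interval_entropy by unfold_locales (auto simp: dist_commute dist_triangle)

lemma add_powr_le:
  fixes a b \<beta> :: real
  assumes "0 \<le> a" "0 \<le> b" "0 < \<beta>"
  shows "(a + b) powr \<beta> \<le> 2 powr \<beta> * (a powr \<beta> + b powr \<beta>)"
proof -
  have "(a + b) powr \<beta> \<le> (2 * max a b) powr \<beta>" using assms by (intro powr_mono2) auto
  also have "\<dots> = 2 powr \<beta> * max a b powr \<beta>" using assms by (simp add: powr_mult)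
  also have "\<dots> \<le> 2 powr \<beta> * (a powr \<beta> + b powr \<beta>)"
    by (intro mult_left_mono) (auto simp: max_def)
  finally show ?thesis .
qed

context regular_irreducible_harmonic_structure begin

lemma resistance_max_pair: "resistance_max (s, x) (t, y) = max \<bar>s - t\<bar> (resistance x y)"
  by (simp add: resistance_max_def)

lemma resistance_pseudometric:
  obtains K where "pseudometric_with_entropy F resistance K dim_H"
proof -
  obtain K where K: "\<And>\<epsilon>. 0 < \<epsilon> \<Longrightarrow> \<epsilon> \<le> 1 \<Longrightarrow>
    \<exists>N\<subseteq>F. finite N \<and> card N \<le> K * \<epsilon> powr (- dim_H) \<and> (\<forall>x\<in>F. \<exists>y\<in>N. resistance x y \<le> \<epsilon>)"
    by (rule resistance_entropy) (rule that; assumption)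
  show ?thesis
  proof (rule that[of K], unfold_locales)
    show "resistance s t = resistance t s" if "s \<in> F" "t \<in> F" for s t by (rule resistance_sym[OF that])
  qed (rule resistance_nonneg resistance_self resistance_triangle dim_H_spec(1) K | assumption)+
qed

lemma resistance_max_pseudometric:
  obtains K where "pseudometric_with_entropy ({0..1} \<times> F) resistance_max K (dim_H + 1)"
proof -
  obtain K where "pseudometric_with_entropy F resistance K dim_H" by (rule resistance_pseudometric)
  then interpret R: pseudometric_with_entropy F resistance K dim_H .
  show ?thesis
  proof (rule that[of "2 * K"], unfold_locales)
    fix p q u assume "p \<in> {0..1::real} \<times> F" "q \<in> {0..1::real} \<times> F" "u \<in> {0..1::real} \<times> F"
    then obtain s x t y v z where *: "p = (s, x)" "q = (t, y)" "u = (v, z)" "x \<in> F" "y \<in> F" "z \<in> F" by blast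
    then have "resistance x z \<le> resistance x y + resistance y z" by (intro resistance_triangle)
    moreover have "\<bar>s - v\<bar> \<le> \<bar>s - t\<bar> + \<bar>t - v\<bar>" by simp
    ultimately show "resistance_max p u \<le> resistance_max p q + resistance_max q u"
      unfolding *(1-3) resistance_max_pair max_def by (auto split: if_splits)
  next
    fix p q assume "p \<in> {0..1::real} \<times> F" "q \<in> {0..1::real} \<times> F"
    then obtain s x t y where *: "p = (s, x)" "q = (t, y)" "x \<in> F" "y \<in> F" by blast
    then show "resistance_max p q = resistance_max q p"
      using resistance_sym[of x y] by (simp add: resistance_max_pair abs_minus_commute)
    show "0 \<le> resistance_max p q" using * by (simp add: resistance_max_pair)
  next
    fix p assume "p \<in> {0..1::real} \<times> F"
    then show "resistance_max p p = 0" by (cases p) (simp add: resistance_max_pair resistance_self)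
  next
    fix \<epsilon> :: real assume \<epsilon>: "0 < \<epsilon>" "\<epsilon> \<le> 1"
    obtain N where N: "N \<subseteq> F" "finite N" "card N \<le> K * \<epsilon> powr (- dim_H)" "\<And>x. x \<in> F \<Longrightarrow> \<exists>y\<in>N. resistance x y \<le> \<epsilon>"
      using R.covering[OF \<epsilon>] by blast
    obtain J where J: "J \<subseteq> {0..1::real}" "finite J" "card J \<le> 2 * \<epsilon> powr (- 1)" "\<And>x. x \<in> {0..1} \<Longrightarrow> \<exists>y\<in>J. dist x y \<le> \<epsilon>"
      using unit_interval_entropy[OF \<epsilon>] by blast
    have "real (card (J \<times> N)) \<le> (2 * \<epsilon> powr (- 1)) * (K * \<epsilon> powr (- dim_H))"
      unfolding card_cartesian_product of_nat_mult using N(3) J(3) by (intro mult_mono) auto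
    also have "\<dots> = 2 * K * (\<epsilon> powr (- 1) * \<epsilon> powr (- dim_H))" by (simp only: mult_ac)
    also have "\<epsilon> powr (- 1) * \<epsilon> powr (- dim_H) = \<epsilon> powr (- (dim_H + 1))"
      by (subst powr_add[symmetric]) (simp add: algebra_simps)
    finally have "real (card (J \<times> N)) \<le> 2 * K * \<epsilon> powr (- (dim_H + 1))" .
    moreover have "\<exists>q\<in>J \<times> N. resistance_max p q \<le> \<epsilon>" if "p \<in> {0..1} \<times> F" for p
    proof -
      obtain s x where p: "p = (s, x)" "s \<in> {0..1}" "x \<in> F" using \<open>p \<in> {0..1} \<times> F\<close> by blast
      obtain t y where "t \<in> J" "dist s t \<le> \<epsilon>" "y \<in> N" "resistance x y \<le> \<epsilon>" using N(4) J(4) p by meson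
      then show ?thesis using p by (intro bexI[of _ "(t, y)"]) (auto simp: resistance_max_pair dist_real_def)
    qed
    moreover have "J \<times> N \<subseteq> {0..1} \<times> F" "finite (J \<times> N)" using N J by auto
    ultimately show "\<exists>N\<subseteq>{0..1} \<times> F. finite N \<and> card N \<le> 2 * K * \<epsilon> powr (- (dim_H + 1)) \<and>
      (\<forall>p\<in>{0..1} \<times> F. \<exists>q\<in>N. resistance_max p q \<le> \<epsilon>)" by (intro exI[of _ "J \<times> N"]) simp
  qed (use dim_H_spec(1) in simp)
qed

text \<open>
  Go from \<open>(s, x)\<close> to \<open>(t, y)\<close> through \<open>(t, x)\<close>.  Both exponents may be lowered to the smaller one since time
  and resistance are bounded.
\<close>

lemma joint_moment:
  fixes \<xi> :: "real \<times> 'a \<Rightarrow> 'w \<Rightarrow> 'e::polish_space"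
  assumes proc: "stochastic_process \<Omega> ({0..1} \<times> F) \<xi>" and pos: "0 < C" "0 < \<beta>" "0 < \<gamma>" "0 < \<gamma>'"
    and space: "\<And>t x y. t \<in> {0..1} \<Longrightarrow> x \<in> F \<Longrightarrow> y \<in> F \<Longrightarrow>
      (\<integral>\<^sup>+\<omega>. ennreal (dist (\<xi> (t, x) \<omega>) (\<xi> (t, y) \<omega>) powr \<beta>) \<partial>\<Omega>) \<le> ennreal (C * resistance x y powr (dim_H + 1 + \<gamma>))"
    and time: "\<And>s t x. s \<in> {0..1} \<Longrightarrow> t \<in> {0..1} \<Longrightarrow> x \<in> F \<Longrightarrow>
      (\<integral>\<^sup>+\<omega>. ennreal (dist (\<xi> (s, x) \<omega>) (\<xi> (t, x) \<omega>) powr \<beta>) \<partial>\<Omega>) \<le> ennreal (C * \<bar>s - t\<bar> powr (dim_H + 1 + \<gamma>'))"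
  shows "\<exists>C'\<ge>0. \<forall>p\<in>{0..1} \<times> F. \<forall>q\<in>{0..1} \<times> F.
    (\<integral>\<^sup>+\<omega>. ennreal (dist (\<xi> p \<omega>) (\<xi> q \<omega>) powr \<beta>) \<partial>\<Omega>) \<le> ennreal (C' * resistance_max p q powr (dim_H + 1 + min \<gamma> \<gamma>'))"
proof -
  obtain B0 where B0: "\<And>x y. x \<in> F \<Longrightarrow> y \<in> F \<Longrightarrow> resistance x y \<le> B0" by (rule resistance_bounded) (rule that; assumption)
  define e where "e = dim_H + 1 + min \<gamma> \<gamma>'"
  have e: "0 < e" using dim_H_spec(1) pos by (simp add: e_def)
  \<comment> \<open>the factor by which the surplus exponent of the resistance is absorbed\<close>
  define B where "B = \<bar>B0\<bar> powr (\<gamma> - min \<gamma> \<gamma>')"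
  show ?thesis
  proof (intro exI[of _ "2 powr \<beta> * (C + C * B)"] conjI ballI)
    show "0 \<le> 2 powr \<beta> * (C + C * B)" using pos by (simp add: B_def)
    fix p q :: "real \<times> 'a" assume "p \<in> {0..1} \<times> F" "q \<in> {0..1} \<times> F"
    then obtain s x t y where pq: "p = (s, x)" "q = (t, y)" and s: "s \<in> {0..1}" and t: "t \<in> {0..1}"
      and x: "x \<in> F" and y: "y \<in> F" by blast
    define m where "m = resistance_max p q"
    have m: "\<bar>s - t\<bar> \<le> m" "resistance x y \<le> m" by (auto simp: m_def pq resistance_max_pair)
    have R: "0 \<le> resistance x y" by (rule resistance_nonneg[OF x y])
    have "\<bar>s - t\<bar> powr (dim_H + 1 + \<gamma>') \<le> \<bar>s - t\<bar> powr e"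
      using s t by (intro powr_mono') (auto simp: e_def)
    also have "\<dots> \<le> m powr e" using m e by (intro powr_mono2) auto
    finally have 1: "\<bar>s - t\<bar> powr (dim_H + 1 + \<gamma>') \<le> m powr e" .
    have "resistance x y powr (dim_H + 1 + \<gamma>) = resistance x y powr e * resistance x y powr (\<gamma> - min \<gamma> \<gamma>')"
      unfolding e_def by (subst powr_add[symmetric]) (simp add: algebra_simps)
    also have "\<dots> \<le> m powr e * B"
      unfolding B_def using m e R B0[OF x y] by (intro mult_mono powr_mono2) auto
    finally have 2: "resistance x y powr (dim_H + 1 + \<gamma>) \<le> m powr e * B" .
    let ?a = "\<lambda>\<omega>. dist (\<xi> (s, x) \<omega>) (\<xi> (t, x) \<omega>)" and ?b = "\<lambda>\<omega>. dist (\<xi> (t, x) \<omega>) (\<xi> (t, y) \<omega>)"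
    have meas: "(\<lambda>\<omega>. ennreal (?a \<omega> powr \<beta>)) \<in> borel_measurable \<Omega>" "(\<lambda>\<omega>. ennreal (?b \<omega> powr \<beta>)) \<in> borel_measurable \<Omega>"
    proof -
      have "\<xi> (s, x) \<in> borel_measurable \<Omega>" "\<xi> (t, x) \<in> borel_measurable \<Omega>" "\<xi> (t, y) \<in> borel_measurable \<Omega>"
        using proc s t x y by (auto simp: stochastic_process_def)
      then show "(\<lambda>\<omega>. ennreal (?a \<omega> powr \<beta>)) \<in> borel_measurable \<Omega>" "(\<lambda>\<omega>. ennreal (?b \<omega> powr \<beta>)) \<in> borel_measurable \<Omega>"
        by measurable
    qed
    have "(\<integral>\<^sup>+\<omega>. ennreal (dist (\<xi> p \<omega>) (\<xi> q \<omega>) powr \<beta>) \<partial>\<Omega>)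
      \<le> (\<integral>\<^sup>+\<omega>. ennreal (2 powr \<beta>) * (ennreal (?a \<omega> powr \<beta>) + ennreal (?b \<omega> powr \<beta>)) \<partial>\<Omega>)"
    proof (rule nn_integral_mono)
      fix \<omega>
      have "dist (\<xi> p \<omega>) (\<xi> q \<omega>) powr \<beta> \<le> (?a \<omega> + ?b \<omega>) powr \<beta>"
        unfolding pq using pos(2) dist_triangle by (intro powr_mono2) auto
      also have "\<dots> \<le> 2 powr \<beta> * (?a \<omega> powr \<beta> + ?b \<omega> powr \<beta>)" using pos(2) by (intro add_powr_le) auto
      finally show "ennreal (dist (\<xi> p \<omega>) (\<xi> q \<omega>) powr \<beta>) \<le> ennreal (2 powr \<beta>) * (ennreal (?a \<omega> powr \<beta>) + ennreal (?b \<omega> powr \<beta>))"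
        by (simp add: ennreal_mult[symmetric] ennreal_plus[symmetric] ennreal_leI del: ennreal_plus)
    qed
    also have "\<dots> = ennreal (2 powr \<beta>) * ((\<integral>\<^sup>+\<omega>. ennreal (?a \<omega> powr \<beta>) \<partial>\<Omega>) + (\<integral>\<^sup>+\<omega>. ennreal (?b \<omega> powr \<beta>) \<partial>\<Omega>))"
      using meas by (simp add: nn_integral_cmult nn_integral_add)
    also have "\<dots> \<le> ennreal (2 powr \<beta>) * (ennreal (C * m powr e) + ennreal (C * (m powr e * B)))"
    proof (intro mult_left_mono add_mono)
      show "(\<integral>\<^sup>+\<omega>. ennreal (?a \<omega> powr \<beta>) \<partial>\<Omega>) \<le> ennreal (C * m powr e)"
        using pos(1) 1 by (intro order_trans[OF time[OF s t x]] ennreal_leI mult_left_mono) auto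
      show "(\<integral>\<^sup>+\<omega>. ennreal (?b \<omega> powr \<beta>) \<partial>\<Omega>) \<le> ennreal (C * (m powr e * B))"
        using pos(1) 2 by (intro order_trans[OF space[OF t x y]] ennreal_leI mult_left_mono) auto
    qed simp
    also have "\<dots> = ennreal (2 powr \<beta> * (C * m powr e + C * (m powr e * B)))"
      using pos(1) by (simp add: ennreal_mult[symmetric] ennreal_plus[symmetric] B_def del: ennreal_plus)
    also have "2 powr \<beta> * (C * m powr e + C * (m powr e * B)) = 2 powr \<beta> * (C + C * B) * m powr e"
      by (simp add: algebra_simps)
    finally show "(\<integral>\<^sup>+\<omega>. ennreal (dist (\<xi> p \<omega>) (\<xi> q \<omega>) powr \<beta>) \<partial>\<Omega>)
      \<le> ennreal (2 powr \<beta> * (C + C * B) * resistance_max p q powr (dim_H + 1 + min \<gamma> \<gamma>'))"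
      by (simp only: m_def e_def)
  qed
qed

end

theorem theorem3p17:
  fixes F :: "'a::metric_space set" and M :: nat and \<psi> :: "nat \<Rightarrow> 'a \<Rightarrow> 'a"
    and A\<^sub>0 :: "'a \<Rightarrow> 'a \<Rightarrow> real" and r :: "nat \<Rightarrow> real"
    and \<Omega> :: "'w measure" and \<xi> :: "real \<times> 'a \<Rightarrow> 'w \<Rightarrow> 'e::polish_space"
    and C \<beta> \<gamma> \<gamma>' :: real
  assumes "regular_irreducible_harmonic_structure F M \<psi> A\<^sub>0 r"
    and "prob_space \<Omega>"
    and "stochastic_process \<Omega> ({0..1} \<times> F) \<xi>"
    and "0 < C" "0 < \<beta>" "0 < \<gamma>" "0 < \<gamma>'"
    and "\<And>t x y. t \<in> {0..1} \<Longrightarrow> x \<in> F \<Longrightarrow> y \<in> F \<Longrightarrow>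
      (\<integral>\<^sup>+\<omega>. ennreal (dist (\<xi> (t, x) \<omega>) (\<xi> (t, y) \<omega>) powr \<beta>) \<partial>\<Omega>)
        \<le> ennreal (C * energy_form.resistance F M \<psi> A\<^sub>0 r x y powr (energy_form.dim_H M r + 1 + \<gamma>))"
    and "\<And>s t x. s \<in> {0..1} \<Longrightarrow> t \<in> {0..1} \<Longrightarrow> x \<in> F \<Longrightarrow>
      (\<integral>\<^sup>+\<omega>. ennreal (dist (\<xi> (s, x) \<omega>) (\<xi> (t, x) \<omega>) powr \<beta>) \<partial>\<Omega>)
        \<le> ennreal (C * \<bar>s - t\<bar> powr (energy_form.dim_H M r + 1 + \<gamma>'))"
  shows "\<exists>\<xi>'. version_of \<Omega> ({0..1} \<times> F) \<xi> \<xi>' \<and>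
    (AE \<omega> in \<Omega>. ess_holder_on (1 / \<beta> * min \<gamma> \<gamma>') ({0..1} \<times> F)
        (energy_form.resistance_max F M \<psi> A\<^sub>0 r) (\<lambda>p. \<xi>' p \<omega>)) \<and>
    (\<forall>t\<in>{0..1}. AE \<omega> in \<Omega>. ess_holder_on (1 / \<beta> * (1 + \<gamma>)) F
        (energy_form.resistance F M \<psi> A\<^sub>0 r) (\<lambda>x. \<xi>' (t, x) \<omega>)) \<and>
    (\<forall>x\<in>F. AE \<omega> in \<Omega>. ess_holder_on (1 / \<beta> * (energy_form.dim_H M r + \<gamma>')) {0..1}
        dist (\<lambda>t. \<xi>' (t, x) \<omega>))"
proof -
  interpret regular_irreducible_harmonic_structure F M \<psi> A\<^sub>0 r by fact
  note proc = assms(3) and pos = assms(4-7) and space = assms(8) and time = assms(9)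
  let ?T = "{0..1::real} \<times> F"
  have "\<exists>C'\<ge>0. \<forall>p\<in>?T. \<forall>q\<in>?T. (\<integral>\<^sup>+\<omega>. ennreal (dist (\<xi> p \<omega>) (\<xi> q \<omega>) powr \<beta>) \<partial>\<Omega>)
    \<le> ennreal (C' * resistance_max p q powr (dim_H + 1 + min \<gamma> \<gamma>'))"
    by (rule joint_moment[OF proc pos space time])
  then obtain C' where C': "0 \<le> C'" "\<And>p q. p \<in> ?T \<Longrightarrow> q \<in> ?T \<Longrightarrow>
    (\<integral>\<^sup>+\<omega>. ennreal (dist (\<xi> p \<omega>) (\<xi> q \<omega>) powr \<beta>) \<partial>\<Omega>) \<le> ennreal (C' * resistance_max p q powr (dim_H + 1 + min \<gamma> \<gamma>'))"
    by blast
  have meas: "\<xi> p \<in> borel_measurable \<Omega>" if "p \<in> ?T" for p using proc that unfolding stochastic_process_def by blast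
  obtain K1 where "pseudometric_with_entropy ?T resistance_max K1 (dim_H + 1)"
    by (rule resistance_max_pseudometric)
  then interpret joint: process_with_moments ?T resistance_max K1 "dim_H + 1" \<Omega> \<xi> C' \<beta> "dim_H + 1 + min \<gamma> \<gamma>'"
    unfolding process_with_moments_def process_with_moments_axioms_def using pos C' meas by simp
  obtain Y where Y: "\<And>p. p \<in> ?T \<Longrightarrow> Y p \<in> borel_measurable \<Omega>" "\<And>p. p \<in> ?T \<Longrightarrow> AE \<omega> in \<Omega>. Y p \<omega> = \<xi> p \<omega>"
    "AE \<omega> in \<Omega>. ess_holder_on ((dim_H + 1 + min \<gamma> \<gamma>' - (dim_H + 1)) / \<beta>) ?T resistance_max (\<lambda>p. Y p \<omega>)"
    by (rule joint.holder_version) (rule that; assumption)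
  have same_moment: "(\<integral>\<^sup>+\<omega>. ennreal (dist (Y p \<omega>) (Y q \<omega>) powr \<beta>) \<partial>\<Omega>)
      = (\<integral>\<^sup>+\<omega>. ennreal (dist (\<xi> p \<omega>) (\<xi> q \<omega>) powr \<beta>) \<partial>\<Omega>)" if "p \<in> ?T" "q \<in> ?T" for p q
  proof (rule nn_integral_cong_AE)
    show "AE \<omega> in \<Omega>. ennreal (dist (Y p \<omega>) (Y q \<omega>) powr \<beta>) = ennreal (dist (\<xi> p \<omega>) (\<xi> q \<omega>) powr \<beta>)"
      using Y(2)[OF that(1)] Y(2)[OF that(2)] by eventually_elim simp
  qed
  \<comment> \<open>the sections of the joint version are continuous, so the sharper bounds apply to them as they are\<close>
  have cont: "AE \<omega> in \<Omega>. \<forall>p\<in>?T. \<forall>e>0. \<exists>h>0. \<forall>q\<in>?T. resistance_max p q < h \<longrightarrow> dist (Y p \<omega>) (Y q \<omega>) < e"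
    using Y(3) by eventually_elim (simp add: ess_holder_on_def)
  have 1: "AE \<omega> in \<Omega>. ess_holder_on (1 / \<beta> * min \<gamma> \<gamma>') ?T resistance_max (\<lambda>p. Y p \<omega>)"
    using Y(3) by simp
  have 2: "AE \<omega> in \<Omega>. ess_holder_on (1 / \<beta> * (1 + \<gamma>)) F resistance (\<lambda>x. Y (t, x) \<omega>)" if t: "t \<in> {0..1}" for t
  proof -
    obtain K where "pseudometric_with_entropy F resistance K dim_H" by (rule resistance_pseudometric)
    then interpret sec: process_with_moments F resistance K dim_H \<Omega> "\<lambda>x. Y (t, x)" C \<beta> "dim_H + 1 + \<gamma>"
      unfolding process_with_moments_def process_with_moments_axioms_def using pos Y(1) t same_moment space by simp
    have "AE \<omega> in \<Omega>. \<forall>x\<in>F. \<forall>e>0. \<exists>h>0. \<forall>y\<in>F. resistance x y < h \<longrightarrow> dist (Y (t, x) \<omega>) (Y (t, y) \<omega>) < e"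
      using cont
    proof eventually_elim
      fix \<omega> assume H: "\<forall>p\<in>?T. \<forall>e>0. \<exists>h>0. \<forall>q\<in>?T. resistance_max p q < h \<longrightarrow> dist (Y p \<omega>) (Y q \<omega>) < e"
      show "\<forall>x\<in>F. \<forall>e>0. \<exists>h>0. \<forall>y\<in>F. resistance x y < h \<longrightarrow> dist (Y (t, x) \<omega>) (Y (t, y) \<omega>) < e"
      proof (intro ballI allI impI)
        fix x e assume x: "x \<in> F" and e: "0 < (e::real)"
        have "(t, x) \<in> ?T" using t x by simp
        with H e obtain h where "0 < h" "\<And>q. q \<in> ?T \<Longrightarrow> resistance_max (t, x) q < h \<Longrightarrow> dist (Y (t, x) \<omega>) (Y q \<omega>) < e" by blast
        then show "\<exists>h>0. \<forall>y\<in>F. resistance x y < h \<longrightarrow> dist (Y (t, x) \<omega>) (Y (t, y) \<omega>) < e"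
          using t by (intro exI[of _ h]) (simp add: resistance_max_pair)
      qed
    qed
    from sec.continuous_process_holder[OF this] show ?thesis by (simp add: algebra_simps)
  qed
  have 3: "AE \<omega> in \<Omega>. ess_holder_on (1 / \<beta> * (dim_H + \<gamma>')) {0..1} dist (\<lambda>t. Y (t, x) \<omega>)" if x: "x \<in> F" for x
  proof -
    interpret sec: process_with_moments "{0..1::real}" dist 2 1 \<Omega> "\<lambda>t. Y (t, x)" C \<beta> "dim_H + 1 + \<gamma>'"
      unfolding process_with_moments_def process_with_moments_axioms_def
      using unit_interval_pseudometric pos Y(1) x same_moment time dim_H_spec(1) by (simp add: dist_real_def)
    have "AE \<omega> in \<Omega>. \<forall>s\<in>{0..1}. \<forall>e>0. \<exists>h>0. \<forall>t\<in>{0..1}. dist s t < h \<longrightarrow> dist (Y (s, x) \<omega>) (Y (t, x) \<omega>) < e"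
      using cont
    proof eventually_elim
      fix \<omega> assume H: "\<forall>p\<in>?T. \<forall>e>0. \<exists>h>0. \<forall>q\<in>?T. resistance_max p q < h \<longrightarrow> dist (Y p \<omega>) (Y q \<omega>) < e"
      show "\<forall>s\<in>{0..1}. \<forall>e>0. \<exists>h>0. \<forall>t\<in>{0..1}. dist s t < h \<longrightarrow> dist (Y (s, x) \<omega>) (Y (t, x) \<omega>) < e"
      proof (intro ballI allI impI)
        fix s e assume s: "s \<in> {0..1::real}" and e: "0 < (e::real)"
        have "(s, x) \<in> ?T" using s x by simp
        with H e obtain h where h: "0 < h" "\<And>q. q \<in> ?T \<Longrightarrow> resistance_max (s, x) q < h \<Longrightarrow> dist (Y (s, x) \<omega>) (Y q \<omega>) < e" by blast
        have "dist (Y (s, x) \<omega>) (Y (t, x) \<omega>) < e" if "t \<in> {0..1}" "dist s t < h" for t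
          using that x h(1) by (intro h(2)) (auto simp: resistance_max_pair resistance_self dist_real_def)
        with h(1) show "\<exists>h>0. \<forall>t\<in>{0..1}. dist s t < h \<longrightarrow> dist (Y (s, x) \<omega>) (Y (t, x) \<omega>) < e" by blast
      qed
    qed
    note holder = sec.continuous_process_holder[OF this]
    have "(dim_H + 1 + \<gamma>' - 1) / \<beta> = 1 / \<beta> * (dim_H + \<gamma>')" by simp
    with holder show ?thesis by (simp only:)
  qed
  have "version_of \<Omega> ?T \<xi> Y" using Y(1,2) by (simp add: version_of_def stochastic_process_def)
  with 1 2 3 show ?thesis by (intro exI[of _ Y] conjI ballI)
qed

end
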